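(* Let $n\ge 1$, $r\ge 0$ be integers and let $\sigma\in H_n$. Then the rank $r$ and rank $r+1$ domino Robinson–Schensted maps are related by $$G_{r+1}(\sigma)=MMT\big(G_r(\sigma)\big).$$
   Context: Notation. $\mathbb{N}_n=\{1,\dots,n\}$. The hyperoctahedral group $H_n$ is realized as the set of subsets $\sigma\subset \mathbb{N}_n\times\mathbb{N}_n\times\{\pm1\}$ whose projections to the first and to the second factor are bijections onto $\mathbb{N}_n$; write $\sigma=\{(\sigma_1,1,\epsilon_1),\dots,(\sigma_n,n,\epsilon_n)\}$. Young diagrams are left-justified arrays of squares with non-increasing row lengths; $S_{i,j}$ is the square in row $i$ (rows counted from the top) and column $j$ (counted from the left). Domino tableaux. A domino tableau of rank $r$ is a Young diagram whose squares carry integer labels such that the label $0$ is carried exactly by the squares $S_{i,j}$ with $i+j<r+2$ (the core), every positive label labels exactly two adjacent squares (a domino), and labels weakly increase along rows and columns. It is standard if its positive labels are exactly $\mathbb{N}_m$; $SDT_r(m)$ is the set of standard rank $r$ domino tableaux with $m$ dominoes. $D(k,T)$ denotes the domino labeled $k$ in $T$, $supp\,D(k,T)$ its two squares. Insertion. Given $(i,j,\epsilon)\in\sigma$ and a rank $r$ domino tableau $T'$ whose positive labels $l_1<\dots<l_k$ do not include $i$, define $T=\alpha((i,j,\epsilon),T')$: (1) if $k=0$ or $i>l_k$, add a horizontal domino labeled $i$ at the end of the first row if $\epsilon=1$, or a vertical domino labeled $i$ at the end of the first column if $\epsilon=-1$. (2) Otherwise let $l_m$ be the least $l_p$ greater than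 $i$; let $T_{m-1}$ be $T'$ with all dominoes of labels $\ge l_m$ removed, $T_m=\alpha((i,j,\epsilon),T_{m-1})$ (by rule (1)), and for $p=m,\dots,k$: (a) if $supp\,D(l_p,T')$ is disjoint from $T_p$, $T_{p+1}$ is $T_p$ with $supp\,D(l_p,T')$ labeled $l_p$; (b) if $supp\,D(l_p,T')\cap T_p$ is a single square $S_{a,b}$, $T_{p+1}$ is $T_p$ with $\{S_{a,b+1},S_{a+1,b+1}\}$ labeled $l_p$ if $D(l_p,T')$ is horizontal, or with $\{S_{a+1,b},S_{a+1,b+1}\}$ labeled $l_p$ if it is vertical; (c) if $supp\,D(l_p,T')\subset T_p$, $T_{p+1}$ is $T_p$ with a horizontal domino labeled $l_p$ added at the end of row $\iota+1$ if $D(l_p,T')$ is horizontal in row $\iota$, or a vertical domino labeled $l_p$ added at the end of column $\iota+1$ if it is vertical in column $\iota$. Set $T=T_{k+1}$. The maps $G_r$. Let $T(0)=S(0)$ be the rank $r$ tableau with no dominoes (only the core). Put $T(k+1)=\alpha((\sigma_{k+1},k+1,\epsilon_{k+1}),T(k))$ and let $S(k+1)$ be $S(k)$ with the two squares of $T(k+1)$ not in $T(k)$ labeled $k+1$. Then $G_r(\sigma)=(T(n),S(n))$, a pair of same-shape tableaux in $SDT_r(n)$. Cycles. In a rank $r$ domino tableau, a square $S_{i,j}$ is fixed if $i+j$ has parity opposite to $r$, and variable otherwise; each domino has exactly one fixed square. Set $label\,S_{i,j}=0$ if $i\le0$ or $j\le 0$, and $label\,S_{i,j}=\infty$ if $i,j>0$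 but $S_{i,j}$ is not in the diagram. If $supp\,D(k,T)$ is $\{S_{i,j},S_{i+1,j}\}$ or $\{S_{i,j-1},S_{i,j}\}$ with $S_{i,j}$ fixed, let $supp\,D'(k,T)=\{S_{i,j},S_{i-1,j}\}$ if $k<label\,S_{i-1,j+1}$ and $\{S_{i,j},S_{i,j+1}\}$ if $k>label\,S_{i-1,j+1}$. If $supp\,D(k,T)$ is $\{S_{i,j},S_{i-1,j}\}$ or $\{S_{i,j+1},S_{i,j}\}$ with $S_{i,j}$ fixed, let $supp\,D'(k,T)=\{S_{i,j},S_{i,j-1}\}$ if $k<label\,S_{i+1,j-1}$ and $\{S_{i,j},S_{i+1,j}\}$ if $k>label\,S_{i+1,j-1}$; $D'(k,T)$ is this pair of squares labeled $k$. The cycle $c(k,T)$ is the smallest set of labels containing $k$ such that $l\in c$ whenever $supp\,D(l,T)\cap supp\,D'(m,T)\ne\emptyset$ or $supp\,D'(l,T)\cap supp\,D(m,T)\ne\emptyset$ for some $m\in c$. Cycles are identified with their dominoes. $MT(T,c)$ is obtained by replacing each $D(l,T)$, $l\in c$, by $D'(l,T)$; it is a domino tableau, and moving through a set $U$ of cycles (in any order) gives a well-defined $MT(T,U)$. The cycle is closed if $MT(T,c)$ has the same shape as $T$ and open otherwise; in that case one square $S_b(c)=S_b(c,T)$ covered by a domino of $c$ in $T$ is no longer covered (it is removed from the diagram or becomes a core square labeled $0$) and one square $S_f(c)=S_f(c,T)$ not in $T$ becomes covered. Extended cycles. Let $(T,S)$ be same-shape domino tableaux and $c$ a cycle in $T$.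 The extended cycle $\tilde c$ of $c$ in $T$ relative to $S$ is the smallest union of cycles of $T$ containing $c$ such that for cycles $c_1,c_2$ of $T$, if one of them is contained in $\tilde c$ and there is a cycle $d$ of $S$ with $S_b(d)$ a square of $c_1$ and $S_f(d)$ a square of $MT(T,c_2)$, then $c_1\cup c_2\subset\tilde c$. One can write $\tilde c=c_1\cup\dots\cup c_m$ with cycles $d_1,\dots,d_m$ of $S$ such that $S_b(c_i)=S_b(d_i)$, $S_f(d_m)=S_f(c_1)$, $S_f(d_i)=S_f(c_{i+1})$ for $i<m$; $\tilde d=d_1\cup\dots\cup d_m$ is the corresponding extended cycle in $S$ relative to $T$. For a pair $b=(\tilde c,\tilde d)$ of corresponding extended cycles, $MT((T,S),b)=(MT(T,\tilde c),MT(S,\tilde d))$, again a same-shape pair; for a family $B$ of such pairs, $MT((T,S),B)$ denotes moving through all of them. The map $MMT$. For a rank $r$ tableau $T$, $\delta(T)$ is the set of squares $S_{i,j}$ with $i+j=r+2$. For a same-shape pair $(T,S)$ of rank $r$, $\gamma(T)$ is the set of extended cycles in $T$ relative to $S$ through $\delta(T)$ (containing a domino meeting $\delta(T)$), and $\gamma(S)$ is the set of extended cycles in $S$ relative to $T$ through $\delta(S)$; with $\gamma=(\gamma(T),\gamma(S))$ set $MMT((T,S))=MT((T,S),\gamma)$, where the vacated squares of $\delta$ become core squares, giving a same-shape pair of rank $r+1$. *)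

theory Defs
  imports Main "HOL-Library.Extended_Nat"
begin

section \<open>Hyperoctahedral group\<close>

definition hyperoctahedral :: "nat \<Rightarrow> (nat \<times> nat \<times> int) set set" where
  "hyperoctahedral n = {\<sigma>. \<sigma> \<subseteq> {1..n} \<times> {1..n} \<times> {1, -1} \<and>
     bij_betw (\<lambda>(i, j, e). i) \<sigma> {1..n} \<and> bij_betw (\<lambda>(i, j, e). j) \<sigma> {1..n}}"

definition entry :: "(nat \<times> nat \<times> int) set \<Rightarrow> nat \<Rightarrow> nat \<times> nat \<times> int" where
  "entry \<sigma> k = (THE x. x \<in> \<sigma> \<and> fst (snd x) = k)"


section \<open>Tableaux\<close>

text \<open>A tableau is a partial labelling of squares (row, column), both counted from 1;
  its domain is the diagram. Integer coordinates let the neighbours in row or column 0 be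
  written without truncation. The rank is passed as a separate argument.\<close>

type_synonym square = "int \<times> int"
type_synonym tableau = "square \<Rightarrow> nat option"

definition core :: "nat \<Rightarrow> square set" where
  "core r = {(i, j). 1 \<le> i \<and> 1 \<le> j \<and> i + j < int r + 2}"

definition delta :: "nat \<Rightarrow> square set" where
  "delta r = {(i, j). 1 \<le> i \<and> 1 \<le> j \<and> i + j = int r + 2}"

definition core_tableau :: "nat \<Rightarrow> tableau" where
  "core_tableau r = (\<lambda>s. if s \<in> core r then Some 0 else None)"

definition labels :: "tableau \<Rightarrow> nat set" where
  "labels T = {k. 0 < k \<and> k \<in> ran T}"

definition supp :: "tableau \<Rightarrow> nat \<Rightarrow> square set" where
  "supp T k = {s. T s = Some k}"

definition put :: "square set \<Rightarrow> nat \<Rightarrow> tableau \<Rightarrow> tableau" where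
  "put X k T = (\<lambda>s. if s \<in> X then Some k else T s)"

definition horizontal :: "square set \<Rightarrow> bool" where
  "horizontal X \<longleftrightarrow> (\<exists>i j. X = {(i, j), (i, j + 1)})"


section \<open>Insertion\<close>

definition row_length :: "tableau \<Rightarrow> int \<Rightarrow> int" where
  "row_length T i = int (card {j. (i, j) \<in> dom T})"

definition col_length :: "tableau \<Rightarrow> int \<Rightarrow> int" where
  "col_length T j = int (card {i. (i, j) \<in> dom T})"

definition add_to_row :: "int \<Rightarrow> nat \<Rightarrow> tableau \<Rightarrow> tableau" where
  "add_to_row i k T = put {(i, row_length T i + 1), (i, row_length T i + 2)} k T"

definition add_to_col :: "int \<Rightarrow> nat \<Rightarrow> tableau \<Rightarrow> tableau" where
  "add_to_col j k T = put {(col_length T j + 1, j), (col_length T j + 2, j)} k T"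

definition add_first :: "nat \<Rightarrow> int \<Rightarrow> tableau \<Rightarrow> tableau" where
  "add_first i e T = (if e = 1 then add_to_row 1 i T else add_to_col 1 i T)"

definition remove_from :: "nat \<Rightarrow> tableau \<Rightarrow> tableau" where
  "remove_from l T = (\<lambda>s. case T s of None \<Rightarrow> None | Some k \<Rightarrow> if l \<le> k then None else Some k)"

text \<open>The passage from \<open>T\<^sub>p\<close> (here \<open>T\<close>) to \<open>T\<^sub>p\<^sub>+\<^sub>1\<close>, for the label \<open>l = l\<^sub>p\<close> of the original
  tableau \<open>T0\<close>.\<close>

definition bump :: "tableau \<Rightarrow> nat \<Rightarrow> tableau \<Rightarrow> tableau" where
  "bump T0 l T =
    (let D = supp T0 l in
     if D \<inter> dom T = {} then put D l T
     else if D \<subseteq> dom T then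
       (if horizontal D then add_to_row ((THE i. \<exists>j. (i, j) \<in> D) + 1) l T
        else add_to_col ((THE j. \<exists>i. (i, j) \<in> D) + 1) l T)
     else
       (let (a, b) = (THE s. s \<in> D \<inter> dom T) in
        if horizontal D then put {(a, b + 1), (a + 1, b + 1)} l T
        else put {(a + 1, b), (a + 1, b + 1)} l T))"

definition insert_domino :: "nat \<times> nat \<times> int \<Rightarrow> tableau \<Rightarrow> tableau" where
  "insert_domino = (\<lambda>(i, j, e) T0.
     if \<forall>l\<in>labels T0. l < i then add_first i e T0
     else
       (let m = Min {l \<in> labels T0. i < l} in
        fold (bump T0) (sorted_list_of_set {l \<in> labels T0. m \<le> l})
          (add_first i e (remove_from m T0))))"


section \<open>The maps \<open>G\<^sub>r\<close>\<close>

primrec left_tableau :: "nat \<Rightarrow> (nat \<times> nat \<times> int) set \<Rightarrow> nat \<Rightarrow> tableau" where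
  "left_tableau r \<sigma> 0 = core_tableau r"
| "left_tableau r \<sigma> (Suc k) = insert_domino (entry \<sigma> (Suc k)) (left_tableau r \<sigma> k)"

primrec right_tableau :: "nat \<Rightarrow> (nat \<times> nat \<times> int) set \<Rightarrow> nat \<Rightarrow> tableau" where
  "right_tableau r \<sigma> 0 = core_tableau r"
| "right_tableau r \<sigma> (Suc k) =
     put (dom (left_tableau r \<sigma> (Suc k)) - dom (left_tableau r \<sigma> k)) (Suc k) (right_tableau r \<sigma> k)"

definition G :: "nat \<Rightarrow> nat \<Rightarrow> (nat \<times> nat \<times> int) set \<Rightarrow> tableau \<times> tableau" where
  "G r n \<sigma> = (left_tableau r \<sigma> n, right_tableau r \<sigma> n)"


section \<open>Cycles\<close>

definition fixed :: "nat \<Rightarrow> square \<Rightarrow> bool" where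
  "fixed r = (\<lambda>(i, j). odd (i + j + int r))"

definition label :: "tableau \<Rightarrow> square \<Rightarrow> enat" where
  "label T = (\<lambda>(i, j). if i \<le> 0 \<or> j \<le> 0 then 0
     else case T (i, j) of None \<Rightarrow> \<infinity> | Some k \<Rightarrow> enat k)"

text \<open>\<open>supp' r T k\<close> is the support of \<open>D'(k, T)\<close>. The comparisons below are never equalities,
  since the inspected square is not in \<open>supp T k\<close>.\<close>

definition supp' :: "nat \<Rightarrow> tableau \<Rightarrow> nat \<Rightarrow> square set" where
  "supp' r T k =
    (let (i, j) = (THE s. s \<in> supp T k \<and> fixed r s) in
     if supp T k = {(i, j), (i + 1, j)} \<or> supp T k = {(i, j - 1), (i, j)}
     then (if enat k < label T (i - 1, j + 1) then {(i, j), (i - 1, j)} else {(i, j), (i, j + 1)})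
     else (if enat k < label T (i + 1, j - 1) then {(i, j), (i, j - 1)} else {(i, j), (i + 1, j)}))"

inductive_set cycle :: "nat \<Rightarrow> tableau \<Rightarrow> nat \<Rightarrow> nat set"
  for r :: nat and T :: tableau and k :: nat where
  start: "k \<in> cycle r T k"
| step: "m \<in> cycle r T k \<Longrightarrow> l \<in> labels T \<Longrightarrow>
     supp T l \<inter> supp' r T m \<noteq> {} \<or> supp' r T l \<inter> supp T m \<noteq> {} \<Longrightarrow> l \<in> cycle r T k"

definition cycles :: "nat \<Rightarrow> tableau \<Rightarrow> nat set set" where
  "cycles r T = cycle r T ` labels T"

definition squares :: "tableau \<Rightarrow> nat set \<Rightarrow> square set" where
  "squares T U = (\<Union>l\<in>U. supp T l)"

text \<open>Moving through a union \<open>U\<close> of cycles. The domino \<open>D'(l, T)\<close> depends only on labels of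
  fixed squares, which no move changes, so all the cycles in \<open>U\<close> are moved at once. A vacated
  square joins the core if it lies on the diagonal \<open>delta r\<close> next to the core, and leaves the
  diagram otherwise.\<close>

definition MT :: "nat \<Rightarrow> tableau \<Rightarrow> nat set \<Rightarrow> tableau" where
  "MT r T U = (\<lambda>s.
     if \<exists>l\<in>U. s \<in> supp' r T l then Some (THE l. l \<in> U \<and> s \<in> supp' r T l)
     else if s \<in> squares T U then (if s \<in> delta r then Some 0 else None)
     else T s)"

definition open_cycle :: "nat \<Rightarrow> tableau \<Rightarrow> nat set \<Rightarrow> bool" where
  "open_cycle r T c \<longleftrightarrow> dom (MT r T c) \<noteq> dom T"

definition S_b :: "nat \<Rightarrow> tableau \<Rightarrow> nat set \<Rightarrow> square" where
  "S_b r T c = (THE s. s \<in> squares T c \<and> (MT r T c s = None \<or> MT r T c s = Some 0))"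

definition S_f :: "nat \<Rightarrow> tableau \<Rightarrow> nat set \<Rightarrow> square" where
  "S_f r T c = (THE s. s \<notin> dom T \<and> s \<in> dom (MT r T c))"


section \<open>Extended cycles and the map \<open>MMT\<close>\<close>

definition linked :: "nat \<Rightarrow> tableau \<Rightarrow> tableau \<Rightarrow> nat set \<Rightarrow> nat set \<Rightarrow> bool" where
  "linked r T S c1 c2 \<longleftrightarrow> (\<exists>d\<in>cycles r S. open_cycle r S d \<and>
     S_b r S d \<in> squares T c1 \<and> S_f r S d \<in> dom (MT r T c2))"

definition extended_cycle :: "nat \<Rightarrow> tableau \<Rightarrow> tableau \<Rightarrow> nat set \<Rightarrow> nat set" where
  "extended_cycle r T S c = \<Inter>{U. (\<exists>C\<subseteq>cycles r T. U = \<Union>C) \<and> c \<subseteq> U \<and>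
     (\<forall>c1\<in>cycles r T. \<forall>c2\<in>cycles r T.
        (c1 \<subseteq> U \<or> c2 \<subseteq> U) \<and> linked r T S c1 c2 \<longrightarrow> c1 \<union> c2 \<subseteq> U)}"

definition extended_cycles :: "nat \<Rightarrow> tableau \<Rightarrow> tableau \<Rightarrow> nat set set" where
  "extended_cycles r T S = extended_cycle r T S ` cycles r T"

definition \<gamma> :: "nat \<Rightarrow> tableau \<Rightarrow> tableau \<Rightarrow> nat set set" where
  "\<gamma> r T S = {U \<in> extended_cycles r T S. squares T U \<inter> delta r \<noteq> {}}"

text \<open>The core of rank \<open>r + 1\<close> also contains the squares of \<open>delta r\<close> lying outside the
  diagram; they cannot be vacated, so they are added here.\<close>

definition complete_core :: "nat \<Rightarrow> tableau \<Rightarrow> tableau" where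
  "complete_core r T = (\<lambda>s. if s \<in> delta r \<and> T s = None then Some 0 else T s)"

definition MMT :: "nat \<Rightarrow> tableau \<times> tableau \<Rightarrow> tableau \<times> tableau" where
  "MMT r = (\<lambda>(T, S).
     (complete_core r (MT r T (\<Union>(\<gamma> r T S))), complete_core r (MT r S (\<Union>(\<gamma> r S T)))))"

end

theory Submission
  imports Defs
begin

text \<open>Recording the shape of the labels at most \<open>i\<close> after \<open>j\<close> insertions turns the algorithm into a growth
  diagram on an \<open>n \<times> n\<close> grid. By induction over its cells, the shapes of ranks \<open>r\<close> and \<open>r + 1\<close> at a grid
  point have the same squares that are fixed for rank \<open>r\<close>, so they differ by flipping variable
  corners and holes, and the rank \<open>r + 1\<close> diagram is obtained from the rank \<open>r\<close> one by moving through some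
  set of cycles. The induction works only if one also knows that along every lattice path from the
  top left to the bottom right corner of the grid the flipped squares are as few as possible, given
  that at both ends the core of rank \<open>r\<close> is flipped to that of rank \<open>r + 1\<close>. On the path that follows the
  two boundaries giving \<open>T\<close> and \<open>S\<close>, the possible flips are the pairs of unions of cycles of \<open>T\<close> and \<open>S\<close>
  that contain all cycles through \<open>delta r\<close> and match at their common final shape; the least such pair
  consists of the extended cycles through \<open>delta r\<close>.\<close>

section \<open>Shapes, dominoes and twins\<close>

text \<open>The obstacle is that the local rule alone does not carry twins to twins. When both
  dominoes of a cell share the fixed square \<open>(i, j)\<close> and neither
  \<open>(i - 1, j + 1)\<close> nor \<open>(i + 1, j - 1)\<close> lies in \<open>A\<close>, the
  fixed squares leave open whether the domino is horizontal or vertical. The two orientations bump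
  into row \<open>i + 1\<close> or into column \<open>j + 1\<close>, after which the ranks would no
  longer share their fixed squares. But different orientations there mean a flipped square at the
  near corner of the cell that could be restored without changing the neighbouring shapes, and
  minimality forbids this (\<open>minimal_flip\<close>). Minimality in turn survives the crossing of
  a cell for two reasons: every competitor of the new path pulls back to a competitor of the old one
  (\<open>cell_pullback\<close>), and a flip that the competitor lacks could only arise as a pair
  right of and below the new fixed square, which the cell rules exclude
  (\<open>cell_forward\<close>). One path through both boundaries treats \<open>T\<close> and
  \<open>S\<close> together: its middle vertex is their common shape, and this coupling is what
  turns cycles into extended cycles.\<close>

text \<open>Shapes are down-closed subsets of the whole of \<open>\<int> \<times> \<int>\<close>, containing every square with a nonpositive
  coordinate; this removes all boundary cases.\<close>

definition ideal :: "square set \<Rightarrow> bool" where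
  "ideal A \<longleftrightarrow> (\<forall>i j i' j'. (i, j) \<in> A \<longrightarrow> i' \<le> i \<longrightarrow> j' \<le> j \<longrightarrow> (i', j') \<in> A)"

lemma idealD: "ideal A \<Longrightarrow> (i, j) \<in> A \<Longrightarrow> i' \<le> i \<Longrightarrow> j' \<le> j \<Longrightarrow> (i', j') \<in> A"
  unfolding ideal_def by blast

definition nbrs :: "int \<Rightarrow> int \<Rightarrow> square set" where
  "nbrs i j = {(i - 1, j), (i + 1, j), (i, j - 1), (i, j + 1)}"

text \<open>The fixed square of the added domino is an explicit argument because it survives the
  passage to a twin: a domino and its moved version have the same \<open>i\<close> and
  \<open>j\<close> and differ only in \<open>v\<close>.\<close>

definition fstep :: "nat \<Rightarrow> square set \<Rightarrow> int \<Rightarrow> int \<Rightarrow> square \<Rightarrow> square set \<Rightarrow> bool" where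
  "fstep r A i j v B \<longleftrightarrow> ideal A \<and> ideal B \<and> fixed r (i, j) \<and> v \<in> nbrs i j \<and>
     (i, j) \<notin> A \<and> v \<notin> A \<and> B = insert (i, j) (insert v A)"

text \<open>Twins differ only in variable squares. A chain of twins of a given chain of shapes amounts to a
  choice, for each domino, between \<open>D(k, T)\<close> and \<open>D'(k, T)\<close>.\<close>

definition twin :: "nat \<Rightarrow> square set \<Rightarrow> square set \<Rightarrow> bool" where
  "twin r A B \<longleftrightarrow> ideal A \<and> ideal B \<and> (\<forall>s. fixed r s \<longrightarrow> (s \<in> A \<longleftrightarrow> s \<in> B))"

text \<open>Equality is allowed because neighbouring grid points carry the same shape while a label
  has not yet been inserted.\<close>

definition step :: "nat \<Rightarrow> square set \<Rightarrow> square set \<Rightarrow> bool" where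
  "step r A B \<longleftrightarrow> ideal A \<and> ideal B \<and> (A = B \<or> (\<exists>i j v. fstep r A i j v B))"

definition flips :: "square set \<Rightarrow> square set \<Rightarrow> square set" where
  "flips A B = (A - B) \<union> (B - A)"

lemma fstepD:
  assumes "fstep r A i j v B"
  shows "ideal A" "ideal B" "fixed r (i, j)" "v \<in> nbrs i j" "(i, j) \<notin> A" "v \<notin> A"
    "B = insert (i, j) (insert v A)"
  using assms unfolding fstep_def by auto

lemma fixed_iff: "fixed r (i, j) \<longleftrightarrow> odd (i + j + int r)"
  by (simp add: fixed_def)

lemma fixed_shift [simp]:
  "fixed r (i + 1, j) \<longleftrightarrow> \<not> fixed r (i, j)" "fixed r (i - 1, j) \<longleftrightarrow> \<not> fixed r (i, j)"
  "fixed r (i, j + 1) \<longleftrightarrow> \<not> fixed r (i, j)" "fixed r (i, j - 1) \<longleftrightarrow> \<not> fixed r (i, j)"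
  "fixed r (i + 2, j) \<longleftrightarrow> fixed r (i, j)" "fixed r (i - 2, j) \<longleftrightarrow> fixed r (i, j)"
  "fixed r (i, j + 2) \<longleftrightarrow> fixed r (i, j)" "fixed r (i, j - 2) \<longleftrightarrow> fixed r (i, j)"
  by (auto simp: fixed_iff)

lemma fstep_var_not_fixed: "fstep r A i j v B \<Longrightarrow> \<not> fixed r v"
  unfolding fstep_def nbrs_def by auto

lemma fstep_fixed_mem: "fstep r A i j v B \<Longrightarrow> fixed r s \<Longrightarrow> s \<in> B \<longleftrightarrow> s \<in> A \<or> s = (i, j)"
  using fstep_var_not_fixed[of r A i j v B] unfolding fstep_def by auto

text \<open>The fixed squares alone confine \<open>v\<close> to two of the four neighbours of \<open>(i, j)\<close>: one of right and up,
  decided by \<open>(i - 1, j + 1)\<close>, and one of down and left, decided by \<open>(i + 1, j - 1)\<close>.\<close>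

lemma fstep_types:
  assumes f: "fstep r A i j v B"
  shows "(i - 1, j + 1) \<in> A \<Longrightarrow> (i + 1, j - 1) \<in> A \<Longrightarrow>
      (v = (i, j + 1) \<or> v = (i + 1, j)) \<and> (i, j - 1) \<in> A \<and> (i - 1, j) \<in> A"
    "(i - 1, j + 1) \<in> A \<Longrightarrow> (i + 1, j - 1) \<notin> A \<Longrightarrow>
      v = (if (i, j - 1) \<in> A then (i, j + 1) else (i, j - 1)) \<and> (i - 1, j) \<in> A \<and> (i + 1, j) \<notin> B"
    "(i - 1, j + 1) \<notin> A \<Longrightarrow> (i + 1, j - 1) \<in> A \<Longrightarrow>
      v = (if (i - 1, j) \<in> A then (i + 1, j) else (i - 1, j)) \<and> (i, j - 1) \<in> A \<and> (i, j + 1) \<notin> B"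
    "(i - 1, j + 1) \<notin> A \<Longrightarrow> (i + 1, j - 1) \<notin> A \<Longrightarrow>
      (v = (i, j - 1) \<and> (i - 1, j) \<in> A \<or> v = (i - 1, j) \<and> (i, j - 1) \<in> A) \<and>
      (i + 1, j) \<notin> B \<and> (i, j + 1) \<notin> B"
proof -
  note d = fstepD[OF f]
  have B: "s \<in> B \<longleftrightarrow> s = (i, j) \<or> s = v \<or> s \<in> A" for s using d(7) by auto
  have v: "v = (i - 1, j) \<or> v = (i + 1, j) \<or> v = (i, j - 1) \<or> v = (i, j + 1)"
    using d(4) unfolding nbrs_def by auto
  have U: "(i - 1, j) \<in> B" and L: "(i, j - 1) \<in> B"
    using idealD[OF d(2), of i j "i - 1" j] idealD[OF d(2), of i j i "j - 1"] B[of "(i, j)"] by auto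
  have Dn: "(i + 1, j) \<notin> A" "(i, j + 1) \<notin> A"
    using idealD[OF d(1), of "i+1" j i j] idealD[OF d(1), of i "j+1" i j] d(5) by auto
  have ur: "(i - 1, j + 1) \<in> B \<longleftrightarrow> (i - 1, j + 1) \<in> A" and dl: "(i + 1, j - 1) \<in> B \<longleftrightarrow> (i + 1, j - 1) \<in> A"
    using B v by auto
  have R: "(i, j + 1) \<in> B \<Longrightarrow> (i - 1, j + 1) \<in> A" using idealD[OF d(2), of i "j+1" "i-1" "j+1"] ur by auto
  have D: "(i + 1, j) \<in> B \<Longrightarrow> (i + 1, j - 1) \<in> A" using idealD[OF d(2), of "i+1" j "i+1" "j-1"] dl by auto
  have a: "(i - 1, j + 1) \<in> A \<Longrightarrow> (i - 1, j) \<in> A" using idealD[OF d(1), of "i-1" "j+1" "i-1" j] by auto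
  have b: "(i + 1, j - 1) \<in> A \<Longrightarrow> (i, j - 1) \<in> A" using idealD[OF d(1), of "i+1" "j-1" i "j-1"] by auto
  have vB: "v \<in> B" using B by auto
  show "(i - 1, j + 1) \<in> A \<Longrightarrow> (i + 1, j - 1) \<in> A \<Longrightarrow>
      (v = (i, j + 1) \<or> v = (i + 1, j)) \<and> (i, j - 1) \<in> A \<and> (i - 1, j) \<in> A"
    using v a b d(6) by metis
  show "(i - 1, j + 1) \<in> A \<Longrightarrow> (i + 1, j - 1) \<notin> A \<Longrightarrow>
      v = (if (i, j - 1) \<in> A then (i, j + 1) else (i, j - 1)) \<and> (i - 1, j) \<in> A \<and> (i + 1, j) \<notin> B"
    using v a b d(6) vB D L B[of "(i, j - 1)"] by (elim disjE) auto
  show "(i - 1, j + 1) \<notin> A \<Longrightarrow> (i + 1, j - 1) \<in> A \<Longrightarrow>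
      v = (if (i - 1, j) \<in> A then (i + 1, j) else (i - 1, j)) \<and> (i, j - 1) \<in> A \<and> (i, j + 1) \<notin> B"
    using v a b d(6) vB R U B[of "(i - 1, j)"] by (elim disjE) auto
  show "(i - 1, j + 1) \<notin> A \<Longrightarrow> (i + 1, j - 1) \<notin> A \<Longrightarrow>
      (v = (i, j - 1) \<and> (i - 1, j) \<in> A \<or> v = (i - 1, j) \<and> (i, j - 1) \<in> A) \<and>
      (i + 1, j) \<notin> B \<and> (i, j + 1) \<notin> B"
    using v R D U L B[of "(i - 1, j)"] B[of "(i, j - 1)"] d(6) vB by (elim disjE) auto
qed

text \<open>A flipped square is created from nothing only as one of a pair right and below \<open>(i, j)\<close>.\<close>

lemma fstep_pushes_flips:
  assumes f: "fstep r A i j v B" "fstep r A' i j v' B'" "fstep r A'' i j v'' B''"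
    and t: "twin r A A'" "twin r A A''"
    and sub: "flips A A' \<subseteq> flips A A''" and s: "s \<in> flips B B'" "s \<notin> flips B B''"
  shows "(i - 1, j + 1) \<in> A" "(i + 1, j - 1) \<in> A" "s = (i, j + 1) \<or> s = (i + 1, j)"
    "(i, j + 1) \<in> flips B B'" "(i + 1, j) \<in> flips B B'"
    "(i, j + 1) \<notin> flips B B''" "(i + 1, j) \<notin> flips B B''"
proof -
  have fx: "fixed r (i - 1, j + 1)" "fixed r (i + 1, j - 1)" using fstepD(3)[OF f(1)] by auto
  have p: "(i - 1, j + 1) \<in> A' \<longleftrightarrow> (i - 1, j + 1) \<in> A" "(i - 1, j + 1) \<in> A'' \<longleftrightarrow> (i - 1, j + 1) \<in> A"
    "(i + 1, j - 1) \<in> A' \<longleftrightarrow> (i + 1, j - 1) \<in> A" "(i + 1, j - 1) \<in> A'' \<longleftrightarrow> (i + 1, j - 1) \<in> A"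
    using t fx unfolding twin_def by blast+
  have n: "(i + 1, j) \<notin> X" "(i, j + 1) \<notin> X" if "fstep r X i j w Y" for X Y w
    using that idealD[of X "i+1" j i j] idealD[of X i "j+1" i j] unfolding fstep_def by auto
  have B: "B = insert (i, j) (insert v A)" "B' = insert (i, j) (insert v' A')" "B'' = insert (i, j) (insert v'' A'')"
    "v \<notin> A" "v' \<notin> A'" "v'' \<notin> A''"
    using f unfolding fstep_def by auto
  note n1 = n[OF f(1)] n[OF f(2)] n[OF f(3)]
  have ss: "s' \<in> flips A A' \<Longrightarrow> s' \<in> flips A A''" for s' using sub by auto
  have main: "(i - 1, j + 1) \<in> A \<and> (i + 1, j - 1) \<in> A \<and> (s = (i, j + 1) \<or> s = (i + 1, j)) \<and>
    (i, j + 1) \<in> flips B B' \<and> (i + 1, j) \<in> flips B B' \<and>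
    (i, j + 1) \<notin> flips B B'' \<and> (i + 1, j) \<notin> flips B B''"
  proof (cases "(i - 1, j + 1) \<in> A"; cases "(i + 1, j - 1) \<in> A")
    assume h: "(i - 1, j + 1) \<in> A" "(i + 1, j - 1) \<in> A"
    note e = fstep_types(1)[OF f(1)] fstep_types(1)[OF f(2)] fstep_types(1)[OF f(3)]
    show ?thesis using h e p n1 B s ss[of s] unfolding flips_def by auto
  next
    assume h: "(i - 1, j + 1) \<in> A" "(i + 1, j - 1) \<notin> A"
    note e = fstep_types(2)[OF f(1)] fstep_types(2)[OF f(2)] fstep_types(2)[OF f(3)]
    show ?thesis using h e p n1 B s ss[of s] ss[of "(i, j - 1)"] unfolding flips_def by (auto split: if_splits)
  next
    assume h: "(i - 1, j + 1) \<notin> A" "(i + 1, j - 1) \<in> A"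
    note e = fstep_types(3)[OF f(1)] fstep_types(3)[OF f(2)] fstep_types(3)[OF f(3)]
    show ?thesis using h e p n1 B s ss[of s] ss[of "(i - 1, j)"] unfolding flips_def by (auto split: if_splits)
  next
    assume h: "(i - 1, j + 1) \<notin> A" "(i + 1, j - 1) \<notin> A"
    note e = fstep_types(4)[OF f(1)] fstep_types(4)[OF f(2)] fstep_types(4)[OF f(3)]
    show ?thesis using h e p n1 B s ss[of s] unfolding flips_def by auto
  qed
  then show "(i - 1, j + 1) \<in> A" "(i + 1, j - 1) \<in> A" "s = (i, j + 1) \<or> s = (i + 1, j)"
    "(i, j + 1) \<in> flips B B'" "(i + 1, j) \<in> flips B B'"
    "(i, j + 1) \<notin> flips B B''" "(i + 1, j) \<notin> flips B B''" by auto
qed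

section \<open>Growth cells\<close>

lemma ideal_insert:
  assumes "ideal A" "(i - 1, j) \<in> A" "(i, j - 1) \<in> A"
  shows "ideal (insert (i, j) A)"
  unfolding ideal_def
proof (intro allI impI)
  fix a b a' b' assume h: "(a, b) \<in> insert (i, j) A" "a' \<le> a" "b' \<le> b"
  show "(a', b') \<in> insert (i, j) A"
  proof (cases "(a, b) \<in> A")
    case True then show ?thesis using h assms(1) idealD by blast
  next
    case False
    then have ab: "a = i" "b = j" using h by auto
    consider "a' = i \<and> b' = j" | "a' \<le> i - 1" | "b' \<le> j - 1" using h ab by linarith
    then show ?thesis
      using idealD[OF assms(1,2), of a' b'] idealD[OF assms(1,3), of a' b'] h ab by cases auto
  qed
qed

lemma ideal_remove:
  assumes "ideal A" "(i + 1, j) \<notin> A" "(i, j + 1) \<notin> A"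
  shows "ideal (A - {(i, j)})"
  unfolding ideal_def
proof (intro allI impI)
  fix a b a' b' assume h: "(a, b) \<in> A - {(i, j)}" "a' \<le> a" "b' \<le> b"
  have "(a', b') \<noteq> (i, j)"
  proof
    assume e: "(a', b') = (i, j)"
    then have "a \<ge> i + 1 \<or> b \<ge> j + 1" using h by auto
    then show False using idealD[OF assms(1), of a b "i+1" j] idealD[OF assms(1), of a b i "j+1"] h e assms by auto
  qed
  then show "(a', b') \<in> A - {(i, j)}" using h idealD[OF assms(1)] by blast
qed

lemma ideal_Un: "ideal A \<Longrightarrow> ideal B \<Longrightarrow> ideal (A \<union> B)"
  unfolding ideal_def by blast

lemma ideal_Int: "ideal A \<Longrightarrow> ideal B \<Longrightarrow> ideal (A \<inter> B)"
  unfolding ideal_def by blast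

text \<open>\<open>cell e A B C D\<close> is the local rule of the growth diagram: \<open>B\<close> and \<open>C\<close> extend \<open>A\<close> by at most one domino
  in the two directions, and \<open>D\<close> is opposite to \<open>A\<close>; \<open>e\<close> is the sign of the entry of the cell, or \<open>0\<close>.\<close>

inductive cell :: "int \<Rightarrow> square set \<Rightarrow> square set \<Rightarrow> square set \<Rightarrow> square set \<Rightarrow> bool" where
  same_left: "cell 0 A A C C"
| same_right: "cell 0 A B A B"
| row_entry: "(1, m) \<notin> A \<Longrightarrow> (1, m - 1) \<in> A \<Longrightarrow> cell 1 A A A (A \<union> {(1, m), (1, m + 1)})"
| col_entry: "(m, 1) \<notin> A \<Longrightarrow> (m - 1, 1) \<in> A \<Longrightarrow> cell (- 1) A A A (A \<union> {(m, 1), (m + 1, 1)})"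
| disjoint: "X \<inter> Y = {} \<Longrightarrow> X \<inter> A = {} \<Longrightarrow> Y \<inter> A = {} \<Longrightarrow> cell 0 A (A \<union> X) (A \<union> Y) (A \<union> X \<union> Y)"
| overlap: "X \<inter> Y = {(a, b)} \<Longrightarrow> X \<inter> A = {} \<Longrightarrow> Y \<inter> A = {} \<Longrightarrow>
    cell 0 A (A \<union> X) (A \<union> Y) (insert (a + 1, b + 1) (A \<union> X \<union> Y))"
| rows: "X = {(a, b), (a, b + 1)} \<Longrightarrow> X \<inter> A = {} \<Longrightarrow> (a + 1, m) \<notin> A \<Longrightarrow> (a + 1, m - 1) \<in> A \<Longrightarrow>
    cell 0 A (A \<union> X) (A \<union> X) (A \<union> X \<union> {(a + 1, m), (a + 1, m + 1)})"
| cols: "X = {(a, b), (a + 1, b)} \<Longrightarrow> X \<inter> A = {} \<Longrightarrow> (m, b + 1) \<notin> A \<Longrightarrow> (m - 1, b + 1) \<in> A \<Longrightarrow>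
    cell 0 A (A \<union> X) (A \<union> X) (A \<union> X \<union> {(m, b + 1), (m + 1, b + 1)})"

lemma cell_cases:
  assumes B: "fstep r A i j v B" and C: "fstep r A i' j' w C" and c: "cell e A B C D"
  obtains (disjoint) "{(i, j), v} \<inter> {(i', j'), w} = {}" "D = B \<union> C"
  | (overlap) a b where "{(i, j), v} \<inter> {(i', j'), w} = {(a, b)}" "D = insert (a + 1, b + 1) (B \<union> C)"
  | (rows) a b m where "{(i, j), v} = {(i', j'), w}" "{(i, j), v} = {(a, b), (a, b + 1)}"
      "(a + 1, m) \<notin> A" "(a + 1, m - 1) \<in> A" "D = insert (a + 1, m + 1) (insert (a + 1, m) B)"
  | (cols) a b m where "{(i, j), v} = {(i', j'), w}" "{(i, j), v} = {(a, b), (a + 1, b)}"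
      "(m, b + 1) \<notin> A" "(m - 1, b + 1) \<in> A" "D = insert (m + 1, b + 1) (insert (m, b + 1) B)"
proof -
  have BA: "B = A \<union> {(i, j), v}" "{(i, j), v} \<inter> A = {}" using B unfolding fstep_def by auto
  have CA: "C = A \<union> {(i', j'), w}" "{(i', j'), w} \<inter> A = {}" using C unfolding fstep_def by auto
  have X: "X = {(i, j), v}" if "B = A \<union> X" "X \<inter> A = {}" for X using that BA by blast
  have Y: "X = {(i', j'), w}" if "C = A \<union> X" "X \<inter> A = {}" for X using that CA by blast
  have ne: "A \<noteq> B" "A \<noteq> C" using BA CA by auto
  from c show thesis
  proof cases
    case (disjoint X Y)
    then show thesis using that(1) X[of X] Y[of Y] by auto
  next
    case (overlap X Y a b)
    show thesis
    proof (rule that(2))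
      show "{(i, j), v} \<inter> {(i', j'), w} = {(a, b)}" using overlap X[of X] Y[of Y] by auto
      show "D = insert (a + 1, b + 1) (B \<union> C)" using overlap by auto
    qed
  next
    case (rows X a b m)
    have e: "X = {(i, j), v}" "X = {(i', j'), w}" using X[of X] Y[of X] rows by auto
    show thesis using that(3)[of a b m] rows e by (simp add: insert_commute)
  next
    case (cols X a b m)
    have e: "X = {(i, j), v}" "X = {(i', j'), w}" using X[of X] Y[of X] cols by auto
    show thesis using that(4)[of a b m] cols e by (simp add: insert_commute)
  qed (use ne in auto)
qed

text \<open>Dominoes with different fixed squares cannot coincide, so only the rules
  \<open>disjoint\<close> and \<open>overlap\<close> remain. In an overlap the shared square is the
  variable square of both, and \<open>(a + 1, b + 1)\<close>, of the same parity, takes its place.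
  In either case both fixed squares persist.\<close>

lemma cell_distinct_fixed:
  assumes B: "fstep r A i j v B" and C: "fstep r A i' j' w C" and c: "cell e A B C D"
    and ne: "(i, j) \<noteq> (i', j')"
  shows "(\<exists>w'. fstep r B i' j' w' D) \<and> (\<exists>v'. fstep r C i j v' D)"
proof -
  note b = fstepD[OF B] and cc = fstepD[OF C]
  have nf: "\<not> fixed r v" "\<not> fixed r w" using fstep_var_not_fixed B C by blast+
  then have ne2: "(i, j) \<noteq> w" "(i', j') \<noteq> v" using b(3) cc(3) by auto
  from B C c show ?thesis
  proof (cases rule: cell_cases)
    case disjoint
    have e: "D = insert (i', j') (insert w B)" "D = insert (i, j) (insert v C)"
      unfolding disjoint(2) using b(7) cc(7) by auto
    have n: "(i', j') \<notin> B" "w \<notin> B" "(i, j) \<notin> C" "v \<notin> C"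
      using disjoint(1) b(5-7) cc(5-7) by auto
    have D: "ideal D" using ideal_Un[OF b(2) cc(2)] disjoint(2) by simp
    have "fstep r B i' j' w D" "fstep r C i j v D" unfolding fstep_def
      using e n D b(2-4) cc(2-4) by blast+
    then show ?thesis by blast
  next
    case (overlap a d)
    have "(a, d) \<in> {(i, j), v}" "(a, d) \<in> {(i', j'), w}" using overlap(1) by blast+
    then have vw: "v = (a, d)" "w = (a, d)" using ne ne2 by auto
    have 1: "(a - 1, d) \<in> B" "(a, d - 1) \<in> B" "(a - 1, d) \<in> C" "(a, d - 1) \<in> C"
      using idealD[OF b(2), of a d "a-1" d] idealD[OF b(2), of a d a "d-1"]
        idealD[OF cc(2), of a d "a-1" d] idealD[OF cc(2), of a d a "d-1"] vw b(7) cc(7) by auto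
    have n: "(i, j) \<notin> C" "(i', j') \<notin> B" using b(5,7) cc(5,7) ne ne2 by auto
    from n have 2: "(i, j) = (a + 1, d) \<or> (i, j) = (a, d + 1)" "(i', j') = (a + 1, d) \<or> (i', j') = (a, d + 1)"
      using 1 b(4) cc(4) vw unfolding nbrs_def by auto
    have D: "ideal D" unfolding overlap(2)
    proof (rule ideal_insert[OF ideal_Un[OF b(2) cc(2)]])
      have "(i, j) \<in> B" "(i', j') \<in> C" using b(7) cc(7) by auto
      then show "(a + 1 - 1, d + 1) \<in> B \<union> C" "(a + 1, d + 1 - 1) \<in> B \<union> C" using 2 ne by auto
    qed
    have "(a + 1, d + 1) \<notin> A" using idealD[OF b(1), of "a+1" "d+1" a d] b(6) vw by auto
    then have n: "(a + 1, d + 1) \<notin> B" "(a + 1, d + 1) \<notin> C" using b(7) cc(7) vw 2 by auto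
    have e: "D = insert (i', j') (insert (a + 1, d + 1) B)" "D = insert (i, j) (insert (a + 1, d + 1) C)"
      unfolding overlap(2) using b(7) cc(7) vw by auto
    have nb: "(a + 1, d + 1) \<in> nbrs i' j'" "(a + 1, d + 1) \<in> nbrs i j" using 2 unfolding nbrs_def by auto
    have "fstep r B i' j' (a + 1, d + 1) D" "fstep r C i j (a + 1, d + 1) D"
      unfolding fstep_def using e nb n D b(2,3) cc(2,3) \<open>(i, j) \<notin> C\<close> \<open>(i', j') \<notin> B\<close> by blast+
    then show ?thesis by blast
  next
    case rows
    have "(i, j) \<in> {(i', j'), w}" unfolding rows(1)[symmetric] by simp
    then show ?thesis using ne ne2 by simp
  next
    case cols
    have "(i, j) \<in> {(i', j'), w}" unfolding cols(1)[symmetric] by simp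
    then show ?thesis using ne ne2 by simp
  qed
qed

text \<open>The new fixed square \<open>(k, l)\<close> is described by fixed squares of
  \<open>A\<close> only, so that the description can be compared with that of a twin:
  \<open>(i + 1, l - 2)\<close> is the fixed square preceding \<open>(i + 1, l)\<close> in its row,
  so \<open>l\<close> marks the first fixed square of that row outside \<open>A\<close>; columns are
  treated alike.\<close>

lemma cell_same_fixed:
  assumes B: "fstep r A i j v B" and C: "fstep r A i j w C" and c: "cell e A B C D"
  obtains k l u u' where "fstep r B k l u D" "fstep r C k l u' D"
    "(i - 1, j + 1) \<in> A \<and> (i + 1, j - 1) \<in> A \<and> k = i + 1 \<and> l = j + 1 \<or>
     (v = (i, j - 1) \<or> v = (i, j + 1)) \<and> k = i + 1 \<and> (i + 1, l) \<notin> A \<and> (i + 1, l - 2) \<in> A \<and>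
       (u = (k, l - 1) \<or> u = (k, l + 1)) \<or>
     (v = (i - 1, j) \<or> v = (i + 1, j)) \<and> l = j + 1 \<and> (k, j + 1) \<notin> A \<and> (k - 2, j + 1) \<in> A \<and>
       (u = (k - 1, l) \<or> u = (k + 1, l))"
proof -
  note b = fstepD[OF B] and cc = fstepD[OF C]
  have nf: "\<not> fixed r v" "\<not> fixed r w" using fstep_var_not_fixed B C by blast+
  then have ne2: "(i, j) \<noteq> w" "(i, j) \<noteq> v" using b(3) by auto
  from B C c show thesis
  proof (cases rule: cell_cases)
    case disjoint then show ?thesis by auto
  next
    case (overlap a d)
    have "(i, j) \<in> {(i, j), v} \<inter> {(i, j), w}" by simp
    then have vw2: "(a, d) = (i, j)" unfolding overlap(1) by simp
    have "v \<noteq> w"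
    proof
      assume "v = w"
      then have "v \<in> {(i, j), v} \<inter> {(i, j), w}" by simp
      then show False unfolding overlap(1) using vw2 ne2 by simp
    qed
    note vw = this vw2
    \<comment> \<open>Two different variable squares for the same fixed square exist only if both
      diagonal neighbours lie in \<open>A\<close>; the overlap then fills the two-by-two block with
      corner \<open>(i, j)\<close>.\<close>
    have p: "(i - 1, j + 1) \<in> A" "(i + 1, j - 1) \<in> A"
    proof -
      have "(i - 1, j + 1) \<in> A \<and> (i + 1, j - 1) \<in> A"
      proof (rule ccontr)
        assume n: "\<not> ?thesis"
        then consider "(i - 1, j + 1) \<in> A" "(i + 1, j - 1) \<notin> A" | "(i - 1, j + 1) \<notin> A" "(i + 1, j - 1) \<in> A"
          | "(i - 1, j + 1) \<notin> A" "(i + 1, j - 1) \<notin> A" by blast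
        then show False
        proof cases
          case 1 then show ?thesis using fstep_types(2)[OF B] fstep_types(2)[OF C] vw(1) by simp
        next
          case 2 then show ?thesis using fstep_types(3)[OF B] fstep_types(3)[OF C] vw(1) by simp
        next
          case 3 then show ?thesis using fstep_types(4)[OF B] fstep_types(4)[OF C] vw(1) b(6) cc(6) by auto
        qed
      qed
      then show "(i - 1, j + 1) \<in> A" "(i + 1, j - 1) \<in> A" by auto
    qed
    have e: "v = (i, j + 1) \<and> w = (i + 1, j) \<or> w = (i, j + 1) \<and> v = (i + 1, j)"
      using fstep_types(1)[OF B p] fstep_types(1)[OF C p] vw(1) by auto
    have D: "ideal D" unfolding overlap(2)
      by (rule ideal_insert[OF ideal_Un[OF b(2) cc(2)]]) (use e vw(2) b(7) cc(7) in auto)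
    have "(i + 1, j + 1) \<notin> A" using idealD[OF b(1), of "i+1" "j+1" i j] b(5) by auto
    then have n: "(i + 1, j + 1) \<notin> B" "(i + 1, j + 1) \<notin> C" "w \<notin> B" "v \<notin> C"
      using b(6,7) cc(6,7) e ne2 by auto
    have eD: "D = insert (i + 1, j + 1) (insert w B)" "D = insert (i + 1, j + 1) (insert v C)"
      unfolding overlap(2) using b(7) cc(7) vw(2) by auto
    have "v \<in> nbrs (i + 1) (j + 1)" "w \<in> nbrs (i + 1) (j + 1)" "fixed r (i + 1, j + 1)"
      using e b(3) unfolding nbrs_def by auto
    then have "fstep r B (i + 1) (j + 1) w D" "fstep r C (i + 1) (j + 1) v D"
      unfolding fstep_def using n eD D b(2) cc(2) by blast+
    then show ?thesis using that p by blast
  next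
    case (rows a d m)
    have w: "w = v" using rows(1) ne2 unfolding doubleton_eq_iff by auto
    have BC: "B = C" using b(7) cc(7) w by simp
    have e: "a = i" "d = j \<and> v = (i, j + 1) \<or> d + 1 = j \<and> v = (i, j - 1)"
      using rows(2) unfolding doubleton_eq_iff by auto
    have dA: "(i, d) \<notin> A" "(i, d + 1) \<notin> A" and dB: "(i, d + 1) \<in> B" using e b by auto
    have "(i + 1, d) \<notin> A" using idealD[OF b(1), of "i+1" d i d] dA by auto
    then have md: "m \<le> d" using idealD[OF b(1) rows(4), of "a+1" d] e(1) by (cases "m \<le> d") auto
    have mB: "(i, m) \<in> B" "(i, m + 1) \<in> B" using idealD[OF b(2) dB] md by auto
    have AB: "A \<subseteq> B" using b(7) by auto
    have D1: "ideal (insert (i + 1, m) B)"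
      by (rule ideal_insert[OF b(2)]) (use mB rows(4) e(1) AB in auto)
    have D: "ideal D" unfolding rows(5) e(1)
      by (rule ideal_insert[OF D1]) (use mB in auto)
    have mA: "(i + 1, m) \<notin> A" "(i + 1, m + 1) \<notin> A" "(i + 1, m - 1) \<in> A"
      using rows(3,4) e(1) idealD[OF b(1), of "i+1" "m+1" "i+1" m] by auto
    have mB2: "(i + 1, m) \<notin> B" "(i + 1, m + 1) \<notin> B" using mA b(7) e by auto
    show ?thesis
    \<comment> \<open>The bumped domino occupies columns \<open>m\<close> and \<open>m + 1\<close>;
      parity decides which of its squares is the fixed one, so \<open>l\<close> is \<open>m\<close>
      or \<open>m + 1\<close>.\<close>
    proof (cases "fixed r (i + 1, m)")
      case True
      have "(i + 1, m - 2) \<in> A" using idealD[OF b(1) mA(3)] by auto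
      moreover have "fstep r B (i + 1) m (i + 1, m + 1) D"
        unfolding fstep_def using True D b(2) mB2 rows(5) e(1) by (auto simp: nbrs_def)
      ultimately show ?thesis using that[of "i+1" m "(i+1,m+1)" "(i+1,m+1)"] BC e mA by auto
    next
      case False
      have "fstep r B (i + 1) (m + 1) (i + 1, m) D"
        unfolding fstep_def using False D b(2) mB2 rows(5) e(1) by (auto simp: nbrs_def)
      then show ?thesis using that[of "i+1" "m+1" "(i+1,m)" "(i+1,m)"] BC e mA by auto
    qed
  next
    case (cols a d m)
    have w: "w = v" using cols(1) ne2 unfolding doubleton_eq_iff by auto
    have BC: "B = C" using b(7) cc(7) w by simp
    have e: "d = j" "a = i \<and> v = (i + 1, j) \<or> a + 1 = i \<and> v = (i - 1, j)"
      using cols(2) unfolding doubleton_eq_iff by auto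
    have dA: "(a, j) \<notin> A" "(a + 1, j) \<notin> A" and dB: "(a + 1, j) \<in> B" using e b by auto
    have "(a, j + 1) \<notin> A" using idealD[OF b(1), of a "j+1" a j] dA by auto
    then have md: "m \<le> a" using idealD[OF b(1) cols(4), of a "d+1"] e(1) by (cases "m \<le> a") auto
    have mB: "(m, j) \<in> B" "(m + 1, j) \<in> B" using idealD[OF b(2) dB] md by auto
    have AB: "A \<subseteq> B" using b(7) by auto
    have D1: "ideal (insert (m, j + 1) B)"
      by (rule ideal_insert[OF b(2)]) (use mB cols(4) e(1) AB in auto)
    have D: "ideal D" unfolding cols(5) e(1)
      by (rule ideal_insert[OF D1]) (use mB in auto)
    have mA: "(m, j + 1) \<notin> A" "(m + 1, j + 1) \<notin> A" "(m - 1, j + 1) \<in> A"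
      using cols(3,4) e(1) idealD[OF b(1), of "m+1" "j+1" m "j+1"] by auto
    have mB2: "(m, j + 1) \<notin> B" "(m + 1, j + 1) \<notin> B" using mA b(7) e by auto
    show ?thesis
    proof (cases "fixed r (m, j + 1)")
      case True
      have "(m - 2, j + 1) \<in> A" using idealD[OF b(1) mA(3)] by auto
      moreover have "fstep r B m (j + 1) (m + 1, j + 1) D"
        unfolding fstep_def using True D b(2) mB2 cols(5) e(1) by (auto simp: nbrs_def)
      ultimately show ?thesis using that[of m "j+1" "(m+1,j+1)" "(m+1,j+1)"] BC e mA by auto
    next
      case False
      have "fstep r B (m + 1) (j + 1) (m, j + 1) D"
        unfolding fstep_def using False D b(2) mB2 cols(5) e(1) by (auto simp: nbrs_def)
      then show ?thesis using that[of "m+1" "j+1" "(m,j+1)" "(m,j+1)"] BC e mA by auto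
    qed
  qed
qed

section \<open>Comparing the fixed squares of twin shapes\<close>

definition border :: "square set" where
  "border = {(i, j). i \<le> 0 \<or> j \<le> 0}"

text \<open>Both columns mark the first fixed square of the row outside the shape, so they differ by
  less than 2, and parity makes the difference even.\<close>

lemma fixed_row_unique:
  assumes "ideal A" "ideal A'" "\<And>s. fixed r s \<Longrightarrow> s \<in> A \<longleftrightarrow> s \<in> A'"
    and "fixed r (i, l)" "fixed r (i, l')" "(i, l) \<notin> A" "(i, l - 2) \<in> A" "(i, l') \<notin> A'" "(i, l' - 2) \<in> A'"
  shows "l = l'"
proof -
  have "(i, l') \<notin> A" "(i, l' - 2) \<in> A" using assms(3)[of "(i, l')"] assms(3)[of "(i, l' - 2)"] assms by auto
  then have "l - 2 < l'" "l' - 2 < l"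
    using idealD[OF assms(1) assms(7), of i l'] idealD[OF assms(1), of i "l'-2" i l] assms(6) by force+
  moreover have "even (l - l')" using assms(4,5) by (auto simp: fixed_iff)
  ultimately show ?thesis by presburger
qed

lemma fixed_col_unique:
  assumes "ideal A" "ideal A'" "\<And>s. fixed r s \<Longrightarrow> s \<in> A \<longleftrightarrow> s \<in> A'"
    and "fixed r (l, i)" "fixed r (l', i)" "(l, i) \<notin> A" "(l - 2, i) \<in> A" "(l', i) \<notin> A'" "(l' - 2, i) \<in> A'"
  shows "l = l'"
proof -
  have "(l', i) \<notin> A" "(l' - 2, i) \<in> A" using assms(3)[of "(l', i)"] assms(3)[of "(l' - 2, i)"] assms by auto
  then have "l - 2 < l'" "l' - 2 < l"
    using idealD[OF assms(1) assms(7), of l' i] idealD[OF assms(1), of "l'-2" i l i] assms(6) by force+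
  moreover have "even (l - l')" using assms(4,5) by (auto simp: fixed_iff)
  ultimately show ?thesis by presburger
qed

lemma twin_refl: "ideal A \<Longrightarrow> twin r A A"
  by (simp add: twin_def)

lemma twin_trans: "twin r A B \<Longrightarrow> twin r B C \<Longrightarrow> twin r A C"
  unfolding twin_def by blast

lemma twinD: "twin r A B \<Longrightarrow> fixed r s \<Longrightarrow> s \<in> A \<longleftrightarrow> s \<in> B"
  unfolding twin_def by blast

lemma twin_ideal: "twin r A B \<Longrightarrow> ideal A" "twin r A B \<Longrightarrow> ideal B"
  unfolding twin_def by blast+

lemma twin_fstepI:
  assumes "fstep r A i j v B" "fstep r A' i j v' B'" "twin r A A'"
  shows "twin r B B'"
  using fstep_fixed_mem[OF assms(1)] fstep_fixed_mem[OF assms(2)] twinD[OF assms(3)]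
    fstepD(2)[OF assms(1)] fstepD(2)[OF assms(2)]
  unfolding twin_def by blast

lemma twin_fstepD:
  assumes "fstep r A i j v B" "fstep r A' i j v' B'" "twin r B B'"
  shows "twin r A A'"
  unfolding twin_def
proof (intro conjI allI impI)
  fix s assume f: "fixed r s"
  show "s \<in> A \<longleftrightarrow> s \<in> A'"
    using fstep_fixed_mem[OF assms(1) f] fstep_fixed_mem[OF assms(2) f] twinD[OF assms(3) f]
    fstepD(5)[OF assms(1)] fstepD(5)[OF assms(2)] by blast
qed (use fstepD(1)[OF assms(1)] fstepD(1)[OF assms(2)] in auto)

text \<open>Symmetric because shapes grow along one direction of a lattice path and shrink along the
  other.\<close>

definition adj :: "nat \<Rightarrow> square set \<Rightarrow> square set \<Rightarrow> bool" where
  "adj r A B \<longleftrightarrow> step r A B \<or> step r B A"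

text \<open>The square \<open>(i, j)\<close> separates \<open>A'\<close> from \<open>B'\<close>.
  This fixes the direction of the step and, since a step adds a single fixed square, also its fixed
  square.\<close>

lemma twin_fstep_adj:
  assumes f: "fstep r A i j v B" and t: "twin r A A'" "twin r B B'" and a: "adj r A' B'"
  obtains v' where "fstep r A' i j v' B'"
proof -
  have x: "(i, j) \<in> B'" "(i, j) \<notin> A'"
    using fstepD(3,5,7)[OF f] twinD[OF t(1), of "(i, j)"] twinD[OF t(2), of "(i, j)"] by auto
  have "\<not> step r B' A'" using x unfolding step_def fstep_def by auto
  then have "step r A' B'" using a unfolding adj_def by auto
  moreover have "A' \<noteq> B'" using x by auto
  ultimately obtain i' j' v' where f': "fstep r A' i' j' v' B'" unfolding step_def by blast
  have "(i, j) = (i', j')" using fstep_fixed_mem[OF f' fstepD(3)[OF f]] x by auto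
  then show thesis using that f' by auto
qed

lemma twin_adj_eq:
  assumes t: "twin r A A'" "twin r A B'" and a: "adj r A' B'"
  shows "A' = B'"
proof (rule ccontr)
  assume "A' \<noteq> B'"
  then obtain i j v where "fstep r A' i j v B' \<or> fstep r B' i j v A'" using a unfolding adj_def step_def by blast
  then have "fixed r (i, j) \<and> ((i, j) \<in> A' \<longleftrightarrow> (i, j) \<notin> B')" unfolding fstep_def by auto
  then show False using twinD[OF t(1)] twinD[OF t(2)] by blast
qed

text \<open>Both ranks must bump to the same fixed square. This could fail only through different
  orientations of the bumped dominoes, and \<open>nb\<close> covers the one situation in which fixed
  squares do not decide the outcome. The last conclusion says that no pair of flips is created right
  of and below \<open>(k, l)\<close>.\<close>

lemma cell_same_fixed_twin:
  assumes B: "fstep r A i j v B" and C: "fstep r A i j w C" and c: "cell e A B C D"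
    and B': "fstep r A' i j v' B'" and C': "fstep r A' i j w' C'" and c': "cell e' A' B' C' D'"
    and t: "twin r A A'" and nb: "(i - 1, j + 1) \<notin> A \<Longrightarrow> (i + 1, j - 1) \<notin> A \<Longrightarrow> v = v'"
  obtains k l u u' x x' where "fstep r B k l u D" "fstep r C k l u' D" "fstep r B' k l x D'" "fstep r C' k l x' D'"
    "(k - 1, l + 1) \<in> B \<Longrightarrow> (k + 1, l - 1) \<in> B \<Longrightarrow> (k, l + 1) \<notin> flips D D'"
proof -
  obtain k l u u' where f: "fstep r B k l u D" "fstep r C k l u' D" and
   k: "(i - 1, j + 1) \<in> A \<and> (i + 1, j - 1) \<in> A \<and> k = i + 1 \<and> l = j + 1 \<or>
     (v = (i, j - 1) \<or> v = (i, j + 1)) \<and> k = i + 1 \<and> (i + 1, l) \<notin> A \<and> (i + 1, l - 2) \<in> A \<and>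
       (u = (k, l - 1) \<or> u = (k, l + 1)) \<or>
     (v = (i - 1, j) \<or> v = (i + 1, j)) \<and> l = j + 1 \<and> (k, j + 1) \<notin> A \<and> (k - 2, j + 1) \<in> A \<and>
       (u = (k - 1, l) \<or> u = (k + 1, l))" (is "?P \<or> ?H \<or> ?V")
    by (rule cell_same_fixed[OF B C c])
  obtain k' l' x x' where f': "fstep r B' k' l' x D'" "fstep r C' k' l' x' D'" and
   k': "(i - 1, j + 1) \<in> A' \<and> (i + 1, j - 1) \<in> A' \<and> k' = i + 1 \<and> l' = j + 1 \<or>
     (v' = (i, j - 1) \<or> v' = (i, j + 1)) \<and> k' = i + 1 \<and> (i + 1, l') \<notin> A' \<and> (i + 1, l' - 2) \<in> A' \<and>
       (x = (k', l' - 1) \<or> x = (k', l' + 1)) \<or>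
     (v' = (i - 1, j) \<or> v' = (i + 1, j)) \<and> l' = j + 1 \<and> (k', j + 1) \<notin> A' \<and> (k' - 2, j + 1) \<in> A' \<and>
       (x = (k' - 1, l') \<or> x = (k' + 1, l'))" (is "?P' \<or> ?H' \<or> ?V'")
    by (rule cell_same_fixed[OF B' C' c'])
  note b = fstepD[OF B] and b' = fstepD[OF B']
  have fx: "fixed r (i, j)" "fixed r (k, l)" "fixed r (k', l')"
    using b(3) fstepD(3)[OF f(1)] fstepD(3)[OF f'(1)] by auto
  have p: "(i - 1, j + 1) \<in> A' \<longleftrightarrow> (i - 1, j + 1) \<in> A" "(i + 1, j - 1) \<in> A' \<longleftrightarrow> (i + 1, j - 1) \<in> A"
    using twinD[OF t, of "(i-1,j+1)"] twinD[OF t, of "(i+1,j-1)"] fx by auto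
  have tt: "\<And>s. fixed r s \<Longrightarrow> s \<in> A \<longleftrightarrow> s \<in> A'" using twinD[OF t] by blast
  have far: "(i + 1, j + 1) \<notin> A" "(i + 1, j + 1) \<notin> A'" "(i, j + 2) \<notin> A" "(i + 2, j) \<notin> A"
    using idealD[OF b(1), of "i+1" "j+1" i j] idealD[OF b'(1), of "i+1" "j+1" i j]
      idealD[OF b(1), of i "j+2" i j] idealD[OF b(1), of "i+2" j i j] b(5) b'(5) by auto
  have ur: "k = k' \<and> l = l' \<and> ((k - 1, l + 1) \<in> B \<longrightarrow> (k + 1, l - 1) \<in> B \<longrightarrow> u = x \<and> (u = (k, l + 1) \<or> u = (k + 1, l)))"
  proof (cases "(i - 1, j + 1) \<in> A \<and> (i + 1, j - 1) \<in> A")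
    case True
    have H: "l0 = j + 1" if "(i + 1, l0) \<notin> A0" "(i + 1, l0 - 2) \<in> A0" "fixed r (i + 1, l0)" "A0 = A \<or> A0 = A'" for l0 A0
      using fixed_row_unique[of A0 A r "i+1" l0 "j+1"] tt b(1) b'(1) that True far fx by auto
    have V: "l0 = i + 1" if "(l0, j + 1) \<notin> A0" "(l0 - 2, j + 1) \<in> A0" "fixed r (l0, j + 1)" "A0 = A \<or> A0 = A'" for l0 A0
      using fixed_col_unique[of A0 A r l0 "j+1" "i+1"] tt b(1) b'(1) that True far fx by auto
    from k have kl: "k = i + 1 \<and> l = j + 1"
    proof (elim disjE)
      assume ?H then show ?thesis using H[of l A] fx by simp
    next
      assume ?V then show ?thesis using V[of k A] fx by simp
    qed simp
    from k' have kl': "k' = i + 1 \<and> l' = j + 1"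
    proof (elim disjE)
      assume ?H' then show ?thesis using H[of l' A'] fx by simp
    next
      assume ?V' then show ?thesis using V[of k' A'] fx by simp
    qed simp
    \<comment> \<open>With both diagonal neighbours in \<open>A\<close>, rows and columns lead to
      the same \<open>(k, l) = (i + 1, j + 1)\<close>, and the last conclusion is vacuous since
      \<open>(k - 1, l + 1)\<close> is not in \<open>B\<close>.\<close>
    have "(i, j + 2) \<notin> B" using far b(3,4,7) unfolding nbrs_def by auto
    moreover have "(k - 1, l + 1) = (i, j + 2)" using kl by simp
    ultimately have "(k - 1, l + 1) \<notin> B" by (simp only: not_False_eq_True)
    moreover have "k = k'" "l = l'" using kl kl' by simp_all
    ultimately show ?thesis by blast
  next
    case False
    \<comment> \<open>A single diagonal neighbour in \<open>A\<close> forces the orientation in both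
      twins; with none, \<open>nb\<close> gives it.\<close>
    have vv: "(v = (i, j - 1) \<or> v = (i, j + 1)) \<longleftrightarrow> (v' = (i, j - 1) \<or> v' = (i, j + 1))"
    proof (cases "(i - 1, j + 1) \<in> A"; cases "(i + 1, j - 1) \<in> A")
      assume h: "(i - 1, j + 1) \<in> A" "(i + 1, j - 1) \<notin> A"
      show ?thesis using fstep_types(2)[OF B h] fstep_types(2)[OF B'] h p by simp
    next
      assume h: "(i - 1, j + 1) \<notin> A" "(i + 1, j - 1) \<in> A"
      show ?thesis using fstep_types(3)[OF B h] fstep_types(3)[OF B'] h p by simp
    next
      assume h: "(i - 1, j + 1) \<notin> A" "(i + 1, j - 1) \<notin> A"
      show ?thesis using nb[OF h] by simp
    qed (use False in simp)
    have dd: "x = (k, l + 1) \<or> x = (k + 1, l)" if h: "(k - 1, l + 1) \<in> B" "(k + 1, l - 1) \<in> B" "k = k'" "l = l'"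
    proof -
      have "(k - 1, l + 1) \<in> B'" "(k + 1, l - 1) \<in> B'"
        using twinD[OF twin_fstepI[OF B B' t], of "(k-1,l+1)"] twinD[OF twin_fstepI[OF B B' t], of "(k+1,l-1)"] fx h
        by auto
      then show ?thesis using fstep_types(1)[OF f'(1)] h(3,4) by simp
    qed
    have du: "(k - 1, l + 1) \<in> B \<Longrightarrow> (k + 1, l - 1) \<in> B \<Longrightarrow> u = (k, l + 1) \<or> u = (k + 1, l)"
      using fstep_types(1)[OF f(1)] by auto
    show ?thesis
    proof (cases "v = (i, j - 1) \<or> v = (i, j + 1)")
      case True
      then have h: ?H using k False by auto
      have h': ?H' using k' True False vv p by auto
      have "l = l'" using fixed_row_unique[OF b(1) b'(1) tt, of r "i+1" l l'] h h' fx by auto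
      then show ?thesis using h h' dd du by auto
    next
      case F: False
      then have h: ?V using k False by auto
      have h': ?V' using k' F False vv p by auto
      have "k = k'" using fixed_col_unique[OF b(1) b'(1) tt, of r k "j+1" k'] h h' fx by auto
      then show ?thesis using h h' dd du by auto
    qed
  qed
  have "(k, l + 1) \<notin> flips D D'" if h: "(k - 1, l + 1) \<in> B" "(k + 1, l - 1) \<in> B"
  proof -
    have u: "u = x" "u = (k, l + 1) \<or> u = (k + 1, l)" using ur h by auto
    have "(k, l + 1) \<notin> B" "(k, l + 1) \<notin> B'"
      using idealD[OF fstepD(1)[OF f(1)], of k "l+1" k l] idealD[OF fstepD(1)[OF f'(1)], of k "l+1" k l]
       fstepD(5)[OF f(1)] fstepD(5)[OF f'(1)] ur by auto
    moreover have "k = k'" "l = l'" using ur by auto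
    ultimately show ?thesis using u fstepD(7)[OF f(1)] fstepD(7)[OF f'(1)] unfolding flips_def by auto
  qed
  then show thesis using that f f' ur by auto
qed

section \<open>Pulling twins back across a cell\<close>

lemma fstep_remove_unique:
  assumes B: "fstep r A i j v B" and B': "fstep r A' i j v' B" and p: "(i - 1, j + 1) \<in> A \<or> (i + 1, j - 1) \<in> A"
  shows "A = A'"
proof -
  note b = fstepD[OF B] and b' = fstepD[OF B']
  have t: "twin r A A'" by (rule twin_fstepD[OF B B' twin_refl[OF b(2)]])
  have pp: "(i - 1, j + 1) \<in> A' \<longleftrightarrow> (i - 1, j + 1) \<in> A" "(i + 1, j - 1) \<in> A' \<longleftrightarrow> (i + 1, j - 1) \<in> A"
    using twinD[OF t, of "(i-1,j+1)"] twinD[OF t, of "(i+1,j-1)"] b(3) by auto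
  have far: "(i + 1, j) \<notin> A" "(i, j + 1) \<notin> A" "(i + 1, j) \<notin> A'" "(i, j + 1) \<notin> A'"
    using idealD[OF b(1), of "i+1" "j" i j] idealD[OF b'(1), of "i+1" "j" i j]
      idealD[OF b(1), of i "j+1" i j] idealD[OF b'(1), of i "j+1" i j] b(5) b'(5) by auto
  have m: "s = (i, j) \<or> s = v \<or> s \<in> A \<longleftrightarrow> s = (i, j) \<or> s = v' \<or> s \<in> A'" for s using b(7) b'(7) by blast
  have "v = v'"
  proof (cases "(i - 1, j + 1) \<in> A"; cases "(i + 1, j - 1) \<in> A")
    assume h: "(i - 1, j + 1) \<in> A" "(i + 1, j - 1) \<in> A"
    show ?thesis using fstep_types(1)[OF B h] fstep_types(1)[OF B'] h pp far m[of "(i, j + 1)"] by auto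
  next
    assume h: "(i - 1, j + 1) \<in> A" "(i + 1, j - 1) \<notin> A"
    show ?thesis using fstep_types(2)[OF B h] fstep_types(2)[OF B'] h pp far m[of "(i, j + 1)"] by (auto split: if_splits)
  next
    assume h: "(i - 1, j + 1) \<notin> A" "(i + 1, j - 1) \<in> A"
    show ?thesis using fstep_types(3)[OF B h] fstep_types(3)[OF B'] h pp far m[of "(i + 1, j)"] by (auto split: if_splits)
  qed (use p in auto)
  have nf: "(i, j) \<noteq> v" using fstep_var_not_fixed[OF B] b(3) by auto
  have "A = B - {(i, j), v}" using b(5,6,7) by auto
  moreover have "A' = B - {(i, j), v}" using b'(5,6,7) \<open>v = v'\<close> by auto
  ultimately show ?thesis by simp
qed

lemma ideal_remove2:
  assumes "ideal B" "fixed r (i, j)" "(i + 1, j + 1) \<notin> B" "(i + 1, j) \<notin> B \<or> (i, j + 1) \<notin> B"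
    "(i, j + 2) \<notin> B" "(i + 2, j) \<notin> B"
    and "v = (i, j + 1) \<or> v = (i + 1, j)" "v \<in> B"
  shows "ideal (B - {(i, j), v})"
proof -
  have v: "v = (i, j + 1) \<and> (i + 1, j) \<notin> B \<or> v = (i + 1, j) \<and> (i, j + 1) \<notin> B" using assms by auto
  have "ideal (B - {v})"
    using v ideal_remove[OF assms(1), of i "j+1"] ideal_remove[OF assms(1), of "i+1" j] assms(3,5,6)
    by (auto simp: add.assoc)
  then have "ideal ((B - {v}) - {(i, j)})" by (rule ideal_remove) (use v in auto)
  moreover have "B - {(i, j), v} = (B - {v}) - {(i, j)}" by auto
  ultimately show ?thesis by simp
qed

text \<open>If both diagonal neighbours lie in \<open>A\<close>, the squares left of and above
  \<open>(i, j)\<close> are blocked, so a domino can be taken off only to the right or downwards,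
  and only if exactly one of these squares is present; this is hypothesis \<open>o\<close>.
  Otherwise some neighbour can always be taken off together with \<open>(i, j)\<close>.\<close>

lemma fstep_pullback:
  assumes f: "fstep r A i j v B" and t: "twin r B B'"
    and o: "(i - 1, j + 1) \<in> A \<Longrightarrow> (i + 1, j - 1) \<in> A \<Longrightarrow> (i, j + 1) \<in> B' \<longleftrightarrow> (i + 1, j) \<notin> B'"
  obtains A' v' where "fstep r A' i j v' B'"
    "(i - 1, j + 1) \<in> A \<Longrightarrow> (i + 1, j - 1) \<in> A \<Longrightarrow> A' = B' - {(i, j), (i, j + 1), (i + 1, j)}"
proof -
  note b = fstepD[OF f]
  have iB: "ideal B'" using twin_ideal t by blast
  have vn: "v \<noteq> (i - 1, j + 1)" "v \<noteq> (i + 1, j - 1)" "v \<noteq> (i + 1, j + 1)" "v \<noteq> (i, j + 2)" "v \<noteq> (i + 2, j)"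
    using fstep_var_not_fixed[OF f] b(3) by auto
  have A: "(i + 1, j + 1) \<notin> A" "(i, j + 2) \<notin> A" "(i + 2, j) \<notin> A"
    using idealD[OF b(1), of "i+1" "j+1" i j] idealD[OF b(1), of i "j+2" i j] idealD[OF b(1), of "i+2" j i j] b(5) by auto
  have x: "(i, j) \<in> B'" using twinD[OF t, of "(i, j)"] b by auto
  have m: "(i + 1, j + 1) \<notin> B'" "(i, j + 2) \<notin> B'" "(i + 2, j) \<notin> B'"
    "(i - 1, j + 1) \<in> B' \<longleftrightarrow> (i - 1, j + 1) \<in> A" "(i + 1, j - 1) \<in> B' \<longleftrightarrow> (i + 1, j - 1) \<in> A"
    using twinD[OF t, of "(i + 1, j + 1)"] twinD[OF t, of "(i, j + 2)"] twinD[OF t, of "(i + 2, j)"]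
      twinD[OF t, of "(i - 1, j + 1)"] twinD[OF t, of "(i + 1, j - 1)"] b(3) A vn b(7) by auto
  have LU: "(i, j - 1) \<in> B'" "(i - 1, j) \<in> B'" using idealD[OF iB x] by auto
  have R: "(i, j + 1) \<in> B' \<Longrightarrow> (i - 1, j + 1) \<in> A" using idealD[OF iB, of i "j+1" "i-1" "j+1"] m by auto
  have D: "(i + 1, j) \<in> B' \<Longrightarrow> (i + 1, j - 1) \<in> A" using idealD[OF iB, of "i+1" "j" "i+1" "j-1"] m by auto
  have mk: "fstep r (B' - {(i, j), w}) i j w B'" if "w \<in> nbrs i j" "w \<in> B'" "ideal (B' - {(i, j), w})" for w
    unfolding fstep_def using that iB b(3) x by auto
  show thesis
  proof (cases "(i, j + 1) \<in> B' \<or> (i + 1, j) \<in> B'")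
    case True
    define w where "w = (if (i, j + 1) \<in> B' then (i, j + 1) else (i + 1, j))"
    have no: "(i + 1, j) \<notin> B' \<or> (i, j + 1) \<notin> B'" using R D o by blast
    have w: "w = (i, j + 1) \<or> w = (i + 1, j)" "w \<in> B'" using True unfolding w_def by auto
    have "fstep r (B' - {(i, j), w}) i j w B'"
      by (rule mk) (use w ideal_remove2[OF iB b(3) m(1) no m(2,3) w] in \<open>auto simp: nbrs_def\<close>)
    moreover have "B' - {(i, j), w} = B' - {(i, j), (i, j + 1), (i + 1, j)}" using no w by auto
    ultimately show thesis using that by metis
  next
    case False
    then have pq: "\<not> ((i - 1, j + 1) \<in> A \<and> (i + 1, j - 1) \<in> A)" using o by blast
    have 1: "ideal (B' - {(i, j)})" by (rule ideal_remove[OF iB]) (use False in auto)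
    \<comment> \<open>With nothing right of or below \<open>(i, j)\<close>, the partner must be
      above or to the left. A diagonal neighbour \<open>(i + 1, j - 1)\<close> in the shape blocks
      the left square, and then nothing blocks the upper one.\<close>
    define w where "w = (if (i + 1, j - 1) \<in> A then (i - 1, j) else (i, j - 1))"
    have "ideal ((B' - {(i, j)}) - {w})"
    proof (cases "(i + 1, j - 1) \<in> A")
      case True
      then have "(i - 1, j + 1) \<notin> B'" using pq m by auto
      then show ?thesis unfolding w_def using True ideal_remove[OF 1, of "i-1" j] by auto
    next
      case False
      then show ?thesis unfolding w_def using ideal_remove[OF 1, of i "j-1"] m by auto
    qed
    moreover have "(B' - {(i, j)}) - {w} = B' - {(i, j), w}" by auto
    ultimately have "fstep r (B' - {(i, j), w}) i j w B'" by (intro mk) (auto simp: w_def nbrs_def LU)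
    then show thesis using that pq by blast
  qed
qed

text \<open>The border supplies a diagonal neighbour of the new fixed square. Hence the added domino
  can be removed in only one way, which is what \<open>cell_pullback\<close> uses.\<close>

lemma cell_entry:
  assumes A: "ideal A" "border \<subseteq> A" and c: "cell e A B C D" and e: "e \<noteq> 0"
  obtains k l u where "B = A" "C = A" "fstep r A k l u D" "(k - 1, l + 1) \<in> A \<or> (k + 1, l - 1) \<in> A"
    "e = 1 \<and> k = 1 \<and> (1, l) \<notin> A \<and> (1, l - 2) \<in> A \<and> (u = (1, l - 1) \<or> u = (1, l + 1)) \<or>
     e = - 1 \<and> l = 1 \<and> (k, 1) \<notin> A \<and> (k - 2, 1) \<in> A \<and> (u = (k - 1, 1) \<or> u = (k + 1, 1))"
  using c
proof cases
  case (row_entry m)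
  have z: "(0, a) \<in> A" for a using A(2) unfolding border_def by auto
  have n: "(1, m + 1) \<notin> A" using idealD[OF A(1), of 1 "m+1" 1 m] row_entry by auto
  have D1: "ideal (insert (1, m) A)" by (rule ideal_insert[OF A(1)]) (use z row_entry in auto)
  have "ideal (insert (1, m + 1) (insert (1, m) A))" by (rule ideal_insert[OF D1]) (use z in auto)
  then have D: "ideal D" unfolding row_entry by (simp add: insert_commute)
  show thesis
  proof (cases "fixed r (1, m)")
    case True
    have "fstep r A 1 m (1, m + 1) D" unfolding fstep_def using True A D row_entry n by (auto simp: nbrs_def)
    moreover have "(1, m - 2) \<in> A" using idealD[OF A(1), of 1 "m-1"] row_entry by auto
    ultimately show thesis using that[of 1 m "(1, m + 1)"] row_entry z by auto
  next
    case False
    have "fstep r A 1 (m + 1) (1, m) D" unfolding fstep_def using False A D row_entry n by (auto simp: nbrs_def)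
    then show thesis using that[of 1 "m + 1" "(1, m)"] row_entry z n by auto
  qed
next
  case (col_entry m)
  have z: "(a, 0) \<in> A" for a using A(2) unfolding border_def by auto
  have n: "(m + 1, 1) \<notin> A" using idealD[OF A(1), of "m+1" 1 m 1] col_entry by auto
  have D1: "ideal (insert (m, 1) A)" by (rule ideal_insert[OF A(1)]) (use z col_entry in auto)
  have "ideal (insert (m + 1, 1) (insert (m, 1) A))" by (rule ideal_insert[OF D1]) (use z in auto)
  then have D: "ideal D" unfolding col_entry by (simp add: insert_commute)
  show thesis
  proof (cases "fixed r (m, 1)")
    case True
    have "fstep r A m 1 (m + 1, 1) D" unfolding fstep_def using True A D col_entry n by (auto simp: nbrs_def)
    moreover have "(m - 2, 1) \<in> A" using idealD[OF A(1), of "m-1" 1] col_entry by auto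
    ultimately show thesis using that[of m 1 "(m + 1, 1)"] col_entry z by auto
  next
    case False
    have "fstep r A (m + 1) 1 (m, 1) D" unfolding fstep_def using False A D col_entry n by (auto simp: nbrs_def)
    then show thesis using that[of "m + 1" 1 "(m, 1)"] col_entry z n by auto
  qed
qed (use e in auto)

lemma cell_eq_left: "cell 0 A A C D \<Longrightarrow> D = C"
  by (erule cell.cases) auto

lemma cell_eq_right: "cell 0 A B A D \<Longrightarrow> D = B"
  by (erule cell.cases) auto

lemma cell_step:
  assumes A: "border \<subseteq> A" and s: "step r A B" "step r A C" and c: "cell e A B C D"
  shows "step r B D" "step r C D"
proof -
  have iA: "ideal A" "ideal B" "ideal C" using s unfolding step_def by auto
  have "step r B D \<and> step r C D"
  proof (cases "e = 0")
    case False
    then obtain k l u where "B = A" "C = A" "fstep r A k l u D" using cell_entry[OF iA(1) A c, of r] by metis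
    then show ?thesis unfolding step_def fstep_def by blast
  next
    case e: True
    show ?thesis
    proof (cases "A = B \<or> A = C")
      case True then show ?thesis using cell_eq_left[of A C D] cell_eq_right[of A B D] c e s iA unfolding step_def by auto
    next
      case False
      then obtain i j v i' j' w where f: "fstep r A i j v B" "fstep r A i' j' w C" using s unfolding step_def by blast
      show ?thesis
      proof (cases "(i, j) = (i', j')")
        case True
        then have C: "fstep r A i j w C" using f by simp
        show ?thesis
        proof (rule cell_same_fixed[OF f(1) C c])
          fix k l u u' assume "fstep r B k l u D" "fstep r C k l u' D"
          then show ?thesis unfolding step_def fstep_def by blast
        qed
      next
        case False
        then show ?thesis using cell_distinct_fixed[OF f c] unfolding step_def fstep_def by blast
      qed
    qed
  qed
  then show "step r B D" "step r C D" by auto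
qed

text \<open>If the variable squares \<open>x\<close> and \<open>y\<close> differ, the intersection
  of \<open>B'\<close> and \<open>C'\<close> is the required shape. If they coincide, the rule
  \<open>overlap\<close> is inverted.\<close>

lemma cell_pullback_distinct:
  assumes B: "fstep r A i j v B" and C: "fstep r A i' j' w C" and ne: "(i, j) \<noteq> (i', j')"
    and f: "fstep r B' i' j' x D'" "fstep r C' i j y D'" and t: "twin r B B'" "twin r C C'"
  obtains A' x' y' where "fstep r A' i j x' B'" "fstep r A' i' j' y' C'"
proof -
  note b = fstepD[OF f(1)] and c = fstepD[OF f(2)]
  have nf: "\<not> fixed r x" "\<not> fixed r y" using fstep_var_not_fixed f by blast+
  have ne2: "(i, j) \<noteq> x" "(i, j) \<noteq> y" "(i', j') \<noteq> x" "(i', j') \<noteq> y" using nf b(3) c(3) by auto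
  have mD: "s \<in> D' \<longleftrightarrow> s = (i', j') \<or> s = x \<or> s \<in> B'" "s \<in> D' \<longleftrightarrow> s = (i, j) \<or> s = y \<or> s \<in> C'" for s
    using b(7) c(7) by auto
  have xB: "(i, j) \<in> B'" "(i', j') \<in> C'" using mD[of "(i, j)"] mD[of "(i', j')"] ne ne2 by auto
  show thesis
  proof (cases "x = y")
    case False
    have i: "ideal (B' \<inter> C')" by (rule ideal_Int[OF b(1) c(1)])
    have y: "y \<in> B'" "x \<in> C'" using mD[of y] mD[of x] False ne2 by auto
    have eB: "B' = insert (i, j) (insert y (B' \<inter> C'))" using mD xB y by blast
    have eC: "C' = insert (i', j') (insert x (B' \<inter> C'))" using mD xB y by blast
    have "fstep r (B' \<inter> C') i j y B'" "fstep r (B' \<inter> C') i' j' x C'"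
      unfolding fstep_def using i b(1,3,4,5,6) c(1,3,4,5,6) eB eC by blast+
    then show thesis using that by blast
  next
    case True
    obtain a d where x: "x = (a, d)" by (cases x)
    have xD: "(a, d) \<in> D'" "(i, j) \<in> D'" "(i', j') \<in> D'" using mD x xB by auto
    have nB: "(a, d) \<notin> B'" "(a, d) \<notin> C'" "(i', j') \<notin> B'" "(i, j) \<notin> C'" using b c x True by auto
    have 1: "(a + 1, d) \<notin> B'" "(a, d + 1) \<notin> B'" "(a + 1, d) \<notin> C'" "(a, d + 1) \<notin> C'"
      using idealD[OF b(1), of "a+1" d a d] idealD[OF b(1), of a "d+1" a d]
        idealD[OF c(1), of "a+1" d a d] idealD[OF c(1), of a "d+1" a d] nB by auto
    have 2: "(i, j) = (a - 1, d) \<or> (i, j) = (a, d - 1)" "(i', j') = (a - 1, d) \<or> (i', j') = (a, d - 1)"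
      using b(4) c(4) 1 xB x True unfolding nbrs_def by auto
    \<comment> \<open>The intersection lacks three squares of \<open>D'\<close>; the corner
      \<open>(a - 1, d - 1)\<close> must go as well, and it becomes the shared variable square of
      both lower dominoes.\<close>
    have fin: "\<exists>A' x' y'. fstep r A' (a - 1) d x' B' \<and> fstep r A' a (d - 1) y' C'"
      if h: "fstep r B' a (d - 1) (a, d) D'" "fstep r C' (a - 1) d (a, d) D'" for B' C'
    proof -
      note hb = fstepD[OF h(1)] and hc = fstepD[OF h(2)]
      let ?E = "B' \<inter> C'"
      have nE: "(a, d - 1) \<notin> ?E" "(a - 1, d) \<notin> ?E" using hb(5) hc(5) by auto
      have mem: "s \<in> D' \<longleftrightarrow> s = (a, d - 1) \<or> s = (a, d) \<or> s \<in> B'" "s \<in> D' \<longleftrightarrow> s = (a - 1, d) \<or> s = (a, d) \<or> s \<in> C'" for s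
        by (simp add: hb(7), simp add: hc(7))
      have q: "(a - 1, d - 1) \<in> B'" "(a - 1, d - 1) \<in> C'"
      proof -
        have "(a - 1, d - 1) \<in> D'" using idealD[OF hb(2), of a d "a - 1" "d - 1"] hb(7) by simp
        then show "(a - 1, d - 1) \<in> B'" "(a - 1, d - 1) \<in> C'" using mem[of "(a - 1, d - 1)"] by simp_all
      qed
      have i: "ideal (?E - {(a - 1, d - 1)})"
        by (rule ideal_remove[OF ideal_Int[OF hb(1) hc(1)]]) (use nE in auto)
      have l: "(a - 1, d) \<in> B'" "(a, d - 1) \<in> C'" using mem[of "(a - 1, d)"] mem[of "(a, d - 1)"] by auto
      have sub: "s \<in> C'" if "s \<in> B'" "s \<noteq> (a - 1, d)" for s using mem[of s] that hb(6) by metis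
      have sub2: "s \<in> B'" if "s \<in> C'" "s \<noteq> (a, d - 1)" for s using mem[of s] that hc(6) by metis
      have e: "B' = insert (a - 1, d) (insert (a - 1, d - 1) (?E - {(a - 1, d - 1)}))"
        "C' = insert (a, d - 1) (insert (a - 1, d - 1) (?E - {(a - 1, d - 1)}))"
        using q sub sub2 l by blast+
      have "fstep r (?E - {(a - 1, d - 1)}) (a - 1) d (a - 1, d - 1) B'"
        "fstep r (?E - {(a - 1, d - 1)}) a (d - 1) (a - 1, d - 1) C'"
        unfolding fstep_def using i hb(1,3) hc(1,3) e nE by (simp_all add: nbrs_def)
      then show ?thesis by blast
    qed
    show thesis
    proof (cases "(i, j) = (a - 1, d)")
      case T: True
      then have "(i', j') = (a, d - 1)" using 2 ne by auto
      then show thesis using fin[of B' C'] f that True x T by auto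
    next
      case F: False
      then have "(i, j) = (a, d - 1)" "(i', j') = (a - 1, d)" using 2 ne by auto
      then show thesis using fin[of C' B'] f that True x by auto
    qed
  qed
qed

text \<open>Turns a competitor passing through the far corner of a cell into one passing through the
  near corner. The assumptions use only \<open>adj\<close>, since that is all a twin path provides;
  the fixed squares restore the directions.\<close>

lemma cell_pullback:
  assumes A: "border \<subseteq> A" and s: "step r A B" "step r A C" and c: "cell e A B C D"
    and t: "twin r B B'" "twin r C C'" "twin r D D'" and a: "adj r B' D'" "adj r C' D'"
  obtains A' where "twin r A A'" "step r A' B'" "step r A' C'"
proof -
  have iA: "ideal A" "ideal B" "ideal C" using s unfolding step_def by auto
  have self: "step r B' B'" "step r C' C'" using twin_ideal t unfolding step_def by auto
  show thesis
  proof (cases "e = 0")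
    case False
    obtain k l u where k: "B = A" "C = A" "fstep r A k l u D" "(k - 1, l + 1) \<in> A \<or> (k + 1, l - 1) \<in> A"
      by (rule cell_entry[OF iA(1) A c False, of r])
    obtain x where x: "fstep r B' k l x D'" using twin_fstep_adj[OF k(3) _ t(3) a(1)] t(1) k by blast
    obtain y where y: "fstep r C' k l y D'" using twin_fstep_adj[OF k(3) _ t(3) a(2)] t(2) k by blast
    have "(k - 1, l + 1) \<in> B' \<or> (k + 1, l - 1) \<in> B'"
      using k twinD[OF t(1), of "(k-1,l+1)"] twinD[OF t(1), of "(k+1,l-1)"] fstepD(3)[OF k(3)] by auto
    then have "B' = C'" using fstep_remove_unique[OF x y] by blast
    then show thesis using that[of B'] t k self by simp
  next
    case e: True
    show thesis
    proof (cases "A = B \<or> A = C")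
      case True
      then show thesis
      proof
        assume h: "A = B"
        then have "D = C" using cell_eq_left c e by blast
        then have "C' = D'" using twin_adj_eq[of r C C' D'] t a by simp
        moreover have "adj r B' C'" using a \<open>C' = D'\<close> by simp
        then have "step r B' C'"
        proof (cases "A = C")
          case True
          then have "B' = C'" using twin_adj_eq[of r A B' C'] t h \<open>adj r B' C'\<close> by simp
          then show ?thesis using self by simp
        next
          case False
          then obtain i j v where "fstep r A i j v C" using s unfolding step_def by blast
          then obtain v' where "fstep r B' i j v' C'"
            by (rule twin_fstep_adj[of r A i j v C B' C']) (use t h \<open>adj r B' C'\<close> in auto)
          then show ?thesis using self unfolding step_def by blast
        qed
        ultimately show thesis using that[of B'] t h self by simp
      next
        assume h: "A = C"
        then have "D = B" using cell_eq_right c e by blast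
        then have "B' = D'" using twin_adj_eq[of r B B' D'] t a by simp
        moreover have "adj r C' B'" using a \<open>B' = D'\<close> by simp
        then have "step r C' B'"
        proof (cases "A = B")
          case True
          then have "C' = B'" using twin_adj_eq[of r A C' B'] t h \<open>adj r C' B'\<close> by simp
          then show ?thesis using self by simp
        next
          case False
          then obtain i j v where "fstep r A i j v B" using s unfolding step_def by blast
          then obtain v' where "fstep r C' i j v' B'"
            by (rule twin_fstep_adj[of r A i j v B C' B']) (use t h \<open>adj r C' B'\<close> in auto)
          then show ?thesis using self unfolding step_def by blast
        qed
        ultimately show thesis using that[of C'] t h self by simp
      qed
    next
      case False
      then obtain i j v i' j' w where f: "fstep r A i j v B" "fstep r A i' j' w C" using s unfolding step_def by blast
      show thesis
      proof (cases "(i, j) = (i', j')")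
        case ne: False
        obtain w' v' where g: "fstep r B i' j' w' D" "fstep r C i j v' D"
          using cell_distinct_fixed[OF f c ne] by blast
        obtain x where x: "fstep r B' i' j' x D'" using twin_fstep_adj[OF g(1) t(1) t(3) a(1)] by blast
        obtain y where y: "fstep r C' i j y D'" using twin_fstep_adj[OF g(2) t(2) t(3) a(2)] by blast
        obtain A' x' y' where A': "fstep r A' i j x' B'" "fstep r A' i' j' y' C'"
          by (rule cell_pullback_distinct[OF f ne x y t(1,2)])
        have "twin r A A'" by (rule twin_fstepD[OF f(1) A'(1) t(1)])
        moreover have "step r A' B'" "step r A' C'" using A' unfolding step_def fstep_def by blast+
        ultimately show thesis using that by blast
      next
        case True
        then have C: "fstep r A i j w C" using f by simp
        obtain k l u u' where g: "fstep r B k l u D" "fstep r C k l u' D" and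
         k: "(i - 1, j + 1) \<in> A \<and> (i + 1, j - 1) \<in> A \<and> k = i + 1 \<and> l = j + 1 \<or>
           (v = (i, j - 1) \<or> v = (i, j + 1)) \<and> k = i + 1 \<and> (i + 1, l) \<notin> A \<and> (i + 1, l - 2) \<in> A \<and>
             (u = (k, l - 1) \<or> u = (k, l + 1)) \<or>
           (v = (i - 1, j) \<or> v = (i + 1, j)) \<and> l = j + 1 \<and> (k, j + 1) \<notin> A \<and> (k - 2, j + 1) \<in> A \<and>
             (u = (k - 1, l) \<or> u = (k + 1, l))" (is "?P \<or> ?H \<or> ?V")
          by (rule cell_same_fixed[OF f(1) C c])
        obtain x where x: "fstep r B' k l x D'" using twin_fstep_adj[OF g(1) t(1) t(3) a(1)] by blast
        obtain y where y: "fstep r C' k l y D'" using twin_fstep_adj[OF g(2) t(2) t(3) a(2)] by blast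
        note b = fstepD[OF f(1)]
        have fx: "fixed r (i, j)" "fixed r (k, l)" using b(3) fstepD(3)[OF g(1)] by auto
        have stepI: "step r X Y" if "fstep r X m n z Y" for X Y m n z using that unfolding step_def fstep_def by blast
        show thesis
        proof (cases "(i - 1, j + 1) \<in> A \<and> (i + 1, j - 1) \<in> A")
          case pq: True
          have far: "(i + 1, j + 1) \<notin> A" "(i, j + 2) \<notin> A" "(i + 2, j) \<notin> A"
            using idealD[OF b(1), of "i+1" "j+1" i j] idealD[OF b(1), of i "j+2" i j] idealD[OF b(1), of "i+2" j i j] b(5) by auto
          have kl: "k = i + 1 \<and> l = j + 1" using k
          proof (elim disjE)
            assume ?H
            then show ?thesis using fixed_row_unique[OF b(1) b(1) refl, of r "i+1" l "j+1"] far pq fx by auto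
          next
            assume ?V
            then show ?thesis using fixed_col_unique[OF b(1) b(1) refl, of r k "j+1" "i+1"] far pq fx by auto
          qed simp
          have nb: "(i, j + 2) \<notin> B" "(i + 2, j) \<notin> B" using far b(3,4,7) unfolding nbrs_def by auto
          have nb': "(k - 1, l + 1) \<notin> X'" "(k + 1, l - 1) \<notin> X'" if "twin r B X'" for X'
          proof -
            have e: "(k - 1, l + 1) = (i, j + 2)" "(k + 1, l - 1) = (i + 2, j)" using kl by auto
            show "(k - 1, l + 1) \<notin> X'" "(k + 1, l - 1) \<notin> X'"
              unfolding e using twinD[OF that, of "(i, j + 2)"] twinD[OF that, of "(i + 2, j)"] nb fx by auto
          qed
          have BC: "twin r B C" by (rule twin_fstepI[OF f(1) C twin_refl[OF b(1)]])
          \<comment> \<open>At \<open>(k, l) = (i + 1, j + 1)\<close> no diagonal neighbour is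
            present, so the removed variable square is one of \<open>(i, j + 1)\<close> and
            \<open>(i + 1, j)\<close> and the other one stays. Both pullbacks therefore end at
            \<open>D'\<close> without the whole two-by-two block, hence at the same shape.\<close>
          have one: "(i, j + 1) \<in> B' \<longleftrightarrow> (i + 1, j) \<notin> B'" "(i, j + 1) \<in> C' \<longleftrightarrow> (i + 1, j) \<notin> C'"
            using fstep_types(4)[OF x nb'[OF t(1)]] fstep_types(4)[OF y nb'[OF twin_trans[OF BC t(2)]]] kl
             fstepD(6)[OF x] fstepD(6)[OF y] by auto
          obtain A1 v1 where A1: "fstep r A1 i j v1 B'" "A1 = B' - {(i, j), (i, j + 1), (i + 1, j)}"
          proof (rule fstep_pullback[OF f(1) t(1)])
            fix A1 v1
            assume "fstep r A1 i j v1 B'" "(i - 1, j + 1) \<in> A \<Longrightarrow> (i + 1, j - 1) \<in> A \<Longrightarrow>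
              A1 = B' - {(i, j), (i, j + 1), (i + 1, j)}"
            then show thesis using that pq by blast
          qed (use one in blast)
          obtain A2 v2 where A2: "fstep r A2 i j v2 C'" "A2 = C' - {(i, j), (i, j + 1), (i + 1, j)}"
          proof (rule fstep_pullback[OF C t(2)])
            fix A1 v1
            assume "fstep r A1 i j v1 C'" "(i - 1, j + 1) \<in> A \<Longrightarrow> (i + 1, j - 1) \<in> A \<Longrightarrow>
              A1 = C' - {(i, j), (i, j + 1), (i + 1, j)}"
            then show thesis using that pq by blast
          qed (use one in blast)
          have xv: "x = (i + 1, j) \<or> x = (i, j + 1)" "y = (i + 1, j) \<or> y = (i, j + 1)"
            using fstep_types(4)[OF x nb'[OF t(1)]] fstep_types(4)[OF y nb'[OF twin_trans[OF BC t(2)]]] kl by auto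
          have "B' - {(i, j), (i, j + 1), (i + 1, j)} = D' - {(i + 1, j + 1), (i, j), (i, j + 1), (i + 1, j)}"
            unfolding fstepD(7)[OF x] using fstepD(5)[OF x] xv(1) kl by (elim disjE) auto
          moreover have "C' - {(i, j), (i, j + 1), (i + 1, j)} = D' - {(i + 1, j + 1), (i, j), (i, j + 1), (i + 1, j)}"
            unfolding fstepD(7)[OF y] using fstepD(5)[OF y] xv(2) kl by (elim disjE) auto
          ultimately have "A1 = A2" using A1(2) A2(2) by simp
          then have "step r A1 C'" using stepI[OF A2(1)] by simp
          then show thesis using that[OF twin_fstepD[OF f(1) A1(1) t(1)] stepI[OF A1(1)]] by simp
        next
          case npq: False
          have xB: "(i, j) \<in> B" using b(7) by auto
          \<comment> \<open>The bumped domino lies far enough along its row or column to have a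
            diagonal neighbour in \<open>B\<close>, so its removal is unique and
            \<open>B' = C'\<close>.\<close>
          have near: "(k - 1, l + 1) \<in> B \<or> (k + 1, l - 1) \<in> B"
            using k
          proof (elim disjE)
            assume ?P then show ?thesis using npq by auto
          next
            assume h: ?H
            have "(i + 1, j - 1) \<notin> A"
            proof
              assume q: "(i + 1, j - 1) \<in> A"
              then have "(i - 1, j + 1) \<notin> A" using npq by auto
              from fstep_types(3)[OF f(1) this q] have "v = (i + 1, j) \<or> v = (i - 1, j)" by (simp split: if_splits)
              then show False using h by auto
            qed
            then have "\<not> j - 1 \<le> l - 2" using idealD[OF b(1), of "i+1" "l-2" "i+1" "j-1"] conjunct1[OF conjunct2[OF conjunct2[OF conjunct2[OF h]]]] by blast
            moreover have "l \<noteq> j" using fx h by auto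
            ultimately have "(i, l + 1) \<in> B" using idealD[OF b(2) xB, of i "l+1"] by auto
            then show ?thesis using h by auto
          next
            assume h: ?V
            have "(i - 1, j + 1) \<notin> A"
            proof
              assume q: "(i - 1, j + 1) \<in> A"
              then have "(i + 1, j - 1) \<notin> A" using npq by auto
              from fstep_types(2)[OF f(1) q this] have "v = (i, j + 1) \<or> v = (i, j - 1)" by (simp split: if_splits)
              then show False using h by auto
            qed
            then have "\<not> i - 1 \<le> k - 2" using h idealD[OF b(1), of "k-2" "j+1" "i-1" "j+1"] by auto
            moreover have "k \<noteq> i" using fx h by auto
            ultimately have "(k + 1, j) \<in> B" using idealD[OF b(2) xB, of "k+1" j] by auto
            then show ?thesis using h by auto
          qed
          then have "(k - 1, l + 1) \<in> B' \<or> (k + 1, l - 1) \<in> B'"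
            using twinD[OF t(1), of "(k-1,l+1)"] twinD[OF t(1), of "(k+1,l-1)"] fx by auto
          then have BC: "B' = C'" using fstep_remove_unique[OF x y] by blast
          obtain A1 v1 where A1: "fstep r A1 i j v1 B'"
            by (rule fstep_pullback[OF f(1) t(1)]) (use npq in blast)+
          then have "step r A1 C'" using stepI[OF A1] BC by simp
          then show thesis using that[OF twin_fstepD[OF f(1) A1 t(1)] stepI[OF A1]] by simp
        qed
      qed
    qed
  qed
qed

section \<open>Minimality along lattice paths\<close>

lemma stepI: "fstep r A i j v B \<Longrightarrow> step r A B"
  unfolding step_def fstep_def by blast

lemma adjI: "step r A B \<Longrightarrow> adj r A B" "step r A B \<Longrightarrow> adj r B A"
  unfolding adj_def by auto

text \<open>By \<open>fstep_pushes_flips\<close> a flip at \<open>D\<close> that the competitor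
  \<open>D2\<close> lacks comes with a pair of flips right of and below the added fixed square. For
  different fixed squares this pair would have two positions at once; for equal ones
  \<open>cell_same_fixed_twin\<close> excludes it; and for an entry both dominoes run in the same
  prescribed direction.\<close>

lemma cell_forward:
  assumes A: "border \<subseteq> A" "border \<subseteq> A'"
    and s: "step r A B" "step r A C" "step r A' B'" "step r A' C'"
    and c: "cell e A B C D" and c': "cell e A' B' C' D'"
    and t: "twin r A A'" "twin r B B'" "twin r C C'"
    and nb: "\<And>i j v w v' w'. fstep r A i j v B \<Longrightarrow> fstep r A i j w C \<Longrightarrow> fstep r A' i j v' B' \<Longrightarrow>
       fstep r A' i j w' C' \<Longrightarrow> (i - 1, j + 1) \<notin> A \<Longrightarrow> (i + 1, j - 1) \<notin> A \<Longrightarrow> v = v'"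
  shows "twin r D D' \<and> (\<forall>B2 C2 D2. twin r B B2 \<longrightarrow> twin r C C2 \<longrightarrow> twin r D D2 \<longrightarrow> adj r B2 D2 \<longrightarrow> adj r C2 D2 \<longrightarrow>
    flips B B' \<subseteq> flips B B2 \<longrightarrow> flips C C' \<subseteq> flips C C2 \<longrightarrow> flips D D' \<subseteq> flips D D2)"
proof -
  have iA: "ideal A" "ideal A'" using t twin_ideal by blast+
  have push: "(k - 1, l + 1) \<in> X \<and> (k + 1, l - 1) \<in> X \<and> (z = (k, l + 1) \<or> z = (k + 1, l)) \<and>
      (k, l + 1) \<in> flips D D' \<and> (k + 1, l) \<in> flips D D' \<and> (k, l + 1) \<notin> flips D D2 \<and> (k + 1, l) \<notin> flips D D2"
    if h: "fstep r X k l u D" "fstep r X' k l x D'" "twin r X X'" "twin r X X2" "twin r D D2" "adj r X2 D2"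
      "flips X X' \<subseteq> flips X X2" "z \<in> flips D D'" "z \<notin> flips D D2" for X k l u X' x X2 D2 z
  proof -
    obtain y where y: "fstep r X2 k l y D2" by (rule twin_fstep_adj[OF h(1,4,5,6)])
    show ?thesis using fstep_pushes_flips[OF h(1,2) y h(3,4,7,8,9)] by blast
  qed
  show ?thesis
  proof (cases "e = 0")
    case False
    obtain k l u where k: "B = A" "C = A" "fstep r A k l u D"
      "e = 1 \<and> k = 1 \<and> (1, l) \<notin> A \<and> (1, l - 2) \<in> A \<and> (u = (1, l - 1) \<or> u = (1, l + 1)) \<or>
     e = - 1 \<and> l = 1 \<and> (k, 1) \<notin> A \<and> (k - 2, 1) \<in> A \<and> (u = (k - 1, 1) \<or> u = (k + 1, 1))"
      by (rule cell_entry[OF iA(1) A(1) c False, of r])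
    obtain k' l' u' where k': "B' = A'" "C' = A'" "fstep r A' k' l' u' D'"
      "e = 1 \<and> k' = 1 \<and> (1, l') \<notin> A' \<and> (1, l' - 2) \<in> A' \<and> (u' = (1, l' - 1) \<or> u' = (1, l' + 1)) \<or>
     e = - 1 \<and> l' = 1 \<and> (k', 1) \<notin> A' \<and> (k' - 2, 1) \<in> A' \<and> (u' = (k' - 1, 1) \<or> u' = (k' + 1, 1))"
      by (rule cell_entry[OF iA(2) A(2) c' False, of r])
    have fx: "fixed r (k, l)" "fixed r (k', l')" using fstepD(3)[OF k(3)] fstepD(3)[OF k'(3)] by auto
    have eq: "k' = k \<and> l' = l"
      using k(4)
    proof
      assume h: "e = 1 \<and> k = 1 \<and> (1, l) \<notin> A \<and> (1, l - 2) \<in> A \<and> (u = (1, l - 1) \<or> u = (1, l + 1))"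
      then have h': "e = 1 \<and> k' = 1 \<and> (1, l') \<notin> A' \<and> (1, l' - 2) \<in> A'" using k'(4) by auto
      then show ?thesis using fixed_row_unique[OF iA twinD[OF t(1)], of r 1 l l'] h fx by auto
    next
      assume h: "e = - 1 \<and> l = 1 \<and> (k, 1) \<notin> A \<and> (k - 2, 1) \<in> A \<and> (u = (k - 1, 1) \<or> u = (k + 1, 1))"
      then have h': "e = - 1 \<and> l' = 1 \<and> (k', 1) \<notin> A' \<and> (k' - 2, 1) \<in> A'" using k'(4) by auto
      then show ?thesis using fixed_col_unique[OF iA twinD[OF t(1)], of r k 1 k'] h fx by auto
    qed
    have f': "fstep r A' k l u' D'" using k'(3) eq by simp
    have D: "twin r D D'" by (rule twin_fstepI[OF k(3) f' t(1)])
    have "z \<in> flips D D2"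
      if h: "twin r B B2" "twin r D D2" "adj r B2 D2" "flips B B' \<subseteq> flips B B2" "z \<in> flips D D'" for B2 D2 z
    proof (rule ccontr)
      assume n: "z \<notin> flips D D2"
      have p: "(k - 1, l + 1) \<in> A \<and> (k + 1, l - 1) \<in> A \<and> (k, l + 1) \<in> flips D D'"
        using push[OF k(3) f' t(1) _ h(2,3) _ h(5) n] h(1,4) k(1) k'(1) by simp
      have p': "(k - 1, l + 1) \<in> A' \<and> (k + 1, l - 1) \<in> A'"
        using p twinD[OF t(1), of "(k - 1, l + 1)"] twinD[OF t(1), of "(k + 1, l - 1)"] fx by auto
      have u: "u = (k, l + 1) \<or> u = (k + 1, l)" "u' = (k, l + 1) \<or> u' = (k + 1, l)"
        using fstep_types(1)[OF k(3)] fstep_types(1)[OF f'] p p' by auto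
      then have "u = u'" using k(4) k'(4) eq by auto
      moreover have "(k, l + 1) \<notin> A" "(k, l + 1) \<notin> A'"
        using idealD[OF iA(1), of k "l+1" k l] idealD[OF iA(2), of k "l+1" k l] fstepD(5)[OF k(3)] fstepD(5)[OF f'] by auto
      ultimately have "(k, l + 1) \<notin> flips D D'"
        unfolding fstepD(7)[OF k(3)] fstepD(7)[OF f'] flips_def by auto
      then show False using p by simp
    qed
    then show ?thesis using D by blast
  next
    case e: True
    show ?thesis
    proof (cases "A = B \<or> A = C")
      case True
      then show ?thesis
      proof
        assume h: "A = B"
        have "A' = B'" using twin_adj_eq[OF t(1)] t(2) h adjI s(3) by simp
        then have "D = C" "D' = C'" using cell_eq_left c c' e h by blast+
        moreover have "C2 = D2" if "twin r C C2" "twin r D D2" "adj r C2 D2" for C2 D2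
          using twin_adj_eq[of r C C2 D2] that \<open>D = C\<close> by simp
        ultimately show ?thesis using t(3) by metis
      next
        assume h: "A = C"
        have "A' = C'" using twin_adj_eq[OF t(1)] t(3) h adjI s(4) by simp
        then have "D = B" "D' = B'" using cell_eq_right c c' e h by blast+
        moreover have "B2 = D2" if "twin r B B2" "twin r D D2" "adj r B2 D2" for B2 D2
          using twin_adj_eq[of r B B2 D2] that \<open>D = B\<close> by simp
        ultimately show ?thesis using t(2) by metis
      qed
    next
      case False
      then obtain i j v i' j' w where f: "fstep r A i j v B" "fstep r A i' j' w C" using s unfolding step_def by blast
      obtain v' where f1: "fstep r A' i j v' B'" by (rule twin_fstep_adj[OF f(1) t(1,2) adjI(1)[OF s(3)]])
      obtain w' where f2: "fstep r A' i' j' w' C'" by (rule twin_fstep_adj[OF f(2) t(1,3) adjI(1)[OF s(4)]])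
      show ?thesis
      proof (cases "(i, j) = (i', j')")
        case False
        obtain x y where g: "fstep r B i' j' x D" "fstep r C i j y D" using cell_distinct_fixed[OF f c False] by blast
        obtain x' y' where g': "fstep r B' i' j' x' D'" "fstep r C' i j y' D'" using cell_distinct_fixed[OF f1 f2 c' False] by blast
        have D: "twin r D D'" by (rule twin_fstepI[OF g(1) g'(1) t(2)])
        have "z \<in> flips D D2"
          if h: "twin r B B2" "twin r C C2" "twin r D D2" "adj r B2 D2" "adj r C2 D2"
            "flips B B' \<subseteq> flips B B2" "flips C C' \<subseteq> flips C C2" "z \<in> flips D D'" for B2 C2 D2 z
        proof (rule ccontr)
          assume n: "z \<notin> flips D D2"
          note 1 = push[OF g(1) g'(1) t(2) h(1,3,4,6)]
          note 2 = push[OF g(2) g'(2) t(3) h(2,3,5,7)]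
          have a: "z = (i', j' + 1) \<or> z = (i' + 1, j')" "(i', j' + 1) \<in> flips D D' \<and> (i' + 1, j') \<in> flips D D'"
            "(i', j' + 1) \<notin> flips D D2 \<and> (i' + 1, j') \<notin> flips D D2" using 1[OF h(8) n] by blast+
          \<comment> \<open>Seen from \<open>B\<close> the pair surrounds \<open>(i', j')\<close>,
            seen from \<open>C\<close> it surrounds \<open>(i, j)\<close>; the same pair determines
            a single fixed square.\<close>
          have b: "(i', j' + 1) = (i, j + 1) \<or> (i', j' + 1) = (i + 1, j)" "(i' + 1, j') = (i, j + 1) \<or> (i' + 1, j') = (i + 1, j)"
            using 2[of "(i', j' + 1)"] 2[of "(i' + 1, j')"] a(2,3) by blast+
          show False using b False by auto
        qed
        then show ?thesis using D by blast
      next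
        case True
        then have C: "fstep r A i j w C" "fstep r A' i j w' C'" using f f2 by auto
        obtain k l u u' x x' where g: "fstep r B k l u D" "fstep r C k l u' D" "fstep r B' k l x D'" "fstep r C' k l x' D'"
          "(k - 1, l + 1) \<in> B \<and> (k + 1, l - 1) \<in> B \<longrightarrow> (k, l + 1) \<notin> flips D D'"
        proof (rule cell_same_fixed_twin[OF f(1) C(1) c f1 C(2) c' t(1) nb[OF f(1) C(1) f1 C(2)]])
          fix k l u u' x x' assume g: "fstep r B k l u D" "fstep r C k l u' D" "fstep r B' k l x D'" "fstep r C' k l x' D'"
            "(k - 1, l + 1) \<in> B \<Longrightarrow> (k + 1, l - 1) \<in> B \<Longrightarrow> (k, l + 1) \<notin> flips D D'"
          show thesis by (rule that[OF g(1-4)]) (use g(5) in blast)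
        qed
        have D: "twin r D D'" by (rule twin_fstepI[OF g(1) g(3) t(2)])
        have "z \<in> flips D D2"
          if h: "twin r B B2" "twin r D D2" "adj r B2 D2" "flips B B' \<subseteq> flips B B2" "z \<in> flips D D'" for B2 D2 z
        proof (rule ccontr)
          assume n: "z \<notin> flips D D2"
          show False using push[OF g(1) g(3) t(2) h n] g(5) by blast
        qed
        then show ?thesis using D by blast
      qed
    qed
  qed
qed

section \<open>Minimal twin paths and the crossing of one cell\<close>

definition twin_path :: "nat \<Rightarrow> nat \<Rightarrow> (nat \<Rightarrow> square set) \<Rightarrow> (nat \<Rightarrow> square set) \<Rightarrow> bool" where
  "twin_path r N P g \<longleftrightarrow> (\<forall>t\<le>N. twin r (P t) (g t)) \<and> (\<forall>t<N. adj r (g t) (g (Suc t)))"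

text \<open>The path \<open>P'\<close> flips as few squares of \<open>P\<close> as the common end point \<open>E\<close> permits. Connectivity of the
  extended cycles through \<open>delta r\<close> enters the proof only in this form.\<close>

definition minimal :: "nat \<Rightarrow> nat \<Rightarrow> square set \<Rightarrow> (nat \<Rightarrow> square set) \<Rightarrow> (nat \<Rightarrow> square set) \<Rightarrow> bool" where
  "minimal r N E P P' \<longleftrightarrow> twin_path r N P P' \<and> P' 0 = E \<and> P' N = E \<and>
    (\<forall>g. twin_path r N P g \<longrightarrow> g 0 = E \<longrightarrow> g N = E \<longrightarrow> (\<forall>t\<le>N. flips (P t) (P' t) \<subseteq> flips (P t) (g t)))"

lemma twin_path_update:
  assumes "twin_path r N P g" "Suc q < N" "twin r X Y" "adj r (g q) Y" "adj r Y (g (Suc (Suc q)))"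
  shows "twin_path r N (P(Suc q := X)) (g(Suc q := Y))"
  unfolding twin_path_def
proof (intro conjI allI impI)
  fix t assume "t \<le> N" then show "twin r ((P(Suc q := X)) t) ((g(Suc q := Y)) t)"
    using assms unfolding twin_path_def by auto
next
  fix t assume "t < N" then show "adj r ((g(Suc q := Y)) t) ((g(Suc q := Y)) (Suc t))"
    using assms unfolding twin_path_def by auto
qed

text \<open>Minimality is used twice: near the old vertex to rule out diverging orientations, and
  then against pulled-back competitors to obtain minimality at the new vertex.\<close>

lemma minimal_flip:
  assumes m: "minimal r N E P P'" and q: "Suc q < N"
    and A: "border \<subseteq> P (Suc q)" "border \<subseteq> P' (Suc q)"
    and s: "step r (P (Suc q)) (P q)" "step r (P (Suc q)) (P (Suc (Suc q)))"
      "step r (P' (Suc q)) (P' q)" "step r (P' (Suc q)) (P' (Suc (Suc q)))"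
    and c: "cell e (P (Suc q)) (P q) (P (Suc (Suc q))) D"
    and c': "cell e (P' (Suc q)) (P' q) (P' (Suc (Suc q))) D'"
  shows "minimal r N E (P(Suc q := D)) (P'(Suc q := D'))"
proof -
  define A B C where abc: "A = P (Suc q)" "B = P q" "C = P (Suc (Suc q))"
  define A' B' C' where abc': "A' = P' (Suc q)" "B' = P' q" "C' = P' (Suc (Suc q))"
  have tp: "twin_path r N P P'" "P' 0 = E" "P' N = E" and
    mn: "\<And>g t. twin_path r N P g \<Longrightarrow> g 0 = E \<Longrightarrow> g N = E \<Longrightarrow> t \<le> N \<Longrightarrow> flips (P t) (P' t) \<subseteq> flips (P t) (g t)"
    using m unfolding minimal_def by blast+
  have t: "twin r A A'" "twin r B B'" "twin r C C'" using tp(1) q unfolding twin_path_def abc abc' by auto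
  note s' = s[folded abc abc'] and cc = c[folded abc] c'[folded abc'] and A' = A[folded abc abc']
  have nb: "v = v'" if h: "fstep r A i j v B" "fstep r A i j w C" "fstep r A' i j v' B'"
       "fstep r A' i j w' C'" and p: "(i - 1, j + 1) \<notin> A" "(i + 1, j - 1) \<notin> A" for i j v w v' w'
  proof (rule ccontr)
    assume ne: "v \<noteq> v'"
    note b = fstepD[OF h(3)]
    have p': "(i - 1, j + 1) \<notin> A'" "(i + 1, j - 1) \<notin> A'"
      using twinD[OF t(1), of "(i-1,j+1)"] twinD[OF t(1), of "(i+1,j-1)"] p b(3) by auto
    note ty = fstep_types(4)[OF h(1) p] and ty' = fstep_types(4)[OF h(3) p']
    have w': "w' = v'" using ty' fstep_types(4)[OF h(4) p'] b(6) fstepD(6)[OF h(4)] by auto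
    have BC: "B' = C'" using b(7) fstepD(7)[OF h(4)] w' by simp
    have v: "v = (i, j - 1) \<or> v = (i - 1, j)" "v \<in> A'" using ty ty' ne by auto
    have pB: "(i - 1, j + 1) \<notin> B'" "(i + 1, j - 1) \<notin> B'" using p' b(3,7) ty' by auto
    have i1: "ideal (B' - {(i, j)})" by (rule ideal_remove[OF b(2)]) (use ty' in auto)
    have i2: "ideal ((B' - {(i, j)}) - {v})"
      using v(1) ideal_remove[OF i1, of i "j-1"] ideal_remove[OF i1, of "i-1" j] pB by auto
    \<comment> \<open>Taking \<open>v\<close> instead of \<open>v'\<close> off
      \<open>B' = C'\<close> gives another admissible vertex in which \<open>v\<close> is not
      flipped, whereas \<open>A'\<close> flips it; this contradicts minimality.\<close>
    define A2 where "A2 = (B' - {(i, j)}) - {v}"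
    have f2: "fstep r A2 i j v B'"
      unfolding fstep_def A2_def using i2 b(2,3,7) v(2) fstepD(4)[OF h(1)] by auto
    have t2: "twin r A A2" by (rule twin_fstepD[OF h(1) f2 t(2)])
    have "twin_path r N (P(Suc q := A)) (P'(Suc q := A2))"
      by (rule twin_path_update[OF tp(1) q t2]) (use adjI[OF stepI[OF f2]] BC abc' in auto)
    then have "twin_path r N P (P'(Suc q := A2))" using abc(1) by simp
    from mn[OF this, of "Suc q"] have "flips A A' \<subseteq> flips A A2" using tp q abc abc' by auto
    moreover have "v \<in> flips A A'" using v(2) fstepD(6)[OF h(1)] unfolding flips_def by auto
    moreover have "v \<notin> flips A A2" using fstepD(6)[OF h(1)] unfolding flips_def A2_def by auto
    ultimately show False by blast
  qed
  have fw0: "twin r D D' \<and> (\<forall>B2 C2 D2. twin r B B2 \<longrightarrow> twin r C C2 \<longrightarrow> twin r D D2 \<longrightarrow> adj r B2 D2 \<longrightarrow> adj r C2 D2 \<longrightarrow>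
    flips B B' \<subseteq> flips B B2 \<longrightarrow> flips C C' \<subseteq> flips C C2 \<longrightarrow> flips D D' \<subseteq> flips D D2)"
    by (rule cell_forward[OF A' s' cc t]) (rule nb)
  have fw: "twin r D D'" "\<And>B2 C2 D2. twin r B B2 \<Longrightarrow> twin r C C2 \<Longrightarrow> twin r D D2 \<Longrightarrow> adj r B2 D2 \<Longrightarrow> adj r C2 D2 \<Longrightarrow>
    flips B B' \<subseteq> flips B B2 \<Longrightarrow> flips C C' \<subseteq> flips C C2 \<Longrightarrow> flips D D' \<subseteq> flips D D2"
    using fw0 by blast+
  have st: "step r B' D'" "step r C' D'" by (rule cell_step[OF A'(2) s'(3,4) cc(2)])+
  show ?thesis unfolding minimal_def
  proof (intro conjI allI impI)
    show "twin_path r N (P(Suc q := D)) (P'(Suc q := D'))"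
      by (rule twin_path_update[OF tp(1) q fw(1)]) (use adjI st abc' in auto)
    show "(P'(Suc q := D')) 0 = E" "(P'(Suc q := D')) N = E" using tp q by auto
    fix g u assume g: "twin_path r N (P(Suc q := D)) g" "g 0 = E" "g N = E" and u: "u \<le> N"
    have gt: "twin r ((P(Suc q := D)) t) (g t)" if "t \<le> N" for t using g(1) that unfolding twin_path_def by blast
    have tg: "twin r B (g q)" "twin r D (g (Suc q))" "twin r C (g (Suc (Suc q)))"
      using gt[of q] gt[of "Suc q"] gt[of "Suc (Suc q)"] q abc by auto
    have ag: "adj r (g q) (g (Suc q))" "adj r (g (Suc (Suc q))) (g (Suc q))"
      using g(1) q unfolding twin_path_def adj_def by auto
    \<comment> \<open>The competitor \<open>g\<close> of the new path agrees with its pullback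
      everywhere except at \<open>Suc q\<close>, so minimality of the old path bounds the flips at
      both neighbours, and \<open>fw\<close> transfers the bound to \<open>D\<close>.\<close>
    obtain A2 where A2: "twin r A A2" "step r A2 (g q)" "step r A2 (g (Suc (Suc q)))"
      by (rule cell_pullback[OF A'(1) s'(1,2) cc(1) tg(1,3,2) ag])
    have "twin_path r N ((P(Suc q := D))(Suc q := A)) (g(Suc q := A2))"
      by (rule twin_path_update[OF g(1) q A2(1)]) (use adjI A2 in auto)
    then have "twin_path r N P (g(Suc q := A2))" using abc(1) by simp
    note mg = mn[OF this]
    have all: "flips (P t) (P' t) \<subseteq> flips (P t) (g t)" if "t \<le> N" "t \<noteq> Suc q" for t
      using mg[of t] that g q by auto
    have "flips D D' \<subseteq> flips D (g (Suc q))"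
      by (rule fw(2)[OF tg(1,3,2) ag]) (use all[of q] all[of "Suc (Suc q)"] q abc abc' in auto)
    then show "flips ((P(Suc q := D)) u) ((P'(Suc q := D')) u) \<subseteq> flips ((P(Suc q := D)) u) (g u)"
      using all[of u] u by (cases "u = Suc q") auto
  qed
qed

section \<open>Sweeping the grid\<close>

locale growth =
  fixes n :: nat and L :: "nat \<Rightarrow> nat \<Rightarrow> square set" and e :: "nat \<Rightarrow> nat \<Rightarrow> int" and Z :: "square set"
  assumes Z: "ideal Z" "border \<subseteq> Z"
    and left: "\<And>i. i \<le> n \<Longrightarrow> L i 0 = Z" and bottom: "\<And>j. j \<le> n \<Longrightarrow> L 0 j = Z"
    and cells: "\<And>i j. i < n \<Longrightarrow> j < n \<Longrightarrow> cell (e i j) (L i j) (L i (Suc j)) (L (Suc i) j) (L (Suc i) (Suc j))"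
begin

lemma steps_aux:
  assumes "i \<le> n"
  shows "(\<forall>j<n. step r (L i j) (L i (Suc j))) \<and> (\<forall>j\<le>n. border \<subseteq> L i j) \<and>
    (i < n \<longrightarrow> (\<forall>j\<le>n. step r (L i j) (L (Suc i) j)))"
  using assms
proof (induction i)
  have up: "(\<forall>j\<le>n. step r (L i j) (L (Suc i) j)) \<and> (\<forall>j<n. step r (L (Suc i) j) (L (Suc i) (Suc j)))"
    if i: "i < n" and h: "\<forall>j<n. step r (L i j) (L i (Suc j))" and b: "\<forall>j\<le>n. border \<subseteq> L i j" for i
  proof -
    have v: "step r (L i j) (L (Suc i) j)" if "j \<le> n" for j
      using that
    proof (induction j)
      case 0 then show ?case using left[of i] left[of "Suc i"] i Z unfolding step_def by simp
    next
      case (Suc j)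
      then show ?case using cell_step(1)[OF _ _ _ cells[OF i, of j], of r] h b by simp
    qed
    have "step r (L (Suc i) j) (L (Suc i) (Suc j))" if "j < n" for j
      using cell_step(2)[OF _ _ _ cells[OF i that], of r] h b v[of j] that by simp
    then show ?thesis using v by blast
  qed
  {
    case 0
    have a: "\<forall>j<n. step r (L 0 j) (L 0 (Suc j))" "\<forall>j\<le>n. border \<subseteq> L 0 j"
      using bottom Z unfolding step_def by auto
    then show ?case using up[of 0] by blast
  next
    case (Suc i)
    then have h: "\<forall>j<n. step r (L i j) (L i (Suc j))" "\<forall>j\<le>n. border \<subseteq> L i j" "i < n" by auto
    note u = up[OF h(3,1,2)]
    have "L i j \<subseteq> L (Suc i) j" if "j \<le> n" for j
      using u that unfolding step_def fstep_def by blast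
    then have b: "\<forall>j\<le>n. border \<subseteq> L (Suc i) j" using h(2) by blast
    then show ?case using u up[of "Suc i"] by blast
  }
qed

lemma steps:
  "i \<le> n \<Longrightarrow> j < n \<Longrightarrow> step r (L i j) (L i (Suc j))"
  "i < n \<Longrightarrow> j \<le> n \<Longrightarrow> step r (L i j) (L (Suc i) j)"
  "i \<le> n \<Longrightarrow> j \<le> n \<Longrightarrow> border \<subseteq> L i j"
  using steps_aux[of i] by auto

end

text \<open>The \<open>t\<close>-th vertex of the lattice path from \<open>(0, n)\<close> to \<open>(n, 0)\<close> below which exactly the cells of the first
  \<open>b\<close> columns and the lowest \<open>a\<close> cells of the next one lie.\<close>

definition sweep :: "nat \<Rightarrow> nat \<Rightarrow> nat \<Rightarrow> nat \<Rightarrow> nat \<times> nat" where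
  "sweep n b a t =
    (if t + b + 1 \<le> n + a then (if t + b + 1 \<le> n then (0, n - t) else (t + b + 1 - n, b + 1))
     else if t + b \<le> 2 * n then (t + b - n, b) else (n, 2 * n - t))"

theorem growth_minimal:
  assumes g: "growth n L e Z" and g': "growth n L' e Z'" and z: "twin r Z Z'"
  shows "minimal r (2 * n) Z' (\<lambda>t. if t \<le> n then L t n else L n (2 * n - t))
    (\<lambda>t. if t \<le> n then L' t n else L' n (2 * n - t))"
proof -
  interpret g: growth n L e Z by fact
  interpret g': growth n L' e Z' by fact
  let ?P = "\<lambda>L b a t. (case sweep n b a t of (i, j) \<Rightarrow> L i j) :: square set"
  have start: "minimal r (2 * n) Z' (?P L 0 0) (?P L' 0 0)"
  proof -
    have P: "?P L 0 0 t = Z" "?P L' 0 0 t = Z'" if "t \<le> 2 * n" for t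
      using that g.left g.bottom g'.left g'.bottom unfolding sweep_def by auto
    show ?thesis unfolding minimal_def
    proof (intro conjI allI impI)
      show "twin_path r (2 * n) (?P L 0 0) (?P L' 0 0)"
        unfolding twin_path_def using P z g'.Z by (auto simp: adj_def step_def)
      show "?P L' 0 0 0 = Z'" "?P L' 0 0 (2 * n) = Z'" using P by auto
      fix h t assume h: "twin_path r (2 * n) (?P L 0 0) h" "h 0 = Z'" and t: "t \<le> 2 * n"
      \<comment> \<open>On the left and bottom edges the shape is constantly \<open>Z\<close>; twins
        of one shape that are adjacent are equal, so the only competitor is the constant
        path.\<close>
      have "h t = Z'" using t
      proof (induction t)
        case (Suc t)
        have "twin r Z (h t)" "twin r Z (h (Suc t))" "adj r (h t) (h (Suc t))"
          using h(1) Suc.prems P(1)[of t] P(1)[of "Suc t"] unfolding twin_path_def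
          by (metis Suc_leD, metis, metis Suc_le_lessD)
        then have "h t = h (Suc t)" by (rule twin_adj_eq)
        then show ?case using Suc by simp
      qed (use h in simp)
      then show "flips (?P L 0 0 t) (?P L' 0 0 t) \<subseteq> flips (?P L 0 0 t) (h t)" using P[OF t] by simp
    qed
  qed
  have flip: "minimal r (2 * n) Z' (?P L b (Suc a)) (?P L' b (Suc a))"
    if m: "minimal r (2 * n) Z' (?P L b a) (?P L' b a)" and ab: "a < n" "b < n" for a b
  proof -
    \<comment> \<open>The next cell has the path vertices \<open>(a, Suc b)\<close>,
      \<open>(a, b)\<close> and \<open>(Suc a, b)\<close> at the positions \<open>q\<close>,
      \<open>q + 1\<close> and \<open>q + 2\<close>; crossing it replaces only the middle
      one.\<close>
    define q where "q = n - b + a - 1"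
    have q: "Suc q = n - b + a" "Suc q < 2 * n" using ab unfolding q_def by auto
    have v: "sweep n b a q = (a, Suc b)" "sweep n b a (Suc q) = (a, b)" "sweep n b a (Suc (Suc q)) = (Suc a, b)"
      using ab q unfolding sweep_def by auto
    have u: "?P K b (Suc a) = (?P K b a)(Suc q := K (Suc a) (Suc b))" for K :: "nat \<Rightarrow> nat \<Rightarrow> square set"
    proof
      fix t
      show "?P K b (Suc a) t = ((?P K b a)(Suc q := K (Suc a) (Suc b))) t"
      proof (cases "t = Suc q")
        case True
        then have "sweep n b (Suc a) t = (Suc a, Suc b)" using ab q unfolding sweep_def by auto
        then show ?thesis using True by simp
      next
        case False
        then have "sweep n b (Suc a) t = sweep n b a t" using ab q unfolding sweep_def by auto
        then show ?thesis using False by simp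
      qed
    qed
    show ?thesis unfolding u
      by (rule minimal_flip[OF m q(2), where e = "e a b"])
        (use v g.steps g'.steps g.cells g'.cells ab in auto)
  qed
  have row: "minimal r (2 * n) Z' (?P L b a) (?P L' b a)"
    if "minimal r (2 * n) Z' (?P L b 0) (?P L' b 0)" "b < n" "a \<le> n" for a b
    using that(3)
  proof (induction a)
    case (Suc a) then show ?case using flip[of b a] that(2) by simp
  qed (use that in simp)
  have nx: "sweep n b n = sweep n (Suc b) 0" if "b < n" for b
    using that unfolding sweep_def by (auto simp: fun_eq_iff)
  have all: "minimal r (2 * n) Z' (?P L b 0) (?P L' b 0)" if "b \<le> n" for b
    using that
  proof (induction b)
    case (Suc b) then show ?case using row[of b n] nx[of b] by simp
  qed (use start in simp)
  have "?P K n 0 = (\<lambda>t. if t \<le> n then K t n else K n (2 * n - t))" for K :: "nat \<Rightarrow> nat \<Rightarrow> square set"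
    by (auto simp: sweep_def fun_eq_iff)
  then show ?thesis using all[of n] by simp
qed

section \<open>Insertion as a growth diagram\<close>

text \<open>Since \<open>label\<close> vanishes outside the positive quadrant, \<open>sub\<close>
  already contains \<open>border\<close>, as the convention for shapes demands.\<close>

definition sub :: "tableau \<Rightarrow> nat \<Rightarrow> square set" where
  "sub T k = {s. label T s \<le> enat k}"

lemma label_border: "s \<in> border \<Longrightarrow> label T s = 0"
  by (auto simp: label_def border_def)

lemma label_inside: "s \<notin> border \<Longrightarrow> label T s = (case T s of None \<Rightarrow> \<infinity> | Some k \<Rightarrow> enat k)"
  by (auto simp: label_def border_def split: prod.splits)

lemma mem_sub: "s \<in> sub T k \<longleftrightarrow> s \<in> border \<or> (\<exists>l\<le>k. T s = Some l)"
  by (cases "s \<in> border"; cases "T s") (auto simp: sub_def label_border label_inside)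

text \<open>A domino tableau is encoded by its chain of shapes: monotonicity of labels becomes
  \<open>ideal\<close>, and having two adjacent squares per label becomes
  \<open>step\<close>.\<close>

definition wf_tab :: "nat \<Rightarrow> tableau \<Rightarrow> bool" where
  "wf_tab r T \<longleftrightarrow> dom T \<inter> border = {} \<and> finite (dom T) \<and> sub T 0 = core r \<union> border \<and>
     (\<forall>k. step r (sub T k) (sub T (Suc k)))"

definition domino :: "square set \<Rightarrow> bool" where
  "domino X \<longleftrightarrow> (\<exists>i j. X = {(i, j), (i, j + 1)} \<or> X = {(i, j), (i + 1, j)})"

lemma domino_card: "domino X \<Longrightarrow> card X = 2" "domino X \<Longrightarrow> finite X"
  unfolding domino_def by auto

lemma initial_segment_card:
  fixes S :: "int set"
  assumes "finite S" "\<And>j. j \<in> S \<Longrightarrow> 1 \<le> j" "\<And>j j'. j \<in> S \<Longrightarrow> 1 \<le> j' \<Longrightarrow> j' \<le> j \<Longrightarrow> j' \<in> S"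
  shows "S = {1..int (card S)}"
proof -
  define m where "m = Max (insert 0 S)"
  have m: "0 \<le> m" "\<And>j. j \<in> S \<Longrightarrow> j \<le> m" "m \<in> insert 0 S"
    using assms(1) Max_ge[of "insert 0 S"] Max_in[of "insert 0 S"] unfolding m_def by (auto simp del: Max_insert)
  have "S = {1..m}"
  proof
    show "S \<subseteq> {1..m}" using m(2) assms(2) by (meson atLeastAtMost_iff subsetI)
    show "{1..m} \<subseteq> S" using assms(3)[of m] m(3) by auto
  qed
  then show ?thesis using m(1) by simp
qed

lemma row_length_end:
  assumes "ideal (dom T \<union> border)" "dom T \<inter> border = {}" "finite (dom T)" "1 \<le> i"
  shows "(i, row_length T i) \<in> dom T \<union> border" "(i, row_length T i + 1) \<notin> dom T \<union> border"
proof -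
  let ?S = "{j. (i, j) \<in> dom T}"
  have "finite ?S" using finite_imageI[OF assms(3), of snd] by (rule rev_finite_subset) force
  moreover have "1 \<le> j" if "j \<in> ?S" for j using that assms(2) unfolding border_def by force
  moreover have "j' \<in> ?S" if "j \<in> ?S" "1 \<le> j'" "j' \<le> j" for j j'
    using idealD[OF assms(1), of i j i j'] that assms(4) unfolding border_def by auto
  ultimately have S: "?S = {1..row_length T i}" unfolding row_length_def by (rule initial_segment_card)
  have r0: "row_length T i \<ge> 0" unfolding row_length_def by simp
  have m: "(i, j) \<in> dom T \<longleftrightarrow> 1 \<le> j \<and> j \<le> row_length T i" for j using S by (auto simp: set_eq_iff)
  show "(i, row_length T i) \<in> dom T \<union> border" using m[of "row_length T i"] r0 unfolding border_def by auto
  show "(i, row_length T i + 1) \<notin> dom T \<union> border" using m[of "row_length T i + 1"] r0 assms(4) unfolding border_def by auto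
qed

lemma col_length_end:
  assumes "ideal (dom T \<union> border)" "dom T \<inter> border = {}" "finite (dom T)" "1 \<le> i"
  shows "(col_length T i, i) \<in> dom T \<union> border" "(col_length T i + 1, i) \<notin> dom T \<union> border"
proof -
  let ?S = "{j. (j, i) \<in> dom T}"
  have "finite ?S" using finite_imageI[OF assms(3), of fst] by (rule rev_finite_subset) force
  moreover have "1 \<le> j" if "j \<in> ?S" for j using that assms(2) unfolding border_def by force
  moreover have "j' \<in> ?S" if "j \<in> ?S" "1 \<le> j'" "j' \<le> j" for j j'
    using idealD[OF assms(1), of j i j' i] that assms(4) unfolding border_def by auto
  ultimately have S: "?S = {1..col_length T i}" unfolding col_length_def by (rule initial_segment_card)
  have r0: "col_length T i \<ge> 0" unfolding col_length_def by simp
  have m: "(j, i) \<in> dom T \<longleftrightarrow> 1 \<le> j \<and> j \<le> col_length T i" for j using S by (auto simp: set_eq_iff)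
  show "(col_length T i, i) \<in> dom T \<union> border" using m[of "col_length T i"] r0 unfolding border_def by auto
  show "(col_length T i + 1, i) \<notin> dom T \<union> border" using m[of "col_length T i + 1"] r0 assms(4) unfolding border_def by auto
qed

lemma not_horizontal_vertical: "\<not> horizontal {(i, j), (i + 1, j)}"
proof
  assume "horizontal {(i, j), (i + 1, j)}"
  then obtain a b where "{(i, j), (i + 1, j)} = {(a, b), (a, b + 1)}" unfolding horizontal_def by blast
  then show False unfolding doubleton_eq_iff by auto
qed

text \<open>The shape before the bump exceeds \<open>A\<close> by one domino \<open>X\<close>, so
  the three clauses of the insertion compare just \<open>X\<close> with \<open>supp T0 l\<close>.
  When the latter lies inside the shape, equal cardinality forces it to be \<open>X\<close>, which
  gives the rules \<open>rows\<close> and \<open>cols\<close>.\<close>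

lemma bump_cell:
  assumes T: "ideal (dom T \<union> border)" "dom T \<inter> border = {}" "finite (dom T)"
    and X: "domino X" "X \<inter> A = {}" "dom T \<union> border = A \<union> X" and bA: "border \<subseteq> A"
    and D: "domino (supp T0 l)" "supp T0 l \<inter> A = {}" "ideal (A \<union> supp T0 l)" and A: "ideal A"
  obtains Z where "bump T0 l T = put Z l T" "domino Z" "Z \<inter> (dom T \<union> border) = {}"
    "cell 0 A (dom T \<union> border) (A \<union> supp T0 l) (dom T \<union> border \<union> Z)"
proof -
  define D where "D = supp T0 l"
  define E where "E = dom T \<union> border"
  note Dd = D[folded D_def]
  have EX: "E = A \<union> X" using X(3) unfolding E_def .
  have iE: "ideal E" using T(1) unfolding E_def .
  have Db: "D \<inter> border = {}" using Dd(2) bA by auto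
  have DE: "D \<inter> dom T = D \<inter> E" "D \<subseteq> dom T \<longleftrightarrow> D \<subseteq> E" "D \<inter> E = D \<inter> X" using Db EX Dd(2) unfolding E_def by auto
  show thesis
  proof (cases "D \<inter> E = {}")
    case True
    have "bump T0 l T = put D l T" unfolding bump_def D_def[symmetric] Let_def using True DE by simp
    moreover have "cell 0 A E (A \<union> D) (E \<union> D)"
    proof -
      have "X \<inter> D = {}" using True DE(3) by blast
      from cell.disjoint[OF this X(2) Dd(2)] show ?thesis unfolding EX .
    qed
    ultimately show thesis using that Dd(1) True unfolding E_def D_def by blast
  next
    case ne: False
    show thesis
    proof (cases "D \<subseteq> E")
      case True
      then have DX: "D \<subseteq> X" using DE by auto
      have c2: "card D = 2" "card X = 2" "finite X" using domino_card Dd(1) X(1) by blast+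
      have "D = X" using card_subset_eq[OF c2(3) DX] c2 by simp
      then have EAD: "E = A \<union> D" using EX by simp
      from Dd(1) consider (h) a b where "D = {(a, b), (a, b + 1)}" | (v) a b where "D = {(a, b), (a + 1, b)}"
        unfolding domino_def by blast
      then show thesis
      proof cases
        case h
        have a0: "0 < a" "0 < b" using h Db unfolding border_def by auto
        have th: "(THE i. \<exists>j. (i, j) \<in> D) = a" unfolding h by (rule the_equality) auto
        have hor: "horizontal D" unfolding horizontal_def h by blast
        define m where "m = row_length T (a + 1)"
        define Z where "Z = {(a + 1, m + 1), (a + 1, m + 2)}"
        have bp: "bump T0 l T = put Z l T"
          unfolding bump_def D_def[symmetric] Let_def Z_def m_def
          using ne True DE th hor by (simp add: add_to_row_def)
        have m: "(a + 1, m) \<in> E" "(a + 1, m + 1) \<notin> E"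
          using row_length_end[OF T, of "a + 1"] a0 unfolding E_def m_def by auto
        have m2: "(a + 1, m + 2) \<notin> E" using idealD[OF iE, of "a+1" "m+2" "a+1" "m+1"] m by auto
        have "Z = {(a + 1, m + 1), (a + 1, (m + 1) + 1)}" unfolding Z_def by (simp add: add.assoc)
        then have Zd: "domino Z" unfolding domino_def by blast
        have "cell 0 A (A \<union> D) (A \<union> D) (A \<union> D \<union> {(a + 1, m + 1), (a + 1, (m + 1) + 1)})"
          by (rule cell.rows[OF h Dd(2)]) (use m EAD h in auto)
        then have "cell 0 A E (A \<union> D) (E \<union> Z)" unfolding EAD Z_def by (simp add: add.assoc)
        moreover have "Z \<inter> E = {}" unfolding Z_def using m m2 by auto
        ultimately show thesis using that[OF bp Zd] unfolding E_def D_def by blast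
      next
        case v
        have a0: "0 < a" "0 < b" using v Db unfolding border_def by auto
        have th: "(THE j. \<exists>i. (i, j) \<in> D) = b" unfolding v by (rule the_equality) auto
        have hor: "\<not> horizontal D" unfolding v by (rule not_horizontal_vertical)
        define m where "m = col_length T (b + 1)"
        define Z where "Z = {(m + 1, b + 1), (m + 2, b + 1)}"
        have bp: "bump T0 l T = put Z l T"
          unfolding bump_def D_def[symmetric] Let_def Z_def m_def
          using ne True DE th hor by (simp add: add_to_col_def)
        have m: "(m, b + 1) \<in> E" "(m + 1, b + 1) \<notin> E"
          using col_length_end[OF T, of "b + 1"] a0 unfolding E_def m_def by auto
        have m2: "(m + 2, b + 1) \<notin> E" using idealD[OF iE, of "m+2" "b+1" "m+1" "b+1"] m by auto
        have "Z = {(m + 1, b + 1), ((m + 1) + 1, b + 1)}" unfolding Z_def by (simp add: add.assoc)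
        then have Zd: "domino Z" unfolding domino_def by blast
        have "cell 0 A (A \<union> D) (A \<union> D) (A \<union> D \<union> {(m + 1, b + 1), ((m + 1) + 1, b + 1)})"
          by (rule cell.cols[OF v Dd(2)]) (use m EAD v in auto)
        then have "cell 0 A E (A \<union> D) (E \<union> Z)" unfolding EAD Z_def by (simp add: add.assoc)
        moreover have "Z \<inter> E = {}" unfolding Z_def using m m2 by auto
        ultimately show thesis using that[OF bp Zd] unfolding E_def D_def by blast
      qed
    next
      case nsub: False
      from Dd(1) consider (h) a b where "D = {(a, b), (a, b + 1)}" | (v) a b where "D = {(a, b), (a + 1, b)}"
        unfolding domino_def by blast
      then show thesis
      proof cases
        case h
        \<comment> \<open>The shape is down-closed, so a single common square must be the left one
          of the domino.\<close>
        have ab: "(a, b) \<in> E" "(a, b + 1) \<notin> E"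
          using ne nsub idealD[OF iE, of a "b+1" a b] unfolding h by auto
        have one: "D \<inter> dom T = {(a, b)}" unfolding DE(1) using ab unfolding h by auto
        have ab2: "(a + 1, b + 1) \<notin> E" using idealD[OF iE, of "a+1" "b+1" a "b+1"] ab by auto
        define Z where "Z = {(a, b + 1), (a + 1, b + 1)}"
        have hor: "horizontal D" unfolding horizontal_def h by blast
        have bp: "bump T0 l T = put Z l T"
          unfolding bump_def D_def[symmetric] Let_def Z_def
          using nsub DE(2) hor one by simp
        have Zd: "domino Z" unfolding domino_def Z_def by blast
        have "X \<inter> D = {(a, b)}" using DE one by auto
        from cell.overlap[OF this X(2) Dd(2)]
        have "cell 0 A E (A \<union> D) (insert (a + 1, b + 1) (A \<union> X \<union> D))" using EX by simp
        moreover have "insert (a + 1, b + 1) (A \<union> X \<union> D) = E \<union> Z" using EX ab unfolding Z_def h by auto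
        moreover have "Z \<inter> E = {}" unfolding Z_def using ab ab2 by auto
        ultimately show thesis using that[OF bp Zd] unfolding E_def D_def by simp
      next
        case v
        have ab: "(a, b) \<in> E" "(a + 1, b) \<notin> E"
          using ne nsub idealD[OF iE, of "a+1" b a b] unfolding v by auto
        have one: "D \<inter> dom T = {(a, b)}" unfolding DE(1) using ab unfolding v by auto
        have ab2: "(a + 1, b + 1) \<notin> E" using idealD[OF iE, of "a+1" "b+1" "a+1" b] ab by auto
        define Z where "Z = {(a + 1, b), (a + 1, b + 1)}"
        have hor: "\<not> horizontal D" unfolding v by (rule not_horizontal_vertical)
        have bp: "bump T0 l T = put Z l T"
          unfolding bump_def D_def[symmetric] Let_def Z_def
          using nsub DE(2) hor one by simp
        have Zd: "domino Z" unfolding domino_def Z_def by blast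
        have "X \<inter> D = {(a, b)}" using DE one by auto
        from cell.overlap[OF this X(2) Dd(2)]
        have "cell 0 A E (A \<union> D) (insert (a + 1, b + 1) (A \<union> X \<union> D))" using EX by simp
        moreover have "insert (a + 1, b + 1) (A \<union> X \<union> D) = E \<union> Z" using EX ab unfolding Z_def v by auto
        moreover have "Z \<inter> E = {}" unfolding Z_def using ab ab2 by auto
        ultimately show thesis using that[OF bp Zd] unfolding E_def D_def by simp
      qed
    qed
  qed
qed

lemma sub_put:
  assumes "Z \<inter> (dom T \<union> border) = {}"
  shows "sub (put Z l T) k = (if l \<le> k then sub T k \<union> Z else sub T k)"
  using assms by (auto simp: mem_sub put_def set_eq_iff)

lemma dom_put: "dom (put Z l T) = dom T \<union> Z"
  by (auto simp: put_def)

lemma labels_put: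
  assumes "Z \<inter> dom T = {}" "Z \<noteq> {}" "0 < l"
  shows "labels (put Z l T) = insert l (labels T)"
  using assms unfolding labels_def ran_def put_def by auto

lemma sub_top: "(\<And>s l. T s = Some l \<Longrightarrow> l \<le> k) \<Longrightarrow> sub T k = dom T \<union> border"
  by (auto simp: mem_sub dom_def)

lemma supp_sub:
  assumes "dom T \<inter> border = {}"
  shows "sub T (Suc k) = sub T k \<union> supp T (Suc k)" "supp T (Suc k) \<inter> sub T k = {}"
  using assms by (auto simp: mem_sub supp_def le_Suc_eq)

lemma nbrs_domino: "v \<in> nbrs i j \<Longrightarrow> domino {(i, j), v}"
proof -
  assume "v \<in> nbrs i j"
  then consider "v = (i - 1, j)" | "v = (i + 1, j)" | "v = (i, j - 1)" | "v = (i, j + 1)" unfolding nbrs_def by blast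
  then show ?thesis
  proof cases
    case 1
    then have "{(i, j), v} = {(i - 1, j), (i - 1 + 1, j)}" by auto
    then show ?thesis unfolding domino_def by blast
  next
    case 3
    then have "{(i, j), v} = {(i, j - 1), (i, j - 1 + 1)}" by auto
    then show ?thesis unfolding domino_def by blast
  qed (auto simp: domino_def)
qed

lemma step_domino:
  assumes "step r A B" "A \<noteq> B"
  obtains X where "domino X" "X \<inter> A = {}" "B = A \<union> X"
proof -
  obtain i j v where f: "fstep r A i j v B" using assms unfolding step_def by blast
  show thesis
    by (rule that[of "{(i, j), v}"]) (use fstepD[OF f] nbrs_domino in auto)
qed

text \<open>Adjacent squares have opposite parity, so one square of a domino is fixed whatever
  \<open>r\<close> is.\<close>

lemma domino_step:
  assumes X: "domino X" "X \<inter> A = {}" and i: "ideal A" "ideal (A \<union> X)"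
  shows "step r A (A \<union> X)"
proof -
  have two: "step r A (A \<union> X)" if h: "X = {(a, b), (c, d)}" "(c, d) \<in> nbrs a b" "(a, b) \<in> nbrs c d"
    "fixed r (a, b) \<longleftrightarrow> \<not> fixed r (c, d)" for a b c d
  proof (cases "fixed r (a, b)")
    case True
    have "fstep r A a b (c, d) (A \<union> X)" unfolding fstep_def using True h X(2) i by auto
    then show ?thesis by (rule stepI)
  next
    case False
    have "fstep r A c d (a, b) (A \<union> X)" unfolding fstep_def using False h X(2) i by auto
    then show ?thesis by (rule stepI)
  qed
  obtain a b where "X = {(a, b), (a, b + 1)} \<or> X = {(a, b), (a + 1, b)}" using X(1) unfolding domino_def by blast
  then show ?thesis
  proof
    assume h: "X = {(a, b), (a, b + 1)}"
    show ?thesis by (rule two[OF h]) (auto simp: nbrs_def)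
  next
    assume h: "X = {(a, b), (a + 1, b)}"
    show ?thesis by (rule two[OF h]) (auto simp: nbrs_def)
  qed
qed

lemma wf_tab_supp:
  assumes w: "wf_tab r T" and k: "Suc k \<in> labels T"
  shows "domino (supp T (Suc k))"
proof -
  have b: "dom T \<inter> border = {}" and s: "step r (sub T k) (sub T (Suc k))" using w unfolding wf_tab_def by auto
  note ss = supp_sub[OF b, of k]
  have "supp T (Suc k) \<noteq> {}" using k unfolding labels_def supp_def ran_def by auto
  then have "sub T k \<noteq> sub T (Suc k)" using ss by blast
  then obtain X where X: "domino X" "X \<inter> sub T k = {}" "sub T (Suc k) = sub T k \<union> X" by (rule step_domino[OF s])
  then have "supp T (Suc k) = X" using ss by blast
  then show ?thesis using X by simp
qed

lemma sub_Suc_not_label: "Suc k \<notin> labels T \<Longrightarrow> sub T (Suc k) = sub T k"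
  by (auto simp: mem_sub labels_def ran_def le_Suc_eq)

lemma finite_labels: "finite (dom T) \<Longrightarrow> finite (labels T)"
  unfolding labels_def using finite_ran by (rule rev_finite_subset) auto

text \<open>Cutting \<open>T0\<close> at \<open>i\<close> rather than at the least larger label
  changes nothing when \<open>i\<close> is not a label. It also makes insertion of a largest label
  the case of an empty bumping list and gives every \<open>k\<close> a stage of its own, matching a
  row of the grid.\<close>

definition insertion_stage :: "nat \<Rightarrow> int \<Rightarrow> tableau \<Rightarrow> nat \<Rightarrow> tableau" where
  "insertion_stage i e T0 k =
    fold (bump T0) (sorted_list_of_set {l \<in> labels T0. i < l \<and> l \<le> k}) (add_first i e (remove_from i T0))"

lemma insertion_stage_Suc:
  assumes "finite (labels T0)" "i \<le> k"
  shows "insertion_stage i e T0 (Suc k) =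
    (if Suc k \<in> labels T0 then bump T0 (Suc k) (insertion_stage i e T0 k) else insertion_stage i e T0 k)"
proof (cases "Suc k \<in> labels T0")
  case True
  let ?A = "{l \<in> labels T0. i < l \<and> l \<le> k}"
  have e: "{l \<in> labels T0. i < l \<and> l \<le> Suc k} = insert (Suc k) ?A" using True assms(2) by (auto simp: le_Suc_eq)
  have fin: "finite ?A" using assms(1) by simp
  have "sorted_list_of_set (insert (Suc k) ?A) = insort (Suc k) (sorted_list_of_set ?A)"
    by (rule sorted_list_of_set_insert[OF fin]) auto
  also have "\<dots> = sorted_list_of_set ?A @ [Suc k]"
    by (rule sorted_insort_is_snoc) (use fin in auto)
  finally show ?thesis unfolding insertion_stage_def e using True by simp
next
  case False
  then have "{l \<in> labels T0. i < l \<and> l \<le> Suc k} = {l \<in> labels T0. i < l \<and> l \<le> k}" by (auto simp: le_Suc_eq)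
  then show ?thesis unfolding insertion_stage_def using False by simp
qed

lemma insert_domino_stage:
  assumes fin: "finite (labels T0)" and i: "0 < i" "i \<notin> labels T0" and K: "\<And>l. l \<in> labels T0 \<Longrightarrow> l \<le> K"
  shows "insert_domino (i, j, e) T0 = insertion_stage i e T0 K"
proof (cases "\<forall>l\<in>labels T0. l < i")
  case True
  have "remove_from i T0 = T0"
  proof
    fix s show "remove_from i T0 s = T0 s"
    proof (cases "T0 s")
      case (Some k)
      then have "k = 0 \<or> k \<in> labels T0" unfolding labels_def by (auto intro: ranI)
      then have "\<not> i \<le> k" using True i by auto
      then show ?thesis using Some unfolding remove_from_def by simp
    qed (simp add: remove_from_def)
  qed
  moreover have e0: "{l \<in> labels T0. i < l \<and> l \<le> K} = {}" using True by auto
  ultimately show ?thesis using True unfolding insert_domino_def insertion_stage_def e0 by simp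
next
  case False
  let ?A = "{l \<in> labels T0. i < l}"
  define m where "m = Min ?A"
  have fA: "finite ?A" "?A \<noteq> {}" using fin False i(2) by (auto simp: not_less le_less)
  have m: "m \<in> ?A" "\<And>l. l \<in> ?A \<Longrightarrow> m \<le> l" using Min_in[OF fA] Min_le[OF fA(1)] unfolding m_def by auto
  have e1: "{l \<in> labels T0. m \<le> l} = {l \<in> labels T0. i < l \<and> l \<le> K}" using m K by force
  have "remove_from m T0 = remove_from i T0"
  proof
    fix s show "remove_from m T0 s = remove_from i T0 s"
    proof (cases "T0 s")
      case (Some k)
      then have "k = 0 \<or> k \<in> labels T0" unfolding labels_def by (auto intro: ranI)
      then have "m \<le> k \<longleftrightarrow> i \<le> k" using m i by (metis (mono_tags, lifting) le_eq_less_or_eq le_trans less_imp_le_nat mem_Collect_eq not_less0 le_zero_eq)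
      then show ?thesis using Some unfolding remove_from_def by simp
    qed (simp add: remove_from_def)
  qed
  then show ?thesis unfolding insert_domino_def insertion_stage_def prod.case if_not_P[OF False] Let_def e1[symmetric] m_def by simp
qed

lemma add_first_cell:
  assumes T: "ideal (dom T \<union> border)" "dom T \<inter> border = {}" "finite (dom T)" and e: "e = 1 \<or> e = - 1"
  obtains Z where "add_first i e T = put Z i T" "domino Z" "Z \<inter> (dom T \<union> border) = {}"
    "cell e (dom T \<union> border) (dom T \<union> border) (dom T \<union> border) (dom T \<union> border \<union> Z)"
proof (cases "e = 1")
  case True
  define m where "m = row_length T 1 + 1"
  have m: "(1, m - 1) \<in> dom T \<union> border" "(1, m) \<notin> dom T \<union> border"
    using row_length_end[OF T, of 1] unfolding m_def by auto
  have m2: "(1, m + 1) \<notin> dom T \<union> border" using idealD[OF T(1), of 1 "m+1" 1 m] m by auto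
  show thesis
  proof (rule that[of "{(1, m), (1, m + 1)}"])
    show "add_first i e T = put {(1, m), (1, m + 1)} i T"
      using True unfolding add_first_def add_to_row_def m_def by (simp add: add.assoc)
    show "cell e (dom T \<union> border) (dom T \<union> border) (dom T \<union> border) (dom T \<union> border \<union> {(1, m), (1, m + 1)})"
      using cell.row_entry[OF m(2,1)] True by simp
  qed (use m m2 in \<open>auto simp: domino_def\<close>)
next
  case False
  then have e1: "e = - 1" using e by simp
  define m where "m = col_length T 1 + 1"
  have m: "(m - 1, 1) \<in> dom T \<union> border" "(m, 1) \<notin> dom T \<union> border"
    using col_length_end[OF T, of 1] unfolding m_def by auto
  have m2: "(m + 1, 1) \<notin> dom T \<union> border" using idealD[OF T(1), of "m+1" 1 m 1] m by auto
  show thesis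
  proof (rule that[of "{(m, 1), (m + 1, 1)}"])
    show "add_first i e T = put {(m, 1), (m + 1, 1)} i T"
      using False unfolding add_first_def add_to_col_def m_def by (simp add: add.assoc)
    show "cell e (dom T \<union> border) (dom T \<union> border) (dom T \<union> border) (dom T \<union> border \<union> {(m, 1), (m + 1, 1)})"
      using cell.col_entry[OF m(2,1)] e1 by simp
  qed (use m m2 in \<open>auto simp: domino_def\<close>)
qed

text \<open>The stage after label \<open>k\<close> already has the final squares of all labels up to
  \<open>k\<close>, since later bumps only add larger labels. Each bump is therefore one cell of the
  growth diagram. The last conclusion says that each insertion really enlarges the shape, which
  later provides every label of the recording tableau.\<close>

lemma insertion:
  fixes T0 :: tableau and i j :: nat and e :: int
  assumes w: "wf_tab r T0" and i: "0 < i" "i \<notin> labels T0" and e: "e = 1 \<or> e = - 1"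
  defines "T \<equiv> insert_domino (i, j, e) T0"
  shows "wf_tab r T" "labels T = insert i (labels T0)"
    "\<And>k. cell (if Suc k = i then e else 0) (sub T0 k) (sub T k) (sub T0 (Suc k)) (sub T (Suc k))"
    "\<And>k. i \<le> k \<Longrightarrow> sub T k \<noteq> sub T0 k"
proof -
  define W where "W = insertion_stage i e T0"
  have b0: "dom T0 \<inter> border = {}" "finite (dom T0)" "sub T0 0 = core r \<union> border"
    and st: "\<And>k. step r (sub T0 k) (sub T0 (Suc k))" using w unfolding wf_tab_def by auto
  have fin: "finite (labels T0)" using finite_labels b0 by blast
  have bs: "border \<subseteq> sub T0 k" for k by (auto simp: mem_sub)
  have ids: "ideal (sub T0 k)" for k using st[of k] unfolding step_def by auto
  obtain i0 where i0: "i = Suc i0" using i(1) by (cases i) auto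
  define R where "R = remove_from i T0"
  have Rs: "R s = Some l \<longleftrightarrow> T0 s = Some l \<and> l < i" for s l
    unfolding R_def remove_from_def by (auto split: option.splits)
  have Rdom: "dom R \<union> border = sub T0 i0" unfolding i0
  proof -
    have "s \<in> dom R \<longleftrightarrow> (\<exists>l. R s = Some l)" for s by auto
    then show "dom R \<union> border = sub T0 i0" using Rs i0 by (auto simp: mem_sub less_Suc_eq_le)
  qed
  have Rb: "dom R \<inter> border = {}" "finite (dom R)"
  proof -
    have "dom R \<subseteq> dom T0" using Rs by auto
    then show "dom R \<inter> border = {}" "finite (dom R)" using b0 finite_subset by blast+
  qed
  have Ri: "ideal (dom R \<union> border)" using ids Rdom by simp
  obtain Z0 where Z0: "add_first i e R = put Z0 i R" "domino Z0" "Z0 \<inter> (dom R \<union> border) = {}"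
    "cell e (dom R \<union> border) (dom R \<union> border) (dom R \<union> border) (dom R \<union> border \<union> Z0)"
    by (rule add_first_cell[OF Ri Rb e])
  have Wi: "W i = put Z0 i R"
  proof -
    have e0: "{l \<in> labels T0. i < l \<and> l \<le> i} = {}" by auto
    show ?thesis unfolding W_def insertion_stage_def e0 using Z0(1) R_def by simp
  qed
  have si: "sub T0 i = sub T0 i0" using sub_Suc_not_label i(2) i0 by simp
  \<comment> \<open>The heart of the invariant is that the current shape exceeds
    \<open>sub T0 k\<close> by exactly one domino \<open>X\<close>, the hypothesis of
    \<open>bump_cell\<close>.\<close>
  define Inv where "Inv k \<longleftrightarrow> dom (W k) \<inter> border = {} \<and> finite (dom (W k)) \<and> ideal (dom (W k) \<union> border) \<and>
     (\<exists>X. domino X \<and> X \<inter> sub T0 k = {} \<and> dom (W k) \<union> border = sub T0 k \<union> X) \<and>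
     (\<forall>s l. W k s = Some l \<longrightarrow> l \<le> k) \<and> labels (W k) = insert i {l \<in> labels T0. l \<le> k}" for k
  have Z0n: "Z0 \<noteq> {}" "finite Z0" using Z0(2) domino_card by force+
  have inv_i: "Inv i" unfolding Inv_def
  proof (intro conjI)
    show "dom (W i) \<inter> border = {}" "finite (dom (W i))" using Wi Z0(3) Rb Z0n by (auto simp: dom_put)
    have "step r (dom R \<union> border) (dom R \<union> border \<union> Z0)"
      by (rule cell_step(1)[OF _ _ _ Z0(4)]) (use Ri in \<open>auto simp: step_def\<close>)
    moreover have d: "dom (W i) \<union> border = dom R \<union> border \<union> Z0" using Wi by (auto simp: dom_put)
    ultimately show "ideal (dom (W i) \<union> border)" unfolding step_def by simp
    show "\<exists>X. domino X \<and> X \<inter> sub T0 i = {} \<and> dom (W i) \<union> border = sub T0 i \<union> X"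
      using d Z0 Rdom si by auto
    show "\<forall>s l. W i s = Some l \<longrightarrow> l \<le> i" using Rs Wi by (auto simp: put_def)
    have "labels R = {l \<in> labels T0. l \<le> i}" using Rs i(2) unfolding labels_def ran_def by (auto simp: le_less)
    then show "labels (W i) = insert i {l \<in> labels T0. l \<le> i}"
      using labels_put[of Z0 R i] Z0(3) Z0n i(1) Wi by auto
  qed
  have stepW: "Inv (Suc k) \<and> cell 0 (sub T0 k) (dom (W k) \<union> border) (sub T0 (Suc k)) (dom (W (Suc k)) \<union> border) \<and>
      (\<forall>k'\<le>k. sub (W (Suc k)) k' = sub (W k) k')" if k: "i \<le> k" and I: "Inv k" for k
  proof (cases "Suc k \<in> labels T0")
    case False
    then have e: "W (Suc k) = W k" "sub T0 (Suc k) = sub T0 k" "{l \<in> labels T0. l \<le> Suc k} = {l \<in> labels T0. l \<le> k}"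
      unfolding W_def using insertion_stage_Suc[OF fin k] sub_Suc_not_label by (auto simp: le_Suc_eq)
    have "Inv (Suc k)" using I unfolding Inv_def e by (meson le_SucI)
    then show ?thesis unfolding e using cell.same_right by simp
  next
    case True
    obtain X where X: "domino X" "X \<inter> sub T0 k = {}" "dom (W k) \<union> border = sub T0 k \<union> X" using I unfolding Inv_def by blast
    have Ik: "dom (W k) \<inter> border = {}" "finite (dom (W k))" "ideal (dom (W k) \<union> border)"
      "\<And>s l. W k s = Some l \<Longrightarrow> l \<le> k" "labels (W k) = insert i {l \<in> labels T0. l \<le> k}" using I unfolding Inv_def by auto
    note ss = supp_sub[OF b0(1), of k]
    have iS: "ideal (sub T0 k \<union> supp T0 (Suc k))" using ids[of "Suc k"] ss(1) by simp
    obtain Z where Z: "bump T0 (Suc k) (W k) = put Z (Suc k) (W k)" "domino Z" "Z \<inter> (dom (W k) \<union> border) = {}"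
      "cell 0 (sub T0 k) (dom (W k) \<union> border) (sub T0 k \<union> supp T0 (Suc k)) (dom (W k) \<union> border \<union> Z)"
      by (rule bump_cell[OF Ik(3,1,2) X bs wf_tab_supp[OF w True] ss(2) iS ids])
    have W1: "W (Suc k) = put Z (Suc k) (W k)"
      unfolding W_def using insertion_stage_Suc[OF fin k] True Z(1)[unfolded W_def] by simp
    have d: "dom (W (Suc k)) \<union> border = dom (W k) \<union> border \<union> Z" unfolding W1 dom_put by auto
    have c: "cell 0 (sub T0 k) (dom (W k) \<union> border) (sub T0 (Suc k)) (dom (W (Suc k)) \<union> border)"
      using Z(4) ss(1) d by simp
    have "step r (sub T0 k) (dom (W k) \<union> border)"
      unfolding X(3) by (rule domino_step[OF X(1,2) ids]) (use Ik(3) X(3) in simp)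
    from cell_step(2)[OF bs this st c] have sD: "step r (sub T0 (Suc k)) (dom (W (Suc k)) \<union> border)" .
    \<comment> \<open>Otherwise the four squares of \<open>X\<close> and \<open>Z\<close> would all
      lie in the two-square domino \<open>Suc k\<close> of \<open>T0\<close>.\<close>
    have "sub T0 (Suc k) \<noteq> dom (W (Suc k)) \<union> border"
    proof
      assume h: "sub T0 (Suc k) = dom (W (Suc k)) \<union> border"
      have "X \<union> Z \<subseteq> sub T0 (Suc k)" unfolding h d X(3) by blast
      moreover have "(X \<union> Z) \<inter> sub T0 k = {}" using X(2) Z(3) unfolding X(3) by blast
      ultimately have sb: "X \<union> Z \<subseteq> supp T0 (Suc k)" unfolding ss(1) by blast
      have "X \<inter> Z = {}" using Z(3) unfolding X(3) by blast
      then have "card (X \<union> Z) = 4" using card_Un_disjoint[of X Z] domino_card X(1) Z(2) by simp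
      moreover have "card (X \<union> Z) \<le> card (supp T0 (Suc k))"
        by (rule card_mono[OF _ sb]) (rule domino_card(2)[OF wf_tab_supp[OF w True]])
      ultimately show False using domino_card(1)[OF wf_tab_supp[OF w True]] by simp
    qed
    then obtain Y where Y: "domino Y" "Y \<inter> sub T0 (Suc k) = {}" "dom (W (Suc k)) \<union> border = sub T0 (Suc k) \<union> Y"
      by (rule step_domino[OF sD])
    have Zn: "Z \<noteq> {}" "finite Z" using Z(2) domino_card by force+
    have "Inv (Suc k)" unfolding Inv_def
    proof (intro conjI)
      show "dom (W (Suc k)) \<inter> border = {}" "finite (dom (W (Suc k)))"
        using W1 Z(3) Ik Zn by (auto simp: dom_put)
      show "ideal (dom (W (Suc k)) \<union> border)" using sD unfolding step_def by simp
      show "\<exists>X. domino X \<and> X \<inter> sub T0 (Suc k) = {} \<and> dom (W (Suc k)) \<union> border = sub T0 (Suc k) \<union> X" using Y by blast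
      show "\<forall>s l. W (Suc k) s = Some l \<longrightarrow> l \<le> Suc k" using W1 Ik(4) by (auto simp: put_def le_SucI)
      have "Z \<inter> dom (W k) = {}" using Z(3) by auto
      then show "labels (W (Suc k)) = insert i {l \<in> labels T0. l \<le> Suc k}"
        unfolding W1 using labels_put[of Z "W k" "Suc k"] Zn Ik(5) True by (auto simp: le_Suc_eq)
    qed
    moreover have "sub (W (Suc k)) k' = sub (W k) k'" if "k' \<le> k" for k'
      unfolding W1 using sub_put[OF Z(3)] that by simp
    ultimately show ?thesis using c by blast
  qed
  have inv: "Inv k" if "i \<le> k" for k using that
    by (induction k rule: dec_induct) (use inv_i stepW in auto)
  have subW: "sub (W k) k' = sub (W m) k'" if "i \<le> m" "k' \<le> m" "m \<le> k" for k k' m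
    using that(3)
  proof (induction k rule: dec_induct)
    case (step k) then show ?case using stepW[of k] inv[of k] that by auto
  qed simp
  have topW: "sub (W k) k = dom (W k) \<union> border" if "i \<le> k" for k
    by (rule sub_top) (use inv[OF that] in \<open>auto simp: Inv_def\<close>)
  define K where "K = Max (insert i (labels T0))"
  have K: "i \<le> K" "\<And>l. l \<in> labels T0 \<Longrightarrow> l \<le> K" using fin unfolding K_def by auto
  have TW: "T = W k" if "K \<le> k" for k
    unfolding T_def W_def by (rule insert_domino_stage[OF fin i]) (use K that le_trans in blast)
  have subT: "sub T k = dom (W k) \<union> border" if "i \<le> k" for k
  proof -
    have "T = W (max k K)" using TW by simp
    then show ?thesis using subW[of k k "max k K"] topW[OF that] that by simp
  qed
  have subT0: "sub T k = sub T0 k" if "k < i" for k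
  proof -
    have "sub T k = sub (W i) k" using TW[of K] subW[of i k K] K that by simp
    also have "\<dots> = sub R k" unfolding Wi using sub_put[OF Z0(3)] that by simp
    also have "\<dots> = sub T0 k" using Rs that by (auto simp: mem_sub)
    finally show ?thesis .
  qed
  show lab: "labels T = insert i (labels T0)"
    using inv[OF K(1)] K(2) TW[of K] unfolding Inv_def by auto
  show cells: "cell (if Suc k = i then e else 0) (sub T0 k) (sub T k) (sub T0 (Suc k)) (sub T (Suc k))" for k
  proof -
    consider "Suc k < i" | "Suc k = i" | "i \<le> k" by linarith
    then show ?thesis
    proof cases
      case 1 then show ?thesis using subT0[of k] subT0[of "Suc k"] cell.same_left by simp
    next
      case 2
      then have "k = i0" using i0 by simp
      moreover have "sub T i = dom R \<union> border \<union> Z0" using subT[of i] Wi by (auto simp: dom_put)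
      ultimately show ?thesis using Z0(4) Rdom subT0[of k] 2 si by simp
    next
      case 3 then show ?thesis using stepW[OF 3 inv[OF 3]] subT[of k] subT[of "Suc k"] by simp
    qed
  qed
  show "sub T k \<noteq> sub T0 k" if ik: "i \<le> k" for k
  proof -
    obtain X where X: "domino X" "X \<inter> sub T0 k = {}" "dom (W k) \<union> border = sub T0 k \<union> X"
      using inv[OF ik] unfolding Inv_def by blast
    moreover have "X \<noteq> {}" using domino_card[OF X(1)] by auto
    ultimately show ?thesis using subT[OF ik] by auto
  qed
  have st2: "step r (sub T0 k) (sub T k)" for k
  proof (induction k)
    case 0 then show ?case using subT0[of 0] i ids by (simp add: step_def)
  next
    case (Suc k)
    show ?case by (rule cell_step(2)[OF bs Suc st cells])
  qed
  show "wf_tab r T" unfolding wf_tab_def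
  proof (intro conjI allI)
    show "dom T \<inter> border = {}" "finite (dom T)" using inv[OF K(1)] TW[of K] unfolding Inv_def by auto
    show "sub T 0 = core r \<union> border" using subT0[of 0] i b0 by simp
    show "step r (sub T k) (sub T (Suc k))" for k by (rule cell_step(1)[OF bs st2 st cells])
  qed
qed

lemma step_mono: "step r A B \<Longrightarrow> A \<subseteq> B"
  unfolding step_def fstep_def by blast

lemma ideal_core: "ideal (core r \<union> border)"
  unfolding ideal_def core_def border_def by auto

text \<open>The two cores differ by \<open>delta r\<close>, where \<open>i + j = r + 2\<close> has
  the parity of \<open>r\<close>, so every such square is variable.\<close>

lemma twin_core: "twin r (core r \<union> border) (core (r + 1) \<union> border)"
proof -
  have "s \<in> core r \<union> border \<longleftrightarrow> s \<in> core (r + 1) \<union> border" if f: "fixed r s" for s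
  proof -
    obtain i j where s: "s = (i, j)" by (cases s)
    have "i + j \<noteq> int r + 2" using f unfolding s fixed_iff by presburger
    then show ?thesis unfolding s core_def border_def by auto
  qed
  then show ?thesis unfolding twin_def using ideal_core by blast
qed

lemma sub_core_tableau: "sub (core_tableau r) k = core r \<union> border"
  by (auto simp: mem_sub core_tableau_def split: if_splits)

lemma wf_core_tableau: "wf_tab r (core_tableau r)"
proof -
  have d: "dom (core_tableau r) = core r" unfolding core_tableau_def by (auto split: if_splits)
  have "core r \<subseteq> {1..int r + 2} \<times> {1..int r + 2}" unfolding core_def by auto
  then have "finite (core r)" by (rule finite_subset) simp
  moreover have "core r \<inter> border = {}" unfolding core_def border_def by auto
  ultimately show ?thesis unfolding wf_tab_def sub_core_tableau step_def using ideal_core d by auto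
qed

section \<open>The growth diagram of a signed permutation\<close>

locale signed_perm =
  fixes n :: nat and \<sigma> :: "(nat \<times> nat \<times> int) set"
  assumes \<sigma>: "\<sigma> \<in> hyperoctahedral n"
begin

definition val :: "nat \<Rightarrow> nat" where "val k = fst (entry \<sigma> k)"
definition sgn :: "nat \<Rightarrow> int" where "sgn k = snd (snd (entry \<sigma> k))"

lemma entry_mem:
  assumes "k \<in> {1..n}"
  shows "entry \<sigma> k \<in> \<sigma> \<and> fst (snd (entry \<sigma> k)) = k"
proof -
  have b: "bij_betw (\<lambda>x. fst (snd x)) \<sigma> {1..n}"
    using \<sigma> unfolding hyperoctahedral_def case_prod_beta by blast
  have "k \<in> (\<lambda>x. fst (snd x)) ` \<sigma>" using b assms unfolding bij_betw_def by auto
  then obtain x where x: "x \<in> \<sigma>" "fst (snd x) = k" by auto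
  have "y = x" if "y \<in> \<sigma> \<and> fst (snd y) = k" for y
    using b that x unfolding bij_betw_def inj_on_def by auto
  then show ?thesis unfolding entry_def using theI[of "\<lambda>x. x \<in> \<sigma> \<and> fst (snd x) = k" x] x by blast
qed

lemma entry_eq: "k \<in> {1..n} \<Longrightarrow> entry \<sigma> k = (val k, k, sgn k)"
  using entry_mem[of k] unfolding val_def sgn_def by (metis prod.collapse)

lemma val_range: "k \<in> {1..n} \<Longrightarrow> val k \<in> {1..n}" and sgn_range: "k \<in> {1..n} \<Longrightarrow> sgn k = 1 \<or> sgn k = - 1"
proof -
  assume k: "k \<in> {1..n}"
  have "entry \<sigma> k \<in> {1..n} \<times> {1..n} \<times> {1, - 1}"
    using entry_mem[OF k] \<sigma> unfolding hyperoctahedral_def by blast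
  then show "val k \<in> {1..n}" "sgn k = 1 \<or> sgn k = - 1" unfolding entry_eq[OF k] by auto
qed

lemma val_inj: "inj_on val {1..n}"
proof (rule inj_onI)
  fix k l assume h: "k \<in> {1..n}" "l \<in> {1..n}" "val k = val l"
  have b: "inj_on fst \<sigma>" using \<sigma> unfolding hyperoctahedral_def bij_betw_def case_prod_beta by blast
  have "entry \<sigma> k = entry \<sigma> l"
    using inj_onD[OF b, of "entry \<sigma> k" "entry \<sigma> l"] entry_mem h unfolding val_def by auto
  then show "k = l" using entry_mem[OF h(1)] entry_mem[OF h(2)] by metis
qed

lemma val_image: "val ` {1..n} = {1..n}"
  by (rule endo_inj_surj[OF _ _ val_inj]) (use val_range in auto)

lemma left_wf:
  assumes "k \<le> n"
  shows "wf_tab r (left_tableau r \<sigma> k) \<and> labels (left_tableau r \<sigma> k) = val ` {1..k}"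
  using assms
proof (induction k)
  case 0
  have "labels (core_tableau r) = {}" unfolding labels_def ran_def core_tableau_def by auto
  then show ?case using wf_core_tableau by simp
next
  case (Suc k)
  let ?T = "left_tableau r \<sigma> k"
  have k: "Suc k \<in> {1..n}" using Suc by simp
  have IH: "wf_tab r ?T" "labels ?T = val ` {1..k}" using Suc by auto
  have "val (Suc k) \<notin> val ` {1..k}"
  proof
    assume "val (Suc k) \<in> val ` {1..k}"
    then obtain y where y: "y \<in> {1..k}" "val (Suc k) = val y" by blast
    then have "Suc k = y" using inj_onD[OF val_inj y(2)] Suc.prems by auto
    then show False using y(1) by simp
  qed
  then have nl: "val (Suc k) \<notin> labels ?T" using IH by simp
  have pos: "0 < val (Suc k)" using val_range[OF k] by simp
  note ins = insertion[OF IH(1) pos nl sgn_range[OF k], where j = "Suc k"]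
  have "val ` {1..Suc k} = insert (val (Suc k)) (val ` {1..k})" by (simp add: atLeastAtMostSuc_conv)
  then show ?case using ins(1,2) IH entry_eq[OF k] by simp
qed

text \<open>The boundary \<open>j = n\<close> is the chain of shapes of the left tableau, the
  boundary \<open>i = n\<close> that of the right one.\<close>

definition L :: "nat \<Rightarrow> nat \<Rightarrow> nat \<Rightarrow> square set" where
  "L r i j = sub (left_tableau r \<sigma> j) i"

definition e :: "nat \<Rightarrow> nat \<Rightarrow> int" where
  "e i j = (if Suc i = val (Suc j) then sgn (Suc j) else 0)"

lemma insert_L:
  assumes "j < n"
  shows "cell (e i j) (L r i j) (L r i (Suc j)) (L r (Suc i) j) (L r (Suc i) (Suc j))"
    "val (Suc j) \<le> i \<Longrightarrow> L r i (Suc j) \<noteq> L r i j"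
proof -
  let ?T = "left_tableau r \<sigma> j"
  have k: "Suc j \<in> {1..n}" using assms by simp
  have IH: "wf_tab r ?T" "labels ?T = val ` {1..j}" using left_wf[of j] assms by auto
  have "val (Suc j) \<notin> val ` {1..j}"
  proof
    assume "val (Suc j) \<in> val ` {1..j}"
    then obtain y where y: "y \<in> {1..j}" "val (Suc j) = val y" by blast
    then have "Suc j = y" using inj_onD[OF val_inj y(2)] assms by auto
    then show False using y(1) by simp
  qed
  then have nl: "val (Suc j) \<notin> labels ?T" using IH by simp
  have pos: "0 < val (Suc j)" using val_range[OF k] by simp
  note ins = insertion[OF IH(1) pos nl sgn_range[OF k], where j = "Suc j"]
  show "cell (e i j) (L r i j) (L r i (Suc j)) (L r (Suc i) j) (L r (Suc i) (Suc j))"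
    using ins(3)[of i] entry_eq[OF k] unfolding L_def e_def by simp
  show "val (Suc j) \<le> i \<Longrightarrow> L r i (Suc j) \<noteq> L r i j"
    using ins(4)[of i] entry_eq[OF k] unfolding L_def by simp
qed

lemma growth_L: "growth n (L r) e (core r \<union> border)"
proof
  show "ideal (core r \<union> border)" by (rule ideal_core)
  show "border \<subseteq> core r \<union> border" by simp
  show "L r i 0 = core r \<union> border" for i unfolding L_def by (simp add: sub_core_tableau)
  show "L r 0 j = core r \<union> border" if "j \<le> n" for j
    using left_wf[OF that] unfolding L_def wf_tab_def by blast
  show "cell (e i j) (L r i j) (L r i (Suc j)) (L r (Suc i) j) (L r (Suc i) (Suc j))" if "i < n" "j < n" for i j
    by (rule insert_L(1)[OF that(2)])
qed

lemma L_top: "j \<le> n \<Longrightarrow> L r n j = dom (left_tableau r \<sigma> j) \<union> border"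
  unfolding L_def
proof (rule sub_top)
  fix s l assume j: "j \<le> n" and s: "left_tableau r \<sigma> j s = Some l"
  show "l \<le> n"
  proof (cases "l = 0")
    case False
    then have "l \<in> labels (left_tableau r \<sigma> j)" using s unfolding labels_def by (auto intro: ranI)
    then have "l \<in> val ` {1..j}" using left_wf[OF j] by simp
    then show ?thesis using val_range j by fastforce
  qed simp
qed

text \<open>The recording tableau labels the squares gained at each insertion, so its shapes are the
  successive full shapes, the points of the grid with \<open>i = n\<close>.\<close>

lemma right_sub:
  assumes "m \<le> n"
  shows "dom (right_tableau r \<sigma> m) = dom (left_tableau r \<sigma> m) \<and> (\<forall>k\<le>m. sub (right_tableau r \<sigma> m) k = L r n k) \<and>
    (\<forall>s l. right_tableau r \<sigma> m s = Some l \<longrightarrow> l \<le> m)"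
  using assms
proof (induction m)
  case 0
  have "L r n 0 = core r \<union> border" unfolding L_def by (simp add: sub_core_tableau)
  then show ?case by (auto simp: sub_core_tableau) (auto simp: core_tableau_def split: if_splits)
next
  case (Suc m)
  interpret g: growth n "L r" e "core r \<union> border" by (rule growth_L)
  let ?T = "left_tableau r \<sigma> m" and ?T' = "left_tableau r \<sigma> (Suc m)" and ?S = "right_tableau r \<sigma> m"
  let ?Z = "dom ?T' - dom ?T"
  have IH: "dom ?S = dom ?T" "\<And>k. k \<le> m \<Longrightarrow> sub ?S k = L r n k" "\<And>s l. ?S s = Some l \<Longrightarrow> l \<le> m" using Suc by auto
  have S': "right_tableau r \<sigma> (Suc m) = put ?Z (Suc m) ?S" by simp
  have b: "dom ?T' \<inter> border = {}" "dom ?T \<inter> border = {}" using left_wf[of "Suc m" r] left_wf[of m r] Suc.prems unfolding wf_tab_def by auto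
  have "L r n m \<subseteq> L r n (Suc m)" by (rule step_mono[OF g.steps(1)[of n m r]]) (use Suc.prems in auto)
  then have "dom ?T \<union> border \<subseteq> dom ?T' \<union> border" using L_top[of m r] L_top[of "Suc m" r] Suc.prems by simp
  then have sub: "dom ?T \<subseteq> dom ?T'" using b(2) by blast
  have Zf: "?Z \<inter> (dom ?S \<union> border) = {}" using IH(1) b by auto
  have d: "dom (right_tableau r \<sigma> (Suc m)) = dom ?T'" unfolding S' dom_put IH(1) using sub by auto
  have "sub (right_tableau r \<sigma> (Suc m)) k = L r n k" if k: "k \<le> Suc m" for k
  proof (cases "k = Suc m")
    case False
    then show ?thesis unfolding S' sub_put[OF Zf] using IH(2)[of k] k by simp
  next
    case True
    have "sub ?S (Suc m) = dom ?S \<union> border" by (rule sub_top) (use IH(3) le_SucI in blast)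
    then show ?thesis unfolding S' sub_put[OF Zf] using True L_top[of "Suc m"] Suc.prems IH(1) sub by auto
  qed
  moreover have "l \<le> Suc m" if "right_tableau r \<sigma> (Suc m) s = Some l" for s l
    using that IH(3)[of s l] unfolding S' put_def by (auto split: if_splits)
  ultimately show ?case using d by blast
qed

lemma tableaux_G:
  fixes r :: nat
  defines "T \<equiv> left_tableau r \<sigma> n" and "S \<equiv> right_tableau r \<sigma> n"
  shows "wf_tab r T" "wf_tab r S" "labels T = {1..n}" "labels S = {1..n}" "dom T = dom S"
    "\<And>k. k \<le> n \<Longrightarrow> sub T k = L r k n" "\<And>k. k \<le> n \<Longrightarrow> sub S k = L r n k"
proof -
  interpret g: growth n "L r" e "core r \<union> border" by (rule growth_L)
  show T: "wf_tab r T" "labels T = {1..n}" using left_wf[of n r] val_image unfolding T_def by auto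
  show d: "dom T = dom S" unfolding T_def S_def using right_sub[of n r] by auto
  show "sub T k = L r k n" if "k \<le> n" for k unfolding T_def L_def by simp
  show sS: "sub S k = L r n k" if "k \<le> n" for k unfolding S_def using right_sub[of n r] that by simp
  have le: "l \<le> n" if "S s = Some l" for s l using right_sub[of n r] that unfolding S_def by blast
  have big: "sub S k = sub S n" if "n \<le> k" for k
    using sub_top[of S n] sub_top[of S k] le that le_trans by metis
  have Sb: "dom S \<inter> border = {}" "finite (dom S)" using T(1) d unfolding wf_tab_def by auto
  have st: "step r (sub S k) (sub S (Suc k))" for k
  proof (cases "k < n")
    case True then show ?thesis using sS[of k] sS[of "Suc k"] g.steps(1)[of n k] by simp
  next
    case False
    moreover have "ideal (sub S n)"
    proof -
      have "sub S n = sub T n" using sS[of n] unfolding T_def L_def by simp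
      then show ?thesis using T(1) unfolding wf_tab_def step_def by auto
    qed
    ultimately show ?thesis using big[of k] big[of "Suc k"] unfolding step_def by simp
  qed
  show "wf_tab r S" unfolding wf_tab_def using Sb st sS[of 0] g.left[of n] by auto
  show "labels S = {1..n}"
  proof
    show "labels S \<subseteq> {1..n}" using le unfolding labels_def ran_def by fastforce
    show "{1..n} \<subseteq> labels S"
    proof
      fix k assume "k \<in> {1..n}"
      then obtain m where m: "k = Suc m" "m < n" by (cases k) auto
      have "val (Suc m) \<le> n" using val_range[of "Suc m"] m by auto
      then have "sub S (Suc m) \<noteq> sub S m" using insert_L(2)[OF m(2), of n r] sS[of m] sS[of "Suc m"] m by simp
      then show "k \<in> labels S" using sub_Suc_not_label m by blast
    qed
  qed
qed

lemma minimal_G: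
  "minimal r (2 * n) (core (r + 1) \<union> border) (\<lambda>t. if t \<le> n then L r t n else L r n (2 * n - t))
    (\<lambda>t. if t \<le> n then L (r + 1) t n else L (r + 1) n (2 * n - t))"
proof -
  have a: "growth n (L r) e (core r \<union> border)" by (rule growth_L)
  have b: "growth n (L (r + 1)) e (core (r + 1) \<union> border)" by (rule growth_L)
  show ?thesis by (rule growth_minimal[OF a b twin_core])
qed

end

section \<open>Labellings and the two variable squares of a domino\<close>

text \<open>A variable square is adjacent to four fixed ones. It can belong only to the domino with the larger
  of the two labels above and to the left of it, or to the one with the smaller of the two labels
  below and to the right of it.\<close>

definition lower :: "(square \<Rightarrow> enat) \<Rightarrow> square \<Rightarrow> enat" where
  "lower lab = (\<lambda>(i, j). max (lab (i - 1, j)) (lab (i, j - 1)))"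

definition upper :: "(square \<Rightarrow> enat) \<Rightarrow> square \<Rightarrow> enat" where
  "upper lab = (\<lambda>(i, j). min (lab (i + 1, j)) (lab (i, j + 1)))"

text \<open>The two ends are the alternatives appearing in the definition of \<open>supp'\<close>,
  and they depend only on labels of fixed squares. A domino occupies one of its two ends and its
  moved version the other.\<close>

definition first_end :: "(square \<Rightarrow> enat) \<Rightarrow> nat \<Rightarrow> square \<Rightarrow> square" where
  "first_end lab k = (\<lambda>(i, j). if lab (i - 1, j + 1) < enat k then (i, j + 1) else (i - 1, j))"

definition second_end :: "(square \<Rightarrow> enat) \<Rightarrow> nat \<Rightarrow> square \<Rightarrow> square" where
  "second_end lab k = (\<lambda>(i, j). if lab (i + 1, j - 1) < enat k then (i + 1, j) else (i, j - 1))"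

text \<open>Abstracts from tableaux so that the labels of the rank \<open>r + 1\<close> tableaux can
  be studied with the fixed squares of rank \<open>r\<close>.\<close>

locale labelling =
  fixes r n :: nat and lab :: "square \<Rightarrow> enat"
  assumes range: "\<And>s. lab s \<noteq> \<infinity> \<Longrightarrow> lab s \<le> enat n"
    and steps: "\<And>k. k < n \<Longrightarrow> \<exists>i j v. fstep r {s. lab s \<le> enat k} i j v {s. lab s \<le> enat (Suc k)}"
    and ideals: "\<And>k. ideal {s. lab s \<le> enat k}"
begin

lemma mono: "i' \<le> i \<Longrightarrow> j' \<le> j \<Longrightarrow> lab (i', j') \<le> lab (i, j)"
proof (cases "lab (i, j)")
  case (enat k)
  assume "i' \<le> i" "j' \<le> j"
  then show ?thesis using idealD[OF ideals[of k], of i j i' j'] enat by simp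
qed simp

lemma value_cases:
  obtains "lab s = 0" | k where "k \<in> {1..n}" "lab s = enat k" | "lab s = \<infinity>"
proof (cases "lab s")
  case (enat k)
  then have "k \<le> n" using range[of s] by simp
  then show thesis using that enat by (cases "k = 0") (auto simp: zero_enat_def)
qed (use that in simp)

lemma domino_ex:
  assumes "k \<in> {1..n}"
  shows "\<exists>x v. fixed r x \<and> \<not> fixed r v \<and> {s. lab s = enat k} = {x, v} \<and>
    (v = first_end lab k x \<or> v = second_end lab k x)"
proof -
  obtain q where q: "k = Suc q" "q < n" using assms by (cases k) auto
  obtain i j v where f: "fstep r {s. lab s \<le> enat q} i j v {s. lab s \<le> enat (Suc q)}" using steps[OF q(2)] by blast
  note d = fstepD[OF f]
  have lt: "lab s < enat k \<longleftrightarrow> lab s \<le> enat q" for s using q(1) by (cases "lab s") auto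
  have eq: "lab s = enat k \<longleftrightarrow> lab s \<le> enat (Suc q) \<and> \<not> lab s \<le> enat q" for s using q(1) by (cases "lab s") auto
  have "s \<in> {s. lab s \<le> enat (Suc q)} \<longleftrightarrow> s = (i, j) \<or> s = v \<or> s \<in> {s. lab s \<le> enat q}" for s
    using d(7) by auto
  then have mem: "lab s \<le> enat (Suc q) \<longleftrightarrow> s = (i, j) \<or> s = v \<or> lab s \<le> enat q" for s by simp
  have n: "\<not> lab (i, j) \<le> enat q" "\<not> lab v \<le> enat q" using d(5,6) by auto
  have "{s. lab s = enat k} = {(i, j), v}" unfolding eq mem using n by auto
  moreover have "v = first_end lab k (i, j) \<or> v = second_end lab k (i, j)"
    unfolding first_end_def second_end_def lt prod.case
  proof (cases "lab (i - 1, j + 1) \<le> enat q"; cases "lab (i + 1, j - 1) \<le> enat q")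
    assume h: "lab (i - 1, j + 1) \<le> enat q" "lab (i + 1, j - 1) \<le> enat q"
    show "v = (if lab (i - 1, j + 1) \<le> enat q then (i, j + 1) else (i - 1, j)) \<or>
      v = (if lab (i + 1, j - 1) \<le> enat q then (i + 1, j) else (i, j - 1))"
      using fstep_types(1)[OF f] h by simp
  next
    assume h: "lab (i - 1, j + 1) \<le> enat q" "\<not> lab (i + 1, j - 1) \<le> enat q"
    show "v = (if lab (i - 1, j + 1) \<le> enat q then (i, j + 1) else (i - 1, j)) \<or>
      v = (if lab (i + 1, j - 1) \<le> enat q then (i + 1, j) else (i, j - 1))"
      using fstep_types(2)[OF f] h by (auto split: if_splits)
  next
    assume h: "\<not> lab (i - 1, j + 1) \<le> enat q" "lab (i + 1, j - 1) \<le> enat q"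
    show "v = (if lab (i - 1, j + 1) \<le> enat q then (i, j + 1) else (i - 1, j)) \<or>
      v = (if lab (i + 1, j - 1) \<le> enat q then (i + 1, j) else (i, j - 1))"
      using fstep_types(3)[OF f] h by (auto split: if_splits)
  next
    assume h: "\<not> lab (i - 1, j + 1) \<le> enat q" "\<not> lab (i + 1, j - 1) \<le> enat q"
    show "v = (if lab (i - 1, j + 1) \<le> enat q then (i, j + 1) else (i - 1, j)) \<or>
      v = (if lab (i + 1, j - 1) \<le> enat q then (i + 1, j) else (i, j - 1))"
      using fstep_types(4)[OF f] h by auto
  qed
  ultimately show ?thesis using d(3) fstep_var_not_fixed[OF f] by blast
qed

text \<open>\<open>fx k\<close> is the fixed square of the domino \<open>k\<close>; \<open>vr k\<close> and \<open>vr' k\<close> are the variable squares of \<open>D(k, T)\<close> and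
  of \<open>D'(k, T)\<close>.\<close>

definition fx :: "nat \<Rightarrow> square" where
  "fx k = (SOME x. \<exists>v. fixed r x \<and> \<not> fixed r v \<and> {s. lab s = enat k} = {x, v} \<and>
    (v = first_end lab k x \<or> v = second_end lab k x))"

definition vr :: "nat \<Rightarrow> square" where
  "vr k = (SOME v. fixed r (fx k) \<and> \<not> fixed r v \<and> {s. lab s = enat k} = {fx k, v} \<and>
    (v = first_end lab k (fx k) \<or> v = second_end lab k (fx k)))"

definition vr' :: "nat \<Rightarrow> square" where
  "vr' k = (if vr k = first_end lab k (fx k) then second_end lab k (fx k) else first_end lab k (fx k))"

lemma domino_props:
  assumes "k \<in> {1..n}"
  shows "fixed r (fx k)" "\<not> fixed r (vr k)" "{s. lab s = enat k} = {fx k, vr k}"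
    "vr k = first_end lab k (fx k) \<or> vr k = second_end lab k (fx k)"
proof -
  have "fixed r (fx k) \<and> \<not> fixed r (vr k) \<and> {s. lab s = enat k} = {fx k, vr k} \<and>
    (vr k = first_end lab k (fx k) \<or> vr k = second_end lab k (fx k))"
    unfolding vr_def using someI_ex[OF domino_ex[OF assms], folded fx_def] by (rule someI_ex)
  then show "fixed r (fx k)" "\<not> fixed r (vr k)" "{s. lab s = enat k} = {fx k, vr k}"
    "vr k = first_end lab k (fx k) \<or> vr k = second_end lab k (fx k)" by blast+
qed

lemma label_iff:
  assumes "k \<in> {1..n}"
  shows "lab s = enat k \<longleftrightarrow> s = fx k \<or> s = vr k"
  using domino_props(3)[OF assms] by blast

lemma label_fixed: "k \<in> {1..n} \<Longrightarrow> fixed r s \<Longrightarrow> lab s = enat k \<longleftrightarrow> s = fx k"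
  using label_iff[of k s] domino_props[of k] by auto

lemma label_var: "k \<in> {1..n} \<Longrightarrow> \<not> fixed r s \<Longrightarrow> lab s = enat k \<longleftrightarrow> s = vr k"
  using label_iff[of k s] domino_props[of k] by auto

lemma label_fx [simp]: "k \<in> {1..n} \<Longrightarrow> lab (fx k) = enat k"
  and label_vr [simp]: "k \<in> {1..n} \<Longrightarrow> lab (vr k) = enat k"
  using label_iff by auto

lemma ends_distinct: "first_end lab k x \<noteq> second_end lab k x"
  unfolding first_end_def second_end_def by (auto split: prod.splits)

lemma vr'_neq: "k \<in> {1..n} \<Longrightarrow> vr' k \<noteq> vr k"
  using ends_distinct[of k "fx k"] domino_props(4)[of k] unfolding vr'_def by auto

lemma ends_var: "fixed r x \<Longrightarrow> \<not> fixed r (first_end lab k x) \<and> \<not> fixed r (second_end lab k x)"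
  unfolding first_end_def second_end_def by (auto split: prod.splits)

lemma vr'_var: "k \<in> {1..n} \<Longrightarrow> \<not> fixed r (vr' k)"
  using ends_var[of "fx k" k] domino_props(1)[of k] unfolding vr'_def by auto

lemma pair_ends: "k \<in> {1..n} \<Longrightarrow> s = vr k \<or> s = vr' k \<longleftrightarrow> s = first_end lab k (fx k) \<or> s = second_end lab k (fx k)"
  using domino_props(4)[of k] unfolding vr'_def by auto

text \<open>The square inspected by \<open>first_end\<close> or \<open>second_end\<close> is
  precisely the other neighbour competing for \<open>s\<close> on the same side. The right-hand side
  involves fixed squares only, so it is the same for both ranks.\<close>

lemma pair_iff:
  assumes k: "k \<in> {1..n}" and s: "\<not> fixed r s"
  shows "s = vr k \<or> s = vr' k \<longleftrightarrow> lower lab s = enat k \<or> upper lab s = enat k"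
proof -
  obtain i j where x: "fx k = (i, j)" by (cases "fx k")
  obtain a b where ab: "s = (a, b)" by (cases s)
  have fx: "fixed r (i, j)" and lx: "lab (i, j) = enat k" using domino_props(1)[OF k] label_fx[OF k] x by auto
  have fs: "fixed r (a - 1, b)" "fixed r (a, b - 1)" "fixed r (a + 1, b)" "fixed r (a, b + 1)" using s ab by auto
  have u: "lab t = enat k \<longleftrightarrow> t = (i, j)" if "fixed r t" for t using label_fixed[OF k that] x by simp
  have ne: "lab (i - 1, j + 1) \<noteq> enat k" "lab (i + 1, j - 1) \<noteq> enat k"
    using u[of "(i - 1, j + 1)"] u[of "(i + 1, j - 1)"] fx by auto
  show ?thesis unfolding pair_ends[OF k] x ab
  proof
    assume "(a, b) = first_end lab k (i, j) \<or> (a, b) = second_end lab k (i, j)"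
    then consider "(a, b) = (i, j + 1)" "lab (i - 1, j + 1) < enat k" | "(a, b) = (i - 1, j)" "\<not> lab (i - 1, j + 1) < enat k"
      | "(a, b) = (i + 1, j)" "lab (i + 1, j - 1) < enat k" | "(a, b) = (i, j - 1)" "\<not> lab (i + 1, j - 1) < enat k"
      unfolding first_end_def second_end_def by (auto split: if_splits)
    then show "lower lab (a, b) = enat k \<or> upper lab (a, b) = enat k"
    proof cases
      case 1 then have "lower lab (a, b) = enat k" unfolding lower_def using lx by (auto simp: max_def)
      then show ?thesis ..
    next
      case 2 then have "upper lab (a, b) = enat k" unfolding upper_def using lx by (auto simp: min_def)
      then show ?thesis ..
    next
      case 3 then have "lower lab (a, b) = enat k" unfolding lower_def using lx by (auto simp: max_def)
      then show ?thesis ..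
    next
      case 4 then have "upper lab (a, b) = enat k" unfolding upper_def using lx by (auto simp: min_def)
      then show ?thesis ..
    qed
  next
    assume "lower lab (a, b) = enat k \<or> upper lab (a, b) = enat k"
    then consider "lab (a - 1, b) = enat k" "lab (a, b - 1) \<le> enat k" | "lab (a, b - 1) = enat k" "lab (a - 1, b) \<le> enat k"
      | "lab (a + 1, b) = enat k" "enat k \<le> lab (a, b + 1)" | "lab (a, b + 1) = enat k" "enat k \<le> lab (a + 1, b)"
      unfolding lower_def upper_def by (auto simp: max_def min_def split: if_splits)
    then show "(a, b) = first_end lab k (i, j) \<or> (a, b) = second_end lab k (i, j)"
    proof cases
      case 1
      then have "a = i + 1" "b = j" using u[OF fs(1)] by auto
      then show ?thesis using 1 ne unfolding second_end_def by auto
    next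
      case 2
      then have "a = i" "b = j + 1" using u[OF fs(2)] by auto
      then show ?thesis using 2 ne unfolding first_end_def by auto
    next
      case 3
      then have "a = i - 1" "b = j" using u[OF fs(3)] by auto
      then show ?thesis using 3 ne unfolding first_end_def by auto
    next
      case 4
      then have "a = i" "b = j - 1" using u[OF fs(4)] by auto
      then show ?thesis using 4 ne unfolding second_end_def by auto
    qed
  qed
qed

lemma lower_le: "lower lab s \<le> lab s" and le_upper: "lab s \<le> upper lab s"
proof -
  obtain a b where ab: "s = (a, b)" by (cases s)
  show "lower lab s \<le> lab s" "lab s \<le> upper lab s" unfolding lower_def upper_def ab
    using mono[of "a - 1" a b b] mono[of a a "b - 1" b] mono[of a "a + 1" b b] mono[of a a b "b + 1"] by auto
qed

lemma label_lower_or_upper: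
  assumes s: "\<not> fixed r s"
  shows "lab s = lower lab s \<or> lab s = upper lab s"
proof (rule value_cases[of s])
  assume "lab s = 0" then show ?thesis using lower_le[of s] by simp
next
  assume "lab s = \<infinity>" then show ?thesis using le_upper[of s] by simp
next
  fix k assume k: "k \<in> {1..n}" "lab s = enat k"
  then have "s = vr k" using label_var s by blast
  then show ?thesis using pair_iff[OF k(1) s] k by auto
qed

text \<open>The label \<open>k\<close> sits on a single fixed square, which cannot be on both sides
  of \<open>s\<close>.\<close>

lemma lower_neq_upper:
  assumes k: "k \<in> {1..n}" and s: "\<not> fixed r s" and l: "lower lab s = enat k"
  shows "upper lab s \<noteq> enat k"
proof
  assume u: "upper lab s = enat k"
  obtain a b where ab: "s = (a, b)" by (cases s)
  have fs: "fixed r (a - 1, b)" "fixed r (a, b - 1)" "fixed r (a + 1, b)" "fixed r (a, b + 1)" using s ab by auto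
  have "fx k = (a - 1, b) \<or> fx k = (a, b - 1)"
    using l label_fixed[OF k fs(1)] label_fixed[OF k fs(2)] unfolding lower_def ab by (auto simp: max_def split: if_splits)
  moreover have "fx k = (a + 1, b) \<or> fx k = (a, b + 1)"
    using u label_fixed[OF k fs(3)] label_fixed[OF k fs(4)] unfolding upper_def ab by (auto simp: min_def split: if_splits)
  ultimately show False by auto
qed

lemma vr_inj: "inj_on vr {1..n}"
proof (rule inj_onI)
  fix k l assume "k \<in> {1..n}" "l \<in> {1..n}" "vr k = vr l"
  then show "k = l" by (metis enat.inject label_vr)
qed

text \<open>If \<open>k\<close> and \<open>l\<close> moved to the same square, they would be its
  \<open>lower\<close> and \<open>upper\<close> labels, so one of the two dominoes would already
  cover it, contradicting \<open>vr'_neq\<close>.\<close>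

lemma vr'_inj: "inj_on vr' {1..n}"
proof (rule inj_onI)
  fix k l assume k: "k \<in> {1..n}" and l: "l \<in> {1..n}" and e: "vr' k = vr' l"
  show "k = l"
  proof (rule ccontr)
    assume ne: "k \<noteq> l"
    let ?s = "vr' k"
    have s: "\<not> fixed r ?s" by (rule vr'_var[OF k])
    have "lower lab ?s = enat k \<or> upper lab ?s = enat k" "lower lab ?s = enat l \<or> upper lab ?s = enat l"
      using pair_iff[OF k s] pair_iff[OF l s] e by auto
    then have "lab ?s = enat k \<or> lab ?s = enat l" using label_lower_or_upper[OF s] ne by auto
    then have "?s = vr k \<or> ?s = vr l" using label_var[OF k s] label_var[OF l s] by auto
    then show False using vr'_neq[OF k] vr'_neq[OF l] e by auto
  qed
qed

lemma fx_inj: "k \<in> {1..n} \<Longrightarrow> l \<in> {1..n} \<Longrightarrow> fx k = fx l \<Longrightarrow> k = l"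
  by (metis enat.inject label_fx)

end

section \<open>Cycles\<close>

lemma label_eq_enat:
  assumes "dom T \<inter> border = {}" "0 < k"
  shows "label T s = enat k \<longleftrightarrow> T s = Some k"
proof (cases "s \<in> border")
  case True
  then have "T s = None" using assms(1) by blast
  then show ?thesis using label_border[OF True] assms(2) by (simp add: zero_enat_def)
next
  case False
  then show ?thesis using label_inside[of s T] by (cases "T s") auto
qed

text \<open>The ranks \<open>q\<close> and \<open>r\<close> are independent, since dominoes have a
  fixed square for either parity. With \<open>q = r + 1\<close> this reads the larger rank through
  the parity of the smaller.\<close>

lemma labelling_label:
  assumes w: "wf_tab q T" and l: "labels T = {1..n}"
  shows "labelling r n (label T)"
proof
  have b: "dom T \<inter> border = {}" and st: "\<And>k. step q (sub T k) (sub T (Suc k))" using w unfolding wf_tab_def by auto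
  show id: "ideal {s. label T s \<le> enat k}" for k using st[of k] unfolding step_def sub_def by blast
  show "label T s \<le> enat n" if li: "label T s \<noteq> \<infinity>" for s
  proof (cases "s \<in> border")
    case True then show ?thesis using label_border by simp
  next
    case False
    then obtain k where k: "T s = Some k" using li label_inside[of s T] by (cases "T s") auto
    then have "k = 0 \<or> k \<in> labels T" unfolding labels_def by (auto intro: ranI)
    then have "k \<le> n" using l by auto
    then show ?thesis using label_inside[OF False, of T] k by simp
  qed
  show "\<exists>i j v. fstep r {s. label T s \<le> enat k} i j v {s. label T s \<le> enat (Suc k)}" if k: "k < n" for k
  proof -
    note ss = supp_sub[OF b, of k]
    have "Suc k \<in> labels T" using k l by simp
    then have "supp T (Suc k) \<noteq> {}" unfolding labels_def supp_def ran_def by auto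
    then have ne: "sub T k \<noteq> sub T (Suc k)" using ss by blast
    then obtain X where X: "domino X" "X \<inter> sub T k = {}" "sub T (Suc k) = sub T k \<union> X" by (rule step_domino[OF st])
    have "step r (sub T k) (sub T (Suc k))" unfolding X(3)
      by (rule domino_step[OF X(1,2)]) (use id[of k] id[of "Suc k"] X(3) in \<open>auto simp: sub_def\<close>)
    then show ?thesis using ne unfolding step_def sub_def by blast
  qed
qed

locale domino_tableau =
  fixes r n :: nat and T :: tableau
  assumes wf: "wf_tab r T" and labels: "labels T = {1..n}"
begin

sublocale labelling r n "label T"
  by (rule labelling_label[OF wf labels])

lemma dom_border: "dom T \<inter> border = {}" and sub_0: "sub T 0 = core r \<union> border"
  using wf unfolding wf_tab_def by auto

lemma label_Some: "k \<in> {1..n} \<Longrightarrow> label T s = enat k \<longleftrightarrow> T s = Some k"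
  using label_eq_enat[OF dom_border, of k s] by simp

lemma label_0: "label T s = 0 \<longleftrightarrow> s \<in> core r \<union> border"
  using sub_0 unfolding sub_def by (auto simp: zero_enat_def[symmetric])

lemma label_infinity: "label T s = \<infinity> \<longleftrightarrow> s \<notin> dom T \<union> border"
  using label_inside[of s T] label_border[of s T] by (cases "s \<in> border"; cases "T s") auto

lemma supp_eq: "k \<in> {1..n} \<Longrightarrow> supp T k = {fx k, vr k}"
  unfolding supp_def using label_iff[of k] label_Some[of k] by auto

text \<open>The orientation test in \<open>supp'\<close> asks whether the domino occupies its
  \<open>second_end\<close>; the result then uses the other end.\<close>

lemma supp'_eq:
  assumes k: "k \<in> {1..n}"
  shows "supp' r T k = {fx k, vr' k}"
proof -
  obtain i j where x: "fx k = (i, j)" by (cases "fx k")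
  note p = domino_props[OF k]
  have the: "(THE s. s \<in> supp T k \<and> fixed r s) = (i, j)"
    unfolding supp_eq[OF k] by (rule the_equality) (use p x in auto)
  have ne: "label T (i - 1, j + 1) \<noteq> enat k" "label T (i + 1, j - 1) \<noteq> enat k"
    using label_fixed[OF k, of "(i - 1, j + 1)"] label_fixed[OF k, of "(i + 1, j - 1)"] p(1) x by auto
  have c: "supp T k = {(i, j), (i + 1, j)} \<or> supp T k = {(i, j - 1), (i, j)} \<longleftrightarrow> vr k = (i + 1, j) \<or> vr k = (i, j - 1)"
    unfolding supp_eq[OF k] x doubleton_eq_iff using p(1,2) x by auto
  have f: "(if enat k < label T (i - 1, j + 1) then {(i, j), (i - 1, j)} else {(i, j), (i, j + 1)}) = {(i, j), first_end (label T) k (i, j)}"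
    "(if enat k < label T (i + 1, j - 1) then {(i, j), (i, j - 1)} else {(i, j), (i + 1, j)}) = {(i, j), second_end (label T) k (i, j)}"
    unfolding first_end_def second_end_def using ne by auto
  show ?thesis
  proof (cases "vr k = first_end (label T) k (fx k)")
    case True
    then have "\<not> (vr k = (i + 1, j) \<or> vr k = (i, j - 1))" unfolding x first_end_def by (auto split: if_splits)
    then show ?thesis unfolding supp'_def the Let_def prod.case c f using True x unfolding vr'_def by simp
  next
    case False
    then have "vr k = second_end (label T) k (fx k)" using p(4) by blast
    then have "vr k = (i + 1, j) \<or> vr k = (i, j - 1)" unfolding x second_end_def by (auto split: if_splits)
    then show ?thesis unfolding supp'_def the Let_def prod.case c f using False x unfolding vr'_def by simp
  qed
qed

text \<open>These sets are exactly the unions of cycles (\<open>closed_Union_cycles\<close>,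
  \<open>Union_cycles_closed\<close>): by \<open>meets_iff\<close> the relation generating cycles
  reduces to \<open>vr l = vr' m\<close>.\<close>

definition closed :: "nat set \<Rightarrow> bool" where
  "closed U \<longleftrightarrow> U \<subseteq> {1..n} \<and> (\<forall>l\<in>{1..n}. \<forall>m\<in>{1..n}. vr l = vr' m \<longrightarrow> (l \<in> U \<longleftrightarrow> m \<in> U))"

lemma meets_iff:
  assumes "l \<in> {1..n}" "m \<in> {1..n}"
  shows "supp T l \<inter> supp' r T m \<noteq> {} \<longleftrightarrow> l = m \<or> vr l = vr' m"
proof -
  have "fx l \<noteq> vr' m" "vr l \<noteq> fx m" "fx l = fx m \<longleftrightarrow> l = m"
    using domino_props[OF assms(1)] domino_props[OF assms(2)] vr'_var[OF assms(2)] fx_inj assms by auto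
  then show ?thesis unfolding supp_eq[OF assms(1)] supp'_eq[OF assms(2)] by auto
qed

lemma cycle_subset:
  assumes "closed U" "k \<in> U"
  shows "cycle r T k \<subseteq> U"
proof
  fix l assume "l \<in> cycle r T k"
  then show "l \<in> U"
  proof induction
    case (step m l)
    have lm: "l \<in> {1..n}" "m \<in> {1..n}" using step.hyps step.IH assms(1) labels unfolding closed_def by auto
    then have "l = m \<or> vr l = vr' m \<or> vr m = vr' l" using step.hyps(3) meets_iff[of l m] meets_iff[of m l] by blast
    then show ?case using assms(1) lm step.IH unfolding closed_def by blast
  qed (use assms in simp)
qed

lemma cycle_closed:
  assumes k: "k \<in> {1..n}"
  shows "closed (cycle r T k)"
proof -
  have sub: "cycle r T k \<subseteq> {1..n}"
  proof
    fix l assume "l \<in> cycle r T k" then show "l \<in> {1..n}" by induction (use k labels in auto)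
  qed
  have "l \<in> cycle r T k \<longleftrightarrow> m \<in> cycle r T k" if lm: "l \<in> {1..n}" "m \<in> {1..n}" "vr l = vr' m" for l m
  proof
    assume l: "l \<in> cycle r T k"
    have "supp' r T m \<inter> supp T l \<noteq> {}" using meets_iff[of l m] lm by blast
    then show "m \<in> cycle r T k" using cycle.step[OF l, of m] lm labels by blast
  next
    assume l: "m \<in> cycle r T k"
    have "supp T l \<inter> supp' r T m \<noteq> {}" using meets_iff[of l m] lm by blast
    then show "l \<in> cycle r T k" using cycle.step[OF l, of l] lm labels by blast
  qed
  then show ?thesis using sub unfolding closed_def by blast
qed

lemma closed_compl: "closed U \<Longrightarrow> closed ({1..n} - U)"
  unfolding closed_def by blast

lemma cycles_eq: "cycles r T = cycle r T ` {1..n}"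
  unfolding cycles_def labels ..

text \<open>The complement of a closed set is closed, so the cycle lies on whichever side its
  generator does.\<close>

lemma cycle_dichotomy:
  assumes "c \<in> cycles r T" "closed U"
  shows "c \<subseteq> U \<or> c \<inter> U = {}"
proof -
  obtain k where k: "c = cycle r T k" "k \<in> {1..n}" using assms(1) cycles_eq by auto
  show ?thesis using cycle_subset[OF assms(2), of k] cycle_subset[OF closed_compl[OF assms(2)], of k] k by (cases "k \<in> U") auto
qed

lemma closed_cycles: "c \<in> cycles r T \<Longrightarrow> closed c"
  using cycle_closed cycles_eq by auto

lemma cycles_eqI:
  assumes "c \<in> cycles r T" "k \<in> c"
  shows "c = cycle r T k"
proof
  have k: "k \<in> {1..n}" using closed_cycles[OF assms(1)] assms(2) unfolding closed_def by auto
  show "cycle r T k \<subseteq> c" by (rule cycle_subset[OF closed_cycles[OF assms(1)] assms(2)])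
  have "k \<in> cycle r T k" by (rule cycle.start)
  then show "c \<subseteq> cycle r T k" using cycle_dichotomy[OF assms(1) cycle_closed[OF k]] assms(2) by blast
qed

lemma closed_Union_cycles:
  assumes "closed U"
  shows "\<exists>C\<subseteq>cycles r T. U = \<Union>C"
proof (intro exI conjI)
  have U: "U \<subseteq> {1..n}" using assms unfolding closed_def by simp
  show "cycle r T ` U \<subseteq> cycles r T" using U cycles_eq by auto
  have "U \<subseteq> \<Union>(cycle r T ` U)"
  proof
    fix k assume "k \<in> U"
    then show "k \<in> \<Union>(cycle r T ` U)" using cycle.start[of k r T] by (rule UN_I)
  qed
  moreover have "\<Union>(cycle r T ` U) \<subseteq> U" using cycle_subset[OF assms] by (rule UN_least)
  ultimately show "U = \<Union>(cycle r T ` U)" by (rule subset_antisym)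
qed

lemma Union_cycles_closed:
  assumes "C \<subseteq> cycles r T"
  shows "closed (\<Union>C)"
proof -
  have "\<And>c. c \<in> C \<Longrightarrow> closed c" using assms closed_cycles by blast
  then show ?thesis unfolding closed_def by blast
qed

lemma closed_vr':
  assumes "closed U" "l \<in> U" "vr l \<in> vr' ` {1..n}"
  shows "vr l \<in> vr' ` U"
proof -
  obtain m where m: "m \<in> {1..n}" "vr l = vr' m" using assms(3) by blast
  have "m \<in> U" using assms(1,2) m unfolding closed_def by blast
  then show ?thesis using m(2) by simp
qed

lemma closed_vr:
  assumes "closed U" "l \<in> U" "vr' l \<in> vr ` {1..n}"
  shows "vr' l \<in> vr ` U"
proof -
  obtain m where m: "m \<in> {1..n}" "vr' l = vr m" using assms(3) by blast
  have "m \<in> U" using assms(1,2) m(1) m(2)[symmetric] unfolding closed_def by blast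
  then show ?thesis using m(2) by simp
qed

text \<open>A cycle is an orbit of the injective partial map sending \<open>m\<close> to the \<open>l\<close> with \<open>vr l = vr' m\<close>. The cycle is
  open iff the orbit has a first element, whose \<open>vr\<close> is \<open>S_b\<close>, and a last one, whose \<open>vr'\<close> is \<open>S_f\<close>.\<close>

definition source :: "nat \<Rightarrow> bool" where
  "source a \<longleftrightarrow> a \<in> {1..n} \<and> vr a \<notin> vr' ` {1..n}"

definition sink :: "nat \<Rightarrow> bool" where
  "sink t \<longleftrightarrow> t \<in> {1..n} \<and> vr' t \<notin> vr ` {1..n}"

text \<open>The forward orbit of \<open>a\<close> is closed, because \<open>a\<close> has no
  predecessor and other predecessors are unique by injectivity of \<open>vr'\<close>. So it contains
  the whole cycle, and a second source could not be reached.\<close>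

lemma source_unique:
  assumes c: "c \<in> cycles r T" and a: "a \<in> c" "source a" and b: "b \<in> c" "source b"
  shows "a = b"
proof -
  define R where "R = {(m, l). m \<in> {1..n} \<and> l \<in> {1..n} \<and> vr l = vr' m}"
  define O1 where "O1 = {l. (a, l) \<in> R\<^sup>*}"
  have a1: "a \<in> {1..n}" using a(2) unfolding source_def by simp
  have inn: "l \<in> {1..n}" if "(a, l) \<in> R\<^sup>*" for l using that by (cases rule: rtrancl.cases) (use a1 R_def in auto)
  have "closed O1" unfolding closed_def
  proof (intro conjI ballI impI)
    show "O1 \<subseteq> {1..n}" unfolding O1_def using inn by blast
    fix l m assume h: "l \<in> {1..n}" "m \<in> {1..n}" "vr l = vr' m"
    have ml: "(m, l) \<in> R" using h unfolding R_def by simp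
    show "l \<in> O1 \<longleftrightarrow> m \<in> O1"
    proof
      assume "m \<in> O1" then show "l \<in> O1" unfolding O1_def using ml by (auto intro: rtrancl_into_rtrancl)
    next
      assume "l \<in> O1"
      then have "(a, l) \<in> R\<^sup>*" unfolding O1_def by simp
      then show "m \<in> O1"
      proof (cases rule: rtrancl.cases)
        case rtrancl_refl
        then have "vr a = vr' m" using h by simp
        then show ?thesis using a(2) h unfolding source_def by blast
      next
        case (rtrancl_into_rtrancl m')
        then have "vr' m' = vr' m" "m' \<in> {1..n}" using h unfolding R_def by auto
        then have "m' = m" using inj_onD[OF vr'_inj] h by blast
        then show ?thesis using rtrancl_into_rtrancl unfolding O1_def by simp
      qed
    qed
  qed
  then have "cycle r T a \<subseteq> O1" by (rule cycle_subset) (simp add: O1_def)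
  then have "(a, b) \<in> R\<^sup>*" using cycles_eqI[OF c a(1)] b(1) unfolding O1_def by blast
  then show ?thesis
  proof (cases rule: rtrancl.cases)
    case (rtrancl_into_rtrancl m')
    then show ?thesis using b(2) unfolding source_def R_def by blast
  qed simp
qed

lemma sink_unique:
  assumes c: "c \<in> cycles r T" and a: "a \<in> c" "sink a" and b: "b \<in> c" "sink b"
  shows "a = b"
proof -
  define R where "R = {(m, l). m \<in> {1..n} \<and> l \<in> {1..n} \<and> vr m = vr' l}"
  define O1 where "O1 = {l. (a, l) \<in> R\<^sup>*}"
  have a1: "a \<in> {1..n}" using a(2) unfolding sink_def by simp
  have inn: "l \<in> {1..n}" if "(a, l) \<in> R\<^sup>*" for l using that by (cases rule: rtrancl.cases) (use a1 R_def in auto)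
  have "closed O1" unfolding closed_def
  proof (intro conjI ballI impI)
    show "O1 \<subseteq> {1..n}" unfolding O1_def using inn by blast
    fix l m assume h: "l \<in> {1..n}" "m \<in> {1..n}" "vr l = vr' m"
    have ml: "(l, m) \<in> R" using h unfolding R_def by simp
    show "l \<in> O1 \<longleftrightarrow> m \<in> O1"
    proof
      assume "l \<in> O1" then show "m \<in> O1" unfolding O1_def using ml by (auto intro: rtrancl_into_rtrancl)
    next
      assume "m \<in> O1"
      then have "(a, m) \<in> R\<^sup>*" unfolding O1_def by simp
      then show "l \<in> O1"
      proof (cases rule: rtrancl.cases)
        case rtrancl_refl
        then have "vr' a = vr l" using h by simp
        then show ?thesis using a(2) h unfolding sink_def by blast
      next
        case (rtrancl_into_rtrancl m')
        then have "vr m' = vr l" "m' \<in> {1..n}" using h unfolding R_def by auto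
        then have "m' = l" using inj_onD[OF vr_inj] h by blast
        then show ?thesis using rtrancl_into_rtrancl unfolding O1_def by simp
      qed
    qed
  qed
  then have "cycle r T a \<subseteq> O1" by (rule cycle_subset) (simp add: O1_def)
  then have "(a, b) \<in> R\<^sup>*" using cycles_eqI[OF c a(1)] b(1) unfolding O1_def by blast
  then show ?thesis
  proof (cases rule: rtrancl.cases)
    case (rtrancl_into_rtrancl m')
    then have "vr' b \<in> vr ` {1..n}" unfolding R_def by force
    then show ?thesis using b(2) unfolding sink_def by blast
  qed simp
qed

text \<open>On the finite set \<open>c\<close> the maps \<open>vr\<close> and \<open>vr'\<close> are
  injective, so their images have equal size; if one image lies in the other, they are
  equal.\<close>

lemma source_sink_exist:
  assumes c: "c \<in> cycles r T"
  shows "(\<exists>a\<in>c. source a) \<longleftrightarrow> (\<exists>t\<in>c. sink t)"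
proof -
  have cl: "closed c" by (rule closed_cycles[OF c])
  have sub: "c \<subseteq> {1..n}" using cl unfolding closed_def by simp
  have fin: "finite c" using sub finite_subset by blast
  have card: "card (vr ` c) = card (vr' ` c)"
    using card_image[OF inj_on_subset[OF vr_inj sub]] card_image[OF inj_on_subset[OF vr'_inj sub]] by simp
  have 1: "vr a \<in> vr' ` {1..n} \<longleftrightarrow> vr a \<in> vr' ` c" if "a \<in> c" for a
    using closed_vr'[OF cl that] sub by blast
  have 2: "vr' a \<in> vr ` {1..n} \<longleftrightarrow> vr' a \<in> vr ` c" if "a \<in> c" for a
    using closed_vr[OF cl that] sub by blast
  have s: "(\<exists>a\<in>c. source a) \<longleftrightarrow> \<not> vr ` c \<subseteq> vr' ` c" unfolding source_def using 1 sub by blast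
  have t: "(\<exists>a\<in>c. sink a) \<longleftrightarrow> \<not> vr' ` c \<subseteq> vr ` c" unfolding sink_def using 2 sub by blast
  have "vr ` c \<subseteq> vr' ` c \<longleftrightarrow> vr' ` c \<subseteq> vr ` c"
    using card_subset_eq[of "vr' ` c" "vr ` c"] card_subset_eq[of "vr ` c" "vr' ` c"] card fin by auto
  then show ?thesis using s t by simp
qed

text \<open>Characterizes \<open>delta r\<close> through neighbouring fixed squares. Parity excludes
  the antidiagonal \<open>i + j = r + 1\<close>, the only other place where the inequalities could
  disagree.\<close>

lemma lower_0_delta:
  assumes s: "\<not> fixed r s"
  shows "lower (label T) s = 0 \<and> upper (label T) s \<noteq> 0 \<longleftrightarrow> s \<in> delta r"
proof -
  obtain i j where ij: "s = (i, j)" by (cases s)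
  have "lower (label T) s = 0 \<longleftrightarrow> label T (i - 1, j) = 0 \<and> label T (i, j - 1) = 0"
    unfolding lower_def ij by (auto simp: max_def split: if_splits)
  moreover have "upper (label T) s \<noteq> 0 \<longleftrightarrow> label T (i + 1, j) \<noteq> 0 \<and> label T (i, j + 1) \<noteq> 0"
    unfolding upper_def ij by (auto simp: min_def split: if_splits)
  moreover have "even (i + j + int r)" using s unfolding ij fixed_iff by simp
  moreover have "(i - 1, j) \<in> core r \<union> border \<and> (i, j - 1) \<in> core r \<union> border \<and>
     (i + 1, j) \<notin> core r \<union> border \<and> (i, j + 1) \<notin> core r \<union> border \<longleftrightarrow> (i, j) \<in> delta r" if e: "even (i + j + int r)"
  proof -
    have "i + j \<noteq> int r + 1" using e by presburger
    then show ?thesis unfolding core_def border_def delta_def by auto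
  qed
  ultimately show ?thesis unfolding label_0 ij by blast
qed

lemma label_var_0:
  assumes s: "\<not> fixed r s" and z: "label T s = 0"
  shows "upper (label T) s = 0"
proof (rule ccontr)
  assume "upper (label T) s \<noteq> 0"
  moreover have "lower (label T) s = 0" using lower_le[of s] z by simp
  ultimately have "s \<in> delta r" using lower_0_delta[OF s] by blast
  moreover have "s \<in> core r \<union> border" using z label_0 by simp
  ultimately show False unfolding core_def border_def delta_def by auto
qed

lemma delta_var: "s \<in> delta r \<Longrightarrow> \<not> fixed r s"
  unfolding delta_def by (auto simp: fixed_iff)

text \<open>A square covered by no domino and not in the core is outside the diagram. The core is
  impossible because a variable square labelled 0 has both neighbouring values 0 and is the end of
  no domino.\<close>

lemma sink_outside:
  assumes t: "sink t"
  shows "vr' t \<notin> dom T \<union> border" "upper (label T) (vr' t) = \<infinity>" "lower (label T) (vr' t) = enat t"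
proof -
  let ?s = "vr' t"
  have t1: "t \<in> {1..n}" using t unfolding sink_def by simp
  have s: "\<not> fixed r ?s" by (rule vr'_var[OF t1])
  have p: "lower (label T) ?s = enat t \<or> upper (label T) ?s = enat t" using pair_iff[OF t1 s] by auto
  have nl: "label T ?s \<noteq> enat k" if "k \<in> {1..n}" for k
    using label_var[OF that s] t that unfolding sink_def by auto
  have "label T ?s \<noteq> 0"
  proof
    assume z: "label T ?s = 0"
    then have "upper (label T) ?s = 0" "lower (label T) ?s = 0" using label_var_0[OF s] lower_le[of ?s] by auto
    then show False using p t1 by (auto simp: zero_enat_def)
  qed
  then have inf: "label T ?s = \<infinity>" using value_cases[of ?s] nl by blast
  then show "?s \<notin> dom T \<union> border" using label_infinity by blast
  show u: "upper (label T) ?s = \<infinity>" using le_upper[of ?s] inf by simp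
  then show "lower (label T) ?s = enat t" using p by simp
qed

text \<open>The two alternatives are the two ways of vacating a square: it leaves the diagram, or it
  joins the core. Any other value on the far side would be the label of a domino moving into
  it.\<close>

lemma source_cases:
  assumes a: "source a"
  shows "upper (label T) (vr a) = \<infinity> \<and> lower (label T) (vr a) = enat a \<or> vr a \<in> delta r"
proof -
  let ?s = "vr a"
  have a1: "a \<in> {1..n}" using a unfolding source_def by simp
  have s: "\<not> fixed r ?s" using domino_props(2)[OF a1] .
  have p: "lower (label T) ?s = enat a \<or> upper (label T) ?s = enat a" using pair_iff[OF a1 s] by auto
  have other: "lower (label T) ?s \<noteq> enat k \<and> upper (label T) ?s \<noteq> enat k" if "k \<in> {1..n}" "k \<noteq> a" for k
  proof -
    have "?s \<noteq> vr k" using that a1 inj_onD[OF vr_inj] by blast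
    moreover have "?s \<noteq> vr' k" using a that unfolding source_def by blast
    ultimately show ?thesis using pair_iff[OF that(1) s] by blast
  qed
  obtain i j where ij: "?s = (i, j)" by (cases ?s)
  have fin: "x = 0 \<or> x = \<infinity> \<or> (\<exists>k\<in>{1..n}. x = enat k)" if "x = label T s'" for x s'
    unfolding that by (rule value_cases[of s']) auto
  have u: "upper (label T) ?s = label T (i + 1, j) \<or> upper (label T) ?s = label T (i, j + 1)"
    unfolding ij upper_def by (auto simp: min_def)
  have l: "lower (label T) ?s = label T (i - 1, j) \<or> lower (label T) ?s = label T (i, j - 1)"
    unfolding ij lower_def by (auto simp: max_def)
  show ?thesis
  proof (cases "lower (label T) ?s = enat a")
    case True
    have "upper (label T) ?s \<noteq> 0" using le_upper[of ?s] label_vr[OF a1] a1 by (auto simp: zero_enat_def)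
    moreover have "upper (label T) ?s \<noteq> enat a" by (rule lower_neq_upper[OF a1 s True])
    ultimately have "upper (label T) ?s = \<infinity>" using other u fin by metis
    then show ?thesis using True by simp
  next
    case False
    then have ua: "upper (label T) ?s = enat a" using p by simp
    have "lower (label T) ?s \<noteq> \<infinity>"
    proof
      assume "lower (label T) ?s = \<infinity>"
      then show False using lower_le[of ?s] label_vr[OF a1] by simp
    qed
    then have "lower (label T) ?s = 0" using other l fin False by metis
    then show ?thesis using lower_0_delta[OF s] ua a1 by (auto simp: zero_enat_def)
  qed
qed

text \<open>Both neighbours before a square of \<open>delta r\<close> carry 0, so its current domino
  is the only one that competes for it and no domino moves there.\<close>

lemma delta_source:
  assumes k: "k \<in> {1..n}" and d: "supp T k \<inter> delta r \<noteq> {}"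
  shows "source k" "vr k \<in> delta r"
proof -
  have s: "vr k \<in> delta r"
    using d domino_props(1)[OF k] delta_var unfolding supp_eq[OF k] by blast
  then show "vr k \<in> delta r" .
  have sv: "\<not> fixed r (vr k)" using domino_props(2)[OF k] .
  have l0: "lower (label T) (vr k) = 0" using lower_0_delta[OF sv] s by blast
  have uk: "upper (label T) (vr k) = enat k"
    using pair_iff[OF k sv] l0 k by (auto simp: zero_enat_def)
  have "vr k \<noteq> vr' m" if m: "m \<in> {1..n}" for m
  proof
    assume e: "vr k = vr' m"
    then have "lower (label T) (vr k) = enat m \<or> upper (label T) (vr k) = enat m" using pair_iff[OF m sv] by simp
    then have "m = k" using l0 uk m by (auto simp: zero_enat_def)
    then show False using e vr'_neq[OF k] by simp
  qed
  then show "source k" unfolding source_def using k by blast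
qed

lemma squares_eq: "U \<subseteq> {1..n} \<Longrightarrow> squares T U = fx ` U \<union> vr ` U"
  unfolding squares_def using supp_eq by blast

lemma in_supp': "U \<subseteq> {1..n} \<Longrightarrow> (\<exists>l\<in>U. s \<in> supp' r T l) \<longleftrightarrow> s \<in> fx ` U \<union> vr' ` U"
  using supp'_eq by blast

lemma MT_dom:
  assumes U: "U \<subseteq> {1..n}"
  shows "s \<in> dom (MT r T U) \<longleftrightarrow> s \<in> fx ` U \<union> vr' ` U \<or> s \<in> vr ` U \<and> s \<in> delta r \<or> s \<notin> vr ` U \<and> s \<in> dom T"
proof -
  have "fx ` U \<subseteq> dom T"
  proof
    fix s assume "s \<in> fx ` U"
    then obtain k where "k \<in> U" "s = fx k" by auto
    then have "T s = Some k" using label_Some[of k s] label_fx[of k] U by auto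
    then show "s \<in> dom T" by auto
  qed
  moreover have "fx ` U \<inter> delta r = {}" using domino_props(1) delta_var U by blast
  ultimately show ?thesis
    unfolding MT_def dom_def using in_supp'[OF U, of s] squares_eq[OF U] by auto
qed

lemma vr_dom: "k \<in> {1..n} \<Longrightarrow> vr k \<in> dom T"
  using label_Some[of k "vr k"] label_vr[of k] by auto

lemma fx_dom: "k \<in> {1..n} \<Longrightarrow> fx k \<in> dom T"
  using label_Some[of k "fx k"] label_fx[of k] by auto

lemma fx_neq_vr': "k \<in> {1..n} \<Longrightarrow> l \<in> {1..n} \<Longrightarrow> fx k \<noteq> vr' l"
  using domino_props(1) vr'_var by metis

lemma S_f_sink:
  assumes c: "c \<in> cycles r T" and t: "t \<in> c" "sink t"
  shows "open_cycle r T c" "S_f r T c = vr' t"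
proof -
  have cl: "closed c" and U: "c \<subseteq> {1..n}" using closed_cycles[OF c] unfolding closed_def by auto
  have d: "vr' t \<in> dom (MT r T c)" "vr' t \<notin> dom T" using MT_dom[OF U] t sink_outside by auto
  then show "open_cycle r T c" unfolding open_cycle_def by auto
  show "S_f r T c = vr' t" unfolding S_f_def
  proof (rule the_equality)
    show "vr' t \<notin> dom T \<and> vr' t \<in> dom (MT r T c)" using d by simp
    fix s assume h: "s \<notin> dom T \<and> s \<in> dom (MT r T c)"
    have "s \<notin> fx ` c" "s \<notin> vr ` {1..n}"
    proof -
      show "s \<notin> fx ` c" using h U fx_dom by blast
      show "s \<notin> vr ` {1..n}" using h vr_dom by blast
    qed
    then obtain l where l: "l \<in> c" "s = vr' l" using h MT_dom[OF U] U by blast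
    then have "sink l" using \<open>s \<notin> vr ` {1..n}\<close> U unfolding sink_def by blast
    then show "s = vr' t" using sink_unique[OF c l(1) _ t] l by blast
  qed
qed

lemma S_b_source:
  assumes c: "c \<in> cycles r T" and a: "a \<in> c" "source a"
  shows "open_cycle r T c" "S_b r T c = vr a"
proof -
  have cl: "closed c" and U: "c \<subseteq> {1..n}" using closed_cycles[OF c] unfolding closed_def by auto
  obtain t where "t \<in> c" "sink t" using source_sink_exist[OF c] a by blast
  then show "open_cycle r T c" using S_f_sink[OF c] by blast
  have a1: "a \<in> {1..n}" "vr a \<notin> vr' ` {1..n}" using a(2) unfolding source_def by auto
  have "vr a \<noteq> fx l" if "l \<in> c" for l
    using domino_props(1)[of l] domino_props(2)[OF a1(1)] that U by auto
  then have nf: "vr a \<notin> fx ` c \<union> vr' ` c" using a1(2) U by blast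
  show "S_b r T c = vr a" unfolding S_b_def
  proof (rule the_equality)
    show "vr a \<in> squares T c \<and> (MT r T c (vr a) = None \<or> MT r T c (vr a) = Some 0)"
      unfolding MT_def squares_eq[OF U] in_supp'[OF U] using nf a(1) by auto
    fix s assume h: "s \<in> squares T c \<and> (MT r T c s = None \<or> MT r T c s = Some 0)"
    have "s \<notin> fx ` c \<union> vr' ` c"
    proof
      assume s: "s \<in> fx ` c \<union> vr' ` c"
      then obtain l where l: "l \<in> c" "s \<in> supp' r T l" using in_supp'[OF U] by blast
      have "l' = l" if "l' \<in> c" "s \<in> supp' r T l'" for l'
      proof -
        have ll: "l \<in> {1..n}" "l' \<in> {1..n}" using l that U by auto
        have "s = fx l \<or> s = vr' l" "s = fx l' \<or> s = vr' l'"
          using l(2) that(2) unfolding supp'_eq[OF ll(1)] supp'_eq[OF ll(2)] by auto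
        then have "fx l' = fx l \<or> vr' l' = vr' l"
          using fx_neq_vr'[OF ll(1) ll(2)] fx_neq_vr'[OF ll(2) ll(1)] by metis
        then show ?thesis using fx_inj[OF ll(2,1)] inj_onD[OF vr'_inj _ ll(2,1)] by blast
      qed
      then have "(THE l. l \<in> c \<and> s \<in> supp' r T l) = l" using l by blast
      then have "MT r T c s = Some l" unfolding MT_def using l by auto
      then show False using h l U by auto
    qed
    then obtain l where l: "l \<in> c" "s = vr l" "s \<notin> vr' ` c" using h squares_eq[OF U] by auto
    have "s \<notin> vr' ` {1..n}" using closed_vr'[OF cl l(1)] l(2,3) by metis
    then have "source l" using l U unfolding source_def by blast
    then show "s = vr a" using source_unique[OF c l(1) _ a] l by blast
  qed
qed

lemma open_cycle_ends:
  assumes c: "c \<in> cycles r T" and o: "open_cycle r T c"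
  obtains a t where "a \<in> c" "source a" "t \<in> c" "sink t" "S_b r T c = vr a" "S_f r T c = vr' t"
proof -
  have cl: "closed c" and U: "c \<subseteq> {1..n}" using closed_cycles[OF c] unfolding closed_def by auto
  have "(\<exists>a\<in>c. source a) \<or> (\<exists>t\<in>c. sink t)"
  proof -
    obtain s where s: "s \<in> dom (MT r T c) \<longleftrightarrow> s \<notin> dom T" using o unfolding open_cycle_def by blast
    show ?thesis
    proof (cases "s \<in> dom T")
      case True
      then have n: "s \<notin> fx ` c \<union> vr' ` c" "s \<in> vr ` c" using s MT_dom[OF U] by blast+
      then obtain l where l: "l \<in> c" "s = vr l" by auto
      have "s \<notin> vr' ` {1..n}" using closed_vr'[OF cl l(1)] l(2) n(1) by (metis UnCI)
      then have "source l" using l U unfolding source_def by blast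
      then show ?thesis using l by blast
    next
      case False
      have "s \<notin> fx ` c" using False U fx_dom by blast
      moreover have nv: "s \<notin> vr ` {1..n}" using False vr_dom by blast
      ultimately obtain l where l: "l \<in> c" "s = vr' l" using s False MT_dom[OF U] U by blast
      then have "sink l" using nv U unfolding sink_def by blast
      then show ?thesis using l by blast
    qed
  qed
  then obtain a t where at: "a \<in> c" "source a" "t \<in> c" "sink t" using source_sink_exist[OF c] by blast
  then show thesis using that S_b_source[OF c] S_f_sink[OF c] by blast
qed

end

section \<open>Moving through cycles\<close>

lemma ideal_local:
  assumes "\<And>i j. (i + 1, j) \<in> A \<Longrightarrow> (i, j) \<in> A" "\<And>i j. (i, j + 1) \<in> A \<Longrightarrow> (i, j) \<in> A"
  shows "ideal A"
  unfolding ideal_def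
proof (intro allI impI)
  fix i j i' j' assume h: "(i, j) \<in> A" "i' \<le> i" "j' \<le> j"
  have 1: "(i - int k, j) \<in> A" for k
  proof (induction k)
    case (Suc k) then show ?case using assms(1)[of "i - int (Suc k)" j] by (simp add: algebra_simps)
  qed (use h in simp)
  have 2: "(i', j) \<in> A" using 1[of "nat (i - i')"] h(2) by simp
  have "(i', j - int k) \<in> A" for k
  proof (induction k)
    case (Suc k) then show ?case using assms(2)[of i' "j - int (Suc k)"] by (simp add: algebra_simps)
  qed (use 2 in simp)
  from this[of "nat (j - j')"] show "(i', j') \<in> A" using h(3) by simp
qed

context domino_tableau
begin

text \<open>All of \<open>delta r\<close> is included, even squares outside the diagram: these are
  the squares that \<open>complete_core\<close> adds.\<close>

definition flipped :: "nat set \<Rightarrow> square \<Rightarrow> bool" where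
  "flipped X s \<longleftrightarrow> s \<in> delta r \<or> (\<exists>k\<in>X. lower (label T) s = enat k \<or> upper (label T) s = enat k)"

text \<open>Moving through \<open>X\<close> written as a labelling: a variable square only ever has
  its \<open>lower\<close> or its \<open>upper\<close> value, and moving exchanges the two. Level
  sets of this function are easier to recognize as shapes than those of \<open>MT\<close>.\<close>

definition flip :: "nat set \<Rightarrow> square \<Rightarrow> enat" where
  "flip X s = (if \<not> fixed r s \<and> flipped X s then
     (if label T s = lower (label T) s then upper (label T) s else lower (label T) s) else label T s)"

definition delta_labels :: "nat set" where
  "delta_labels = {k \<in> {1..n}. supp T k \<inter> delta r \<noteq> {}}"

lemma flip_fixed: "fixed r s \<Longrightarrow> flip X s = label T s"
  unfolding flip_def by simp

lemma flip_lower_or_upper: "\<not> fixed r s \<Longrightarrow> flip X s = lower (label T) s \<or> flip X s = upper (label T) s"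
  unfolding flip_def using label_lower_or_upper[of s] by auto

lemma flip_bounds: "\<not> fixed r s \<Longrightarrow> lower (label T) s \<le> flip X s \<and> flip X s \<le> upper (label T) s"
  using flip_lower_or_upper[of s X] lower_le[of s] le_upper[of s] by auto

text \<open>Different dominoes \<open>k\<close> and \<open>m\<close> competing for \<open>s\<close>
  are linked there, one having \<open>s\<close> as \<open>vr\<close> and the other as
  \<open>vr'\<close>; closedness puts both in \<open>X\<close> or neither. Squares of
  \<open>delta r\<close> are settled by \<open>delta_labels\<close>.\<close>

lemma flipped_iff:
  assumes X: "closed X" "delta_labels \<subseteq> X" and k: "k \<in> {1..n}" and s: "\<not> fixed r s"
    and p: "lower (label T) s = enat k \<or> upper (label T) s = enat k"
  shows "flipped X s \<longleftrightarrow> k \<in> X"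
proof
  assume "k \<in> X" then show "flipped X s" unfolding flipped_def using p by blast
next
  assume "flipped X s"
  then consider "s \<in> delta r" | m where "m \<in> X" "lower (label T) s = enat m \<or> upper (label T) s = enat m"
    unfolding flipped_def by blast
  then show "k \<in> X"
  proof cases
    case 1
    then have l: "lower (label T) s = 0" and "upper (label T) s \<noteq> 0" using lower_0_delta[OF s] by auto
    then have u: "upper (label T) s = enat k" using p k by (auto simp: zero_enat_def)
    have "label T s \<noteq> 0" using 1 label_0 unfolding core_def border_def delta_def by auto
    then have "label T s = enat k" using label_lower_or_upper[OF s] l u by auto
    then have "s = vr k" using label_var[OF k s] by simp
    then have "k \<in> delta_labels" unfolding delta_labels_def using 1 k supp_eq[OF k] by auto
    then show ?thesis using X by blast
  next
    case (2 m)
    have m: "m \<in> {1..n}" using 2(1) X(1) unfolding closed_def by blast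
    show ?thesis
    proof (cases "m = k")
      case False
      then have lu: "label T s = enat k \<or> label T s = enat m" using label_lower_or_upper[OF s] p 2(2) by auto
      have pk: "s = vr k \<or> s = vr' k" and pm: "s = vr m \<or> s = vr' m" using pair_iff[OF k s] pair_iff[OF m s] p 2(2) by auto
      have "vr k \<noteq> vr m" using False inj_onD[OF vr_inj _ k m] by blast
      from lu show ?thesis
      proof
        assume "label T s = enat k"
        then have "s = vr k" using label_var[OF k s] by simp
        then have "vr k = vr' m" using pm \<open>vr k \<noteq> vr m\<close> by simp
        then show ?thesis using X(1) k m 2(1) unfolding closed_def by blast
      next
        assume "label T s = enat m"
        then have "s = vr m" using label_var[OF m s] by simp
        then have "vr m = vr' k" using pk \<open>vr k \<noteq> vr m\<close> by simp
        then show ?thesis using X(1) k m 2(1) unfolding closed_def by blast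
      qed
    qed (use 2 in simp)
  qed
qed

lemma flip_eq_iff:
  assumes X: "closed X" "delta_labels \<subseteq> X" and k: "k \<in> {1..n}" and s: "\<not> fixed r s"
  shows "flip X s = enat k \<longleftrightarrow> s = (if k \<in> X then vr' k else vr k)"
proof (cases "lower (label T) s = enat k \<or> upper (label T) s = enat k")
  case False
  then have "s \<noteq> vr k" "s \<noteq> vr' k" using pair_iff[OF k s] by auto
  moreover have "flip X s \<noteq> enat k" using False flip_lower_or_upper[OF s, of X] by auto
  ultimately show ?thesis by auto
next
  case True
  note fi = flipped_iff[OF X k s True]
  have ne: "lower (label T) s \<noteq> upper (label T) s" using True lower_neq_upper[OF k s] by auto
  have pk: "s = vr k \<or> s = vr' k" using True pair_iff[OF k s] by auto
  have lv: "label T s = enat k \<longleftrightarrow> s = vr k" by (rule label_var[OF k s])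
  show ?thesis
  proof (cases "k \<in> X")
    case kX: True
    then have f: "flip X s = (if label T s = lower (label T) s then upper (label T) s else lower (label T) s)"
      unfolding flip_def using fi s by simp
    have "flip X s = enat k \<longleftrightarrow> label T s \<noteq> enat k" using f True ne label_lower_or_upper[OF s] by auto
    then show ?thesis using lv pk kX vr'_neq[OF k] by auto
  next
    case False
    then have "flip X s = label T s" unfolding flip_def using fi by simp
    then show ?thesis using lv False by simp
  qed
qed

text \<open>Of two adjacent squares one is fixed and keeps its label, which bounds
  \<open>lower\<close> or \<open>upper\<close> of the other and hence its flipped value.
  Monotonicity thus needs nothing about \<open>X\<close>.\<close>

lemma flip_ideal: "ideal {s. flip X s \<le> e}"
proof (rule ideal_local)
  have le: "flip X (a, b) \<le> flip X (a', b')" if h: "(a', b') = (a + 1, b) \<or> (a', b') = (a, b + 1)" for a b a' b'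
  proof (cases "fixed r (a, b)")
    case True
    then have s: "\<not> fixed r (a', b')" using h by auto
    have "label T (a, b) \<le> lower (label T) (a', b')" using h unfolding lower_def by auto
    then show ?thesis using flip_bounds[OF s, of X] flip_fixed[OF True, of X] by auto
  next
    case False
    then have s: "fixed r (a', b')" using h by auto
    have "upper (label T) (a, b) \<le> label T (a', b')" using h unfolding upper_def by auto
    then show ?thesis using flip_bounds[OF False, of X] flip_fixed[OF s, of X] by auto
  qed
  show "(i, j) \<in> {s. flip X s \<le> e}" if "(i + 1, j) \<in> {s. flip X s \<le> e}" for i j
    using le[of "i + 1" j i j] that by auto
  show "(i, j) \<in> {s. flip X s \<le> e}" if "(i, j + 1) \<in> {s. flip X s \<le> e}" for i j
    using le[of i "j + 1" i j] that by auto
qed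

lemma fx_nbrs:
  assumes k: "k \<in> {1..n}" and x: "fx k = (i, j)"
  shows "vr k \<in> nbrs i j" "vr' k \<in> nbrs i j"
  using pair_ends[OF k, of "vr k"] pair_ends[OF k, of "vr' k"] unfolding x first_end_def second_end_def nbrs_def
  by (auto split: if_splits)

lemma flip_step:
  assumes X: "closed X" "delta_labels \<subseteq> X" and k: "k < n"
  shows "step r {s. flip X s \<le> enat k} {s. flip X s \<le> enat (Suc k)}"
proof -
  have K: "Suc k \<in> {1..n}" using k by simp
  obtain i j where x: "fx (Suc k) = (i, j)" by (cases "fx (Suc k)")
  define v where "v = (if Suc k \<in> X then vr' (Suc k) else vr (Suc k))"
  have fxd: "fixed r (i, j)" using domino_props(1)[OF K] x by simp
  have vv: "\<not> fixed r v" unfolding v_def using vr'_var[OF K] domino_props(2)[OF K] by simp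
  have eq: "flip X s = enat (Suc k) \<longleftrightarrow> s = (i, j) \<or> s = v" for s
  proof (cases "fixed r s")
    case True
    then show ?thesis using flip_fixed[OF True, of X] label_fixed[OF K True] x vv by auto
  next
    case False
    then show ?thesis using flip_eq_iff[OF X K False] fxd unfolding v_def by auto
  qed
  have le: "flip X s \<le> enat (Suc k) \<longleftrightarrow> flip X s \<le> enat k \<or> flip X s = enat (Suc k)" for s
    by (cases "flip X s") auto
  have n: "\<not> flip X (i, j) \<le> enat k" "\<not> flip X v \<le> enat k"
    using eq[of "(i, j)"] eq[of v] by auto
  have "fstep r {s. flip X s \<le> enat k} i j v {s. flip X s \<le> enat (Suc k)}"
    unfolding fstep_def
  proof (intro conjI)
    show "v \<in> nbrs i j" unfolding v_def using fx_nbrs[OF K x] by simp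
    show "{s. flip X s \<le> enat (Suc k)} = insert (i, j) (insert v {s. flip X s \<le> enat k})"
      using le eq by auto
  qed (use n fxd flip_ideal in auto)
  then show ?thesis by (rule stepI)
qed

lemma core_Suc: "core (r + 1) = core r \<union> delta r"
  unfolding core_def delta_def by auto

lemma flip_zero: "{s. flip X s \<le> enat 0} = core (r + 1) \<union> border"
proof -
  have "flip X s = 0 \<longleftrightarrow> s \<in> core (r + 1) \<union> border" for s
  proof (cases "fixed r s")
    case True
    then show ?thesis using flip_fixed[OF True, of X] label_0[of s] delta_var[of s] unfolding core_Suc by auto
  next
    case False
    show ?thesis
    proof (cases "label T s = 0")
      case True
      then have "lower (label T) s = 0" "upper (label T) s = 0" using lower_le[of s] label_var_0[OF False] by auto
      then have "flip X s = 0" using flip_lower_or_upper[OF False, of X] by auto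
      then show ?thesis using True label_0 unfolding core_Suc by blast
    next
      case nz: False
      then have u: "upper (label T) s \<noteq> 0" using le_upper[of s] by auto
      show ?thesis
      proof (cases "s \<in> delta r")
        case True
        then have "lower (label T) s = 0" using lower_0_delta[OF False] by simp
        moreover have "flipped X s" using True unfolding flipped_def by simp
        ultimately have "flip X s = 0" unfolding flip_def using False nz by simp
        then show ?thesis using True unfolding core_Suc by simp
      next
        case nd: False
        then have "lower (label T) s \<noteq> 0" using lower_0_delta[OF False] u by blast
        then have "flip X s \<noteq> 0" using flip_lower_or_upper[OF False, of X] u by auto
        then show ?thesis using nd nz label_0 unfolding core_Suc by blast
      qed
    qed
  qed
  then show ?thesis by (auto simp: zero_enat_def[symmetric])
qed

lemma flip_range: "flip X s \<noteq> \<infinity> \<Longrightarrow> flip X s \<le> enat n"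
proof -
  assume h: "flip X s \<noteq> \<infinity>"
  obtain i j where ij: "s = (i, j)" by (cases s)
  have "\<exists>s'. flip X s = label T s'"
    unfolding flip_def lower_def upper_def ij by (auto simp: max_def min_def)
  then show ?thesis using h range by metis
qed

end

locale tableau_pair =
  T: domino_tableau r n T + S: domino_tableau r n S for r n :: nat and T S :: tableau +
  assumes dom_eq: "dom T = dom S"
begin

text \<open>By parity \<open>S_b\<close> of the linking cycle is the variable square of a domino of
  \<open>c1\<close>. As \<open>S_f\<close> lies outside the common shape, only a moved domino of
  \<open>c2\<close> can cover it.\<close>

lemma linkedD:
  assumes c: "c1 \<in> cycles r T" "c2 \<in> cycles r T" and l: "linked r T S c1 c2"
  obtains d a t l1 l2 where "d \<in> cycles r S" "a \<in> d" "S.source a" "t \<in> d" "S.sink t" "l1 \<in> c1" "l2 \<in> c2"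
    "T.vr l1 = S.vr a" "T.vr' l2 = S.vr' t"
proof -
  obtain d where d: "d \<in> cycles r S" "open_cycle r S d" "S_b r S d \<in> squares T c1" "S_f r S d \<in> dom (MT r T c2)"
    using l unfolding linked_def by blast
  obtain a t where at: "a \<in> d" "S.source a" "t \<in> d" "S.sink t" "S_b r S d = S.vr a" "S_f r S d = S.vr' t"
    by (rule S.open_cycle_ends[OF d(1,2)])
  have U: "c1 \<subseteq> {1..n}" "c2 \<subseteq> {1..n}" using T.closed_cycles c unfolding T.closed_def by auto
  have a1: "a \<in> {1..n}" "t \<in> {1..n}" using at unfolding S.source_def S.sink_def by auto
  have "S.vr a \<noteq> T.fx l" if "l \<in> c1" for l
    using S.domino_props(2)[OF a1(1)] T.domino_props(1)[of l] that U by auto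
  then have "S.vr a \<in> T.vr ` c1" using d(3) at(5) T.squares_eq[OF U(1)] by auto
  then obtain l1 where l1: "l1 \<in> c1" "T.vr l1 = S.vr a" by auto
  have no: "S.vr' t \<notin> dom T" using S.sink_outside(1)[OF at(4)] dom_eq by blast
  have "T.fx ` c2 \<subseteq> dom T" by (rule image_subsetI, rule T.fx_dom) (use U(2) in blast)
  moreover have "T.vr ` c2 \<subseteq> dom T" by (rule image_subsetI, rule T.vr_dom) (use U(2) in blast)
  ultimately have "S.vr' t \<notin> T.fx ` c2" "S.vr' t \<notin> T.vr ` c2" using no by (meson subsetD)+
  then have "S.vr' t \<in> T.vr' ` c2" using d(4) at(6) T.MT_dom[OF U(2), of "S.vr' t"] no by auto
  then obtain l2 where l2: "l2 \<in> c2" "T.vr' l2 = S.vr' t" by auto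
  show thesis by (rule that[OF d(1) at(1-4) l1(1) l2(1) l1(2) l2(2)])
qed

lemma linkedI:
  assumes "c1 \<in> cycles r T" "c2 \<in> cycles r T" "d \<in> cycles r S" "a \<in> d" "S.source a" "t \<in> d" "S.sink t" "l1 \<in> c1" "l2 \<in> c2"
    "T.vr l1 = S.vr a" "T.vr' l2 = S.vr' t"
  shows "linked r T S c1 c2"
proof -
  have U: "c1 \<subseteq> {1..n}" "c2 \<subseteq> {1..n}" using T.closed_cycles assms(1,2) unfolding T.closed_def by auto
  note b = S.S_b_source[OF assms(3-5)] and f = S.S_f_sink[OF assms(3,6,7)]
  have "T.vr l1 \<in> squares T c1" using T.squares_eq[OF U(1)] assms(8) by auto
  moreover have "T.vr' l2 \<in> dom (MT r T c2)" using T.MT_dom[OF U(2)] assms(9) by auto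
  ultimately show ?thesis unfolding linked_def using assms(3,10,11) b f by (intro bexI[of _ d]) auto
qed

text \<open>The closure condition of \<open>extended_cycle\<close>, stated as an equivalence; in
  this form it visibly passes to complements, intersections and unions.\<close>

definition good :: "nat set \<Rightarrow> bool" where
  "good U \<longleftrightarrow> T.closed U \<and> (\<forall>c1\<in>cycles r T. \<forall>c2\<in>cycles r T. linked r T S c1 c2 \<longrightarrow> (c1 \<subseteq> U \<longleftrightarrow> c2 \<subseteq> U))"

lemma extended_cycle_eq: "extended_cycle r T S c = \<Inter>{U. good U \<and> c \<subseteq> U}"
proof -
  have a: "(\<exists>C\<subseteq>cycles r T. U = \<Union>C) \<longleftrightarrow> T.closed U" for U
    using T.closed_Union_cycles[of U] T.Union_cycles_closed by metis
  have b: "((c1 \<subseteq> U \<or> c2 \<subseteq> U) \<and> linked r T S c1 c2 \<longrightarrow> c1 \<union> c2 \<subseteq> U) \<longleftrightarrow>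
      (linked r T S c1 c2 \<longrightarrow> (c1 \<subseteq> U \<longleftrightarrow> c2 \<subseteq> U))" for c1 c2 U
    unfolding Un_subset_iff by argo
  show ?thesis unfolding extended_cycle_def good_def a b by (simp only: conj_ac)
qed

lemma good_UNIV: "good {1..n}"
proof -
  have "c \<subseteq> {1..n}" if "c \<in> cycles r T" for c using T.closed_cycles[OF that] unfolding T.closed_def by simp
  then show ?thesis unfolding good_def T.closed_def by simp
qed

lemma good_Inter:
  assumes "F \<noteq> {}" "\<And>U. U \<in> F \<Longrightarrow> good U"
  shows "good (\<Inter>F)"
proof -
  have "T.closed (\<Inter>F)" unfolding T.closed_def
  proof (intro conjI ballI impI)
    show "\<Inter>F \<subseteq> {1..n}" using assms unfolding good_def T.closed_def by blast
    fix l m assume "l \<in> {1..n}" "m \<in> {1..n}" "T.vr l = T.vr' m"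
    then have "\<And>U. U \<in> F \<Longrightarrow> l \<in> U \<longleftrightarrow> m \<in> U" using assms(2) unfolding good_def T.closed_def by blast
    then show "l \<in> \<Inter>F \<longleftrightarrow> m \<in> \<Inter>F" by blast
  qed
  moreover have "c1 \<subseteq> \<Inter>F \<longleftrightarrow> c2 \<subseteq> \<Inter>F" if "c1 \<in> cycles r T" "c2 \<in> cycles r T" "linked r T S c1 c2" for c1 c2
  proof -
    have "\<And>U. U \<in> F \<Longrightarrow> c1 \<subseteq> U \<longleftrightarrow> c2 \<subseteq> U" using assms(2) that unfolding good_def by blast
    then show ?thesis by (simp add: le_Inf_iff)
  qed
  ultimately show ?thesis unfolding good_def by blast
qed

lemma cycle_nonempty: "c \<in> cycles r T \<Longrightarrow> c \<noteq> {}"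
  unfolding cycles_def using cycle.start by blast

lemma good_compl:
  assumes "good U"
  shows "good ({1..n} - U)"
proof -
  have cl: "T.closed U" using assms unfolding good_def by simp
  have e: "c \<subseteq> {1..n} - U \<longleftrightarrow> \<not> c \<subseteq> U" if "c \<in> cycles r T" for c
    using T.cycle_dichotomy[OF that cl] cycle_nonempty[OF that] T.closed_cycles[OF that] unfolding T.closed_def by blast
  show ?thesis unfolding good_def
  proof (intro conjI ballI impI)
    show "T.closed ({1..n} - U)" by (rule T.closed_compl[OF cl])
    fix c1 c2 assume h: "c1 \<in> cycles r T" "c2 \<in> cycles r T" "linked r T S c1 c2"
    then have "c1 \<subseteq> U \<longleftrightarrow> c2 \<subseteq> U" using assms unfolding good_def by blast
    then show "c1 \<subseteq> {1..n} - U \<longleftrightarrow> c2 \<subseteq> {1..n} - U" using e h by simp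
  qed
qed

lemma extended_cycle_good: "c \<in> cycles r T \<Longrightarrow> good (extended_cycle r T S c)"
  unfolding extended_cycle_eq
proof (rule good_Inter)
  assume "c \<in> cycles r T"
  then have "c \<subseteq> {1..n}" using T.closed_cycles unfolding T.closed_def by blast
  then show "{U. good U \<and> c \<subseteq> U} \<noteq> {}" using good_UNIV by blast
qed simp

lemma good_Union_gamma: "good (\<Union>(\<gamma> r T S))"
proof -
  have g: "good E" if "E \<in> \<gamma> r T S" for E
    using that extended_cycle_good unfolding \<gamma>_def extended_cycles_def by blast
  have "T.closed (\<Union>(\<gamma> r T S))" unfolding T.closed_def
  proof (intro conjI ballI impI)
    show "\<Union>(\<gamma> r T S) \<subseteq> {1..n}" using g unfolding good_def T.closed_def by blast
    fix l m assume "l \<in> {1..n}" "m \<in> {1..n}" "T.vr l = T.vr' m"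
    then have "\<And>U. U \<in> \<gamma> r T S \<Longrightarrow> l \<in> U \<longleftrightarrow> m \<in> U" using g unfolding good_def T.closed_def by blast
    then show "l \<in> \<Union>(\<gamma> r T S) \<longleftrightarrow> m \<in> \<Union>(\<gamma> r T S)" by blast
  qed
  moreover have "c1 \<subseteq> \<Union>(\<gamma> r T S) \<longleftrightarrow> c2 \<subseteq> \<Union>(\<gamma> r T S)"
    if h: "c1 \<in> cycles r T" "c2 \<in> cycles r T" "linked r T S c1 c2" for c1 c2
  proof -
    have e: "c \<subseteq> \<Union>(\<gamma> r T S) \<longleftrightarrow> (\<exists>E\<in>\<gamma> r T S. c \<subseteq> E)" if c: "c \<in> cycles r T" for c
    proof
      assume s: "c \<subseteq> \<Union>(\<gamma> r T S)"
      obtain k where "k \<in> c" using cycle_nonempty[OF c] by blast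
      then obtain E where E: "E \<in> \<gamma> r T S" "k \<in> E" using s by blast
      then have "c \<subseteq> E" using T.cycle_dichotomy[OF c, of E] g[OF E(1)] \<open>k \<in> c\<close> unfolding good_def by blast
      then show "\<exists>E\<in>\<gamma> r T S. c \<subseteq> E" using E by blast
    qed blast
    have "\<And>E. E \<in> \<gamma> r T S \<Longrightarrow> c1 \<subseteq> E \<longleftrightarrow> c2 \<subseteq> E" using g h unfolding good_def by blast
    then show ?thesis using e h by simp
  qed
  ultimately show ?thesis unfolding good_def by blast
qed

lemma delta_labels_gamma: "T.delta_labels \<subseteq> \<Union>(\<gamma> r T S)"
proof
  fix k assume "k \<in> T.delta_labels"
  then have k: "k \<in> {1..n}" "supp T k \<inter> delta r \<noteq> {}" unfolding T.delta_labels_def by auto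
  let ?E = "extended_cycle r T S (cycle r T k)"
  have c: "cycle r T k \<in> cycles r T" using k T.cycles_eq by blast
  have kE: "k \<in> ?E" unfolding extended_cycle_eq using cycle.start[of k r T] by blast
  then have "squares T ?E \<inter> delta r \<noteq> {}" using k(2) unfolding squares_def by blast
  then have "?E \<in> \<gamma> r T S" unfolding \<gamma>_def extended_cycles_def using c by blast
  then show "k \<in> \<Union>(\<gamma> r T S)" using kE by blast
qed

text \<open>Each extended cycle through \<open>delta r\<close> contains a label of \<open>W\<close>.
  If its generating cycle were not in \<open>W\<close>, the good complement of \<open>W\<close>
  would contain the whole extended cycle.\<close>

lemma gamma_least:
  assumes W: "good W" "T.delta_labels \<subseteq> W"
  shows "\<Union>(\<gamma> r T S) \<subseteq> W"
proof (rule Union_least)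
  fix E assume "E \<in> \<gamma> r T S"
  then obtain c where c: "c \<in> cycles r T" "E = extended_cycle r T S c" "squares T E \<inter> delta r \<noteq> {}"
    unfolding \<gamma>_def extended_cycles_def by blast
  obtain l where l: "l \<in> E" "supp T l \<inter> delta r \<noteq> {}" using c(3) unfolding squares_def by blast
  have "E \<subseteq> {1..n}" using extended_cycle_good[OF c(1)] c(2) unfolding good_def T.closed_def by blast
  then have "l \<in> T.delta_labels" using l unfolding T.delta_labels_def by blast
  then have lW: "l \<in> W" using W by blast
  have cl: "T.closed W" using W unfolding good_def by simp
  have sub: "E \<subseteq> V" if "good V" "c \<subseteq> V" for V using that unfolding c(2) extended_cycle_eq by blast
  have "c \<subseteq> W"
  proof (rule ccontr)
    assume "\<not> c \<subseteq> W"
    then have "c \<subseteq> {1..n} - W"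
      using T.cycle_dichotomy[OF c(1) cl] T.closed_cycles[OF c(1)] unfolding T.closed_def by blast
    then have "E \<subseteq> {1..n} - W" by (rule sub[OF good_compl[OF W(1)]])
    then show False using l lW by blast
  qed
  then show "E \<subseteq> W" by (rule sub[OF W(1)])
qed

end

section \<open>Comparing the two ranks\<close>

lemma min_eq_infinity: "min (a :: enat) b = \<infinity> \<longleftrightarrow> a = \<infinity> \<and> b = \<infinity>"
  by (cases a; cases b) auto

lemma max_eq_infinity: "max (a :: enat) b = \<infinity> \<longleftrightarrow> a = \<infinity> \<or> b = \<infinity>"
  by (cases a; cases b) auto

lemma label_eq_infinity: "label T s = \<infinity> \<longleftrightarrow> s \<notin> dom T \<union> border"
  using label_inside[of s T] label_border[of s T] by (cases "s \<in> border"; cases "T s") auto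

lemma (in labelling) value_ex: "lab s \<noteq> 0 \<Longrightarrow> lab s \<noteq> \<infinity> \<Longrightarrow> \<exists>k\<in>{1..n}. lab s = enat k"
  by (rule value_cases[of s]) auto

locale relabelled =
  domino_tableau r n T + L': labelling r n l' for r n :: nat and T :: tableau and l' :: "square \<Rightarrow> enat" +
  assumes agree: "\<And>s. fixed r s \<Longrightarrow> label T s = l' s"
begin

definition moved :: "nat set" where
  "moved = {k \<in> {1..n}. L'.vr k \<noteq> vr k}"

lemma lower_agree: "\<not> fixed r s \<Longrightarrow> lower (label T) s = lower l' s"
  and upper_agree: "\<not> fixed r s \<Longrightarrow> upper (label T) s = upper l' s"
  using agree by (cases s; auto simp: lower_def upper_def)+

lemma fx_agree: "k \<in> {1..n} \<Longrightarrow> L'.fx k = fx k"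
  using label_fixed[of k "L'.fx k"] L'.domino_props(1)[of k] agree[of "L'.fx k"] L'.label_fx[of k] by simp

lemma vr_agree: "k \<in> {1..n} \<Longrightarrow> L'.vr k = vr k \<or> L'.vr k = vr' k"
proof -
  assume k: "k \<in> {1..n}"
  have s: "\<not> fixed r (L'.vr k)" by (rule L'.domino_props(2)[OF k])
  show ?thesis using pair_iff[OF k s] L'.pair_iff[OF k s] lower_agree[OF s] upper_agree[OF s] by simp
qed

text \<open>If \<open>k\<close> stays, its label is absent from \<open>vr' k\<close> in both
  labellings, so both take the other one of the two common values \<open>lower\<close> and
  \<open>upper\<close>. Applied to the square shared by two dominoes, this makes
  \<open>moved\<close> closed.\<close>

lemma moved_iff:
  assumes k: "k \<in> {1..n}" and s: "s = vr k \<or> s = vr' k"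
  shows "k \<in> moved \<longleftrightarrow> l' s \<noteq> label T s"
proof -
  have sv: "\<not> fixed r s" using s domino_props(2)[OF k] vr'_var[OF k] by auto
  have l'v: "l' s = enat k \<longleftrightarrow> s = L'.vr k" by (rule L'.label_var[OF k sv])
  have lv: "label T s = enat k \<longleftrightarrow> s = vr k" by (rule label_var[OF k sv])
  show ?thesis
  proof (cases "s = vr k")
    case True
    then show ?thesis using l'v lv k unfolding moved_def by auto
  next
    case False
    then have s': "s = vr' k" using s by simp
    show ?thesis
    proof (cases "k \<in> moved")
      case True
      then have "L'.vr k = s" using vr_agree[OF k] s' unfolding moved_def by auto
      then show ?thesis using l'v lv False True by auto
    next
      case nm: False
      then have "L'.vr k = vr k" using k unfolding moved_def by simp
      then have "l' s \<noteq> enat k" "label T s \<noteq> enat k" using l'v lv False by auto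
      moreover have "lower (label T) s = enat k \<or> upper (label T) s = enat k" using pair_iff[OF k sv] s by simp
      moreover have "l' s = lower (label T) s \<or> l' s = upper (label T) s"
        using L'.label_lower_or_upper[OF sv] lower_agree[OF sv] upper_agree[OF sv] by simp
      ultimately have "l' s = label T s" using label_lower_or_upper[OF sv] by auto
      then show ?thesis using nm by simp
    qed
  qed
qed

lemma moved_closed: "closed moved"
  unfolding closed_def
proof (intro conjI ballI impI)
  show "moved \<subseteq> {1..n}" unfolding moved_def by auto
  fix l m assume h: "l \<in> {1..n}" "m \<in> {1..n}" "vr l = vr' m"
  show "l \<in> moved \<longleftrightarrow> m \<in> moved"
    using moved_iff[OF h(1), of "vr l"] moved_iff[OF h(2), of "vr l"] h(3) by auto
qed

end

lemma minimalD:
  assumes "minimal r N E P P'" "twin_path r N P g" "g 0 = E" "g N = E" "t \<le> N"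
  shows "flips (P t) (P' t) \<subseteq> flips (P t) (g t)"
  using assms unfolding minimal_def by blast

text \<open>Reversal exchanges the roles of \<open>T\<close> and \<open>S\<close>, so the second
  tableau needs no separate argument.\<close>

lemma minimal_rev:
  assumes "minimal r N E P P'"
  shows "minimal r N E (\<lambda>t. P (N - t)) (\<lambda>t. P' (N - t))"
proof -
  have rev: "twin_path r N (\<lambda>t. P (N - t)) (\<lambda>t. g (N - t))" if h: "twin_path r N P g" for P g
    unfolding twin_path_def
  proof (intro conjI allI impI)
    fix t show "twin r (P (N - t)) (g (N - t))" using h unfolding twin_path_def by simp
  next
    fix t assume t: "t < N"
    then have "adj r (g (N - Suc t)) (g (Suc (N - Suc t)))" using h unfolding twin_path_def by simp
    moreover have "Suc (N - Suc t) = N - t" using t by simp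
    ultimately show "adj r (g (N - t)) (g (N - Suc t))" unfolding adj_def by auto
  qed
  have m: "twin_path r N P P'" "P' 0 = E" "P' N = E" and
    mn: "\<And>g t. twin_path r N P g \<Longrightarrow> g 0 = E \<Longrightarrow> g N = E \<Longrightarrow> t \<le> N \<Longrightarrow> flips (P t) (P' t) \<subseteq> flips (P t) (g t)"
    using assms unfolding minimal_def by blast+
  show ?thesis unfolding minimal_def
  proof (intro conjI allI impI)
    show "twin_path r N (\<lambda>t. P (N - t)) (\<lambda>t. P' (N - t))" by (rule rev[OF m(1)])
    show "P' (N - 0) = E" "P' (N - N) = E" using m by auto
    fix g t assume g: "twin_path r N (\<lambda>t. P (N - t)) g" "g 0 = E" "g N = E" and t: "t \<le> N"
    have "twin_path r N (\<lambda>t. P (N - (N - t))) (\<lambda>t. g (N - t))" by (rule rev[OF g(1)])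
    then have "twin_path r N P (\<lambda>t. g (N - t))" unfolding twin_path_def by simp
    from mn[OF this, of "N - t"] show "flips (P (N - t)) (P' (N - t)) \<subseteq> flips (P (N - t)) (g t)"
      using g t by simp
  qed
qed

lemma minimal_cong:
  assumes m: "minimal r N E P Q" and e: "\<And>t. t \<le> N \<Longrightarrow> P t = P' t" "\<And>t. t \<le> N \<Longrightarrow> Q t = Q' t"
  shows "minimal r N E P' Q'"
proof -
  have t: "twin_path r N P' g" if "twin_path r N P h" "\<And>t. t \<le> N \<Longrightarrow> h t = g t" for g h
    using that e unfolding twin_path_def by simp
  have t': "twin_path r N P g" if "twin_path r N P' g" for g
    using that e unfolding twin_path_def by simp
  have p: "twin_path r N P Q" "Q 0 = E" "Q N = E" using m unfolding minimal_def by auto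
  show ?thesis unfolding minimal_def
  proof (intro conjI allI impI)
    show "twin_path r N P' Q'" by (rule t[OF p(1) e(2)])
    show "Q' 0 = E" "Q' N = E" using p e(2)[of 0] e(2)[of N] by auto
    fix g u assume g: "twin_path r N P' g" "g 0 = E" "g N = E" "u \<le> N"
    show "flips (P' u) (Q' u) \<subseteq> flips (P' u) (g u)"
      using minimalD[OF m t'[OF g(1)] g(2,3,4)] e(1)[OF g(4)] e(2)[OF g(4)] by simp
  qed
qed

locale rank_shift =
  tableau_pair r n T S for r n :: nat and T S :: tableau +
  fixes T' S' :: tableau
  assumes T': "wf_tab (r + 1) T'" "labels T' = {1..n}" and S': "wf_tab (r + 1) S'" "labels S' = {1..n}"
    and dom_eq': "dom T' = dom S'"
    and minimal: "minimal r (2 * n) (core (r + 1) \<union> border) (\<lambda>t. if t \<le> n then sub T t else sub S (2 * n - t))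
      (\<lambda>t. if t \<le> n then sub T' t else sub S' (2 * n - t))"
begin

lemma twin_sub: "k \<le> n \<Longrightarrow> twin r (sub T k) (sub T' k)" "k < n \<Longrightarrow> twin r (sub S k) (sub S' k)"
proof -
  have tw: "twin r (if t \<le> n then sub T t else sub S (2 * n - t)) (if t \<le> n then sub T' t else sub S' (2 * n - t))"
    if t: "t \<le> 2 * n" for t
    using conjunct1[OF conjunct1[OF minimal[unfolded minimal_def twin_path_def]], rule_format, OF t] .
  show "k \<le> n \<Longrightarrow> twin r (sub T k) (sub T' k)" using tw[of k] by simp
  show "twin r (sub S k) (sub S' k)" if k: "k < n"
  proof -
    have "\<not> 2 * n - k \<le> n" "2 * n - (2 * n - k) = k" using k by auto
    then show ?thesis using tw[of "2 * n - k"] by simp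
  qed
qed

lemma sub_n: "sub T n = dom T \<union> border" "sub S n = dom T \<union> border" "sub T' n = dom T' \<union> border" "sub S' n = dom T' \<union> border"
proof -
  have top: "sub A n = dom A \<union> border" if l: "labels A = {1..n}" for A
  proof (rule sub_top)
    fix s k assume "A s = Some k"
    then have "k = 0 \<or> k \<in> labels A" unfolding labels_def by (auto intro: ranI)
    then show "k \<le> n" using l by auto
  qed
  show "sub T n = dom T \<union> border" "sub S n = dom T \<union> border" "sub T' n = dom T' \<union> border" "sub S' n = dom T' \<union> border"
    using top[OF T.labels] top[OF S.labels] top[OF T'(2)] top[OF S'(2)] dom_eq dom_eq' by simp_all
qed

lemma twin_sub_S: "k \<le> n \<Longrightarrow> twin r (sub S k) (sub S' k)"
  using twin_sub(2)[of k] twin_sub(1)[of n] sub_n by (cases "k = n") auto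

lemma agree_aux:
  assumes A: "labelling r n (label A)" and B: "labelling r n (label B)"
    and t: "\<And>k. k \<le> n \<Longrightarrow> twin r (sub A k) (sub B k)" and s: "fixed r s"
  shows "label A s = label B s"
proof -
  interpret A: labelling r n "label A" by fact
  interpret B: labelling r n "label B" by fact
  have e: "label A s \<le> enat k \<longleftrightarrow> label B s \<le> enat k" if "k \<le> n" for k
    using twinD[OF t[OF that] s] unfolding sub_def by simp
  show ?thesis
  proof (rule antisym)
    show "label A s \<le> label B s"
    proof (cases "label B s")
      case (enat k)
      then have "k \<le> n" using B.range[of s] by simp
      then show ?thesis using e[of k] enat by simp
    qed simp
    show "label B s \<le> label A s"
    proof (cases "label A s")
      case (enat k)
      then have "k \<le> n" using A.range[of s] by simp
      then show ?thesis using e[of k] enat by simp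
    qed simp
  qed
qed

lemma lab_T': "labelling r n (label T')" by (rule labelling_label[OF T'])
lemma lab_S': "labelling r n (label S')" by (rule labelling_label[OF S'])

sublocale TT: relabelled r n T "label T'"
proof -
  interpret labelling r n "label T'" by (rule lab_T')
  show "relabelled r n T (label T')"
    by unfold_locales (rule agree_aux[OF T.labelling_axioms lab_T' twin_sub(1)])
qed

sublocale SS: relabelled r n S "label S'"
proof -
  interpret labelling r n "label S'" by (rule lab_S')
  show "relabelled r n S (label S')"
    by unfold_locales (rule agree_aux[OF S.labelling_axioms lab_S' twin_sub_S])
qed

lemma label_inf_iff: "label T s = \<infinity> \<longleftrightarrow> label S s = \<infinity>"
  using T.label_infinity S.label_infinity dom_eq by simp

lemma label_inf_iff': "label T' s = \<infinity> \<longleftrightarrow> label S' s = \<infinity>"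
  using label_eq_infinity[of T' s] label_eq_infinity[of S' s] dom_eq' by simp

lemma upper_inf_iff: "upper (label T) s = \<infinity> \<longleftrightarrow> upper (label S) s = \<infinity>"
  using label_inf_iff by (cases s) (simp add: upper_def min_eq_infinity)

lemma lower_inf_iff: "lower (label T) s = \<infinity> \<longleftrightarrow> lower (label S) s = \<infinity>"
  using label_inf_iff by (cases s) (simp add: lower_def max_eq_infinity)

lemma delta_zero: "s \<in> delta r \<Longrightarrow> label T' s = 0 \<and> label S' s = 0"
proof -
  assume "s \<in> delta r"
  then have "s \<in> core (r + 1)" using T.core_Suc by blast
  then have "s \<in> sub T' 0" "s \<in> sub S' 0" using T'(1) S'(1) unfolding wf_tab_def by auto
  then show ?thesis unfolding sub_def by (simp add: zero_enat_def[symmetric])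
qed

lemma delta_nonzero: "s \<in> delta r \<Longrightarrow> label T s \<noteq> 0 \<and> label S s \<noteq> 0"
  using T.label_0 S.label_0 unfolding core_def border_def delta_def by auto

text \<open>At the two ends of a cycle of \<open>S\<close>, whether the domino moved can be read off
  from the common shape of \<open>T'\<close> and \<open>S'\<close> or from \<open>delta r\<close>.
  Both are the same for \<open>T\<close> and \<open>S\<close>, and the cycle of \<open>S\<close>
  carries the answer from one end to the other.\<close>

lemma good_moved: "good TT.moved"
  unfolding good_def
proof (intro conjI ballI impI)
  show "T.closed TT.moved" by (rule TT.moved_closed)
  fix c1 c2 assume c: "c1 \<in> cycles r T" "c2 \<in> cycles r T" and "linked r T S c1 c2"
  then obtain d a t l1 l2 where d: "d \<in> cycles r S" "a \<in> d" "S.source a" "t \<in> d" "S.sink t" "l1 \<in> c1" "l2 \<in> c2"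
    "T.vr l1 = S.vr a" "T.vr' l2 = S.vr' t" by (rule linkedD)
  have U: "c1 \<subseteq> {1..n}" "c2 \<subseteq> {1..n}" using T.closed_cycles c unfolding T.closed_def by auto
  have i: "l1 \<in> {1..n}" "l2 \<in> {1..n}" "a \<in> {1..n}" "t \<in> {1..n}"
    using U d unfolding S.source_def S.sink_def by auto
  have 1: "l1 \<in> TT.moved \<longleftrightarrow> a \<in> SS.moved"
  proof -
    let ?s = "S.vr a"
    have m: "l1 \<in> TT.moved \<longleftrightarrow> label T' ?s \<noteq> label T ?s" "a \<in> SS.moved \<longleftrightarrow> label S' ?s \<noteq> label S ?s"
      using TT.moved_iff[OF i(1), of ?s] SS.moved_iff[OF i(3), of ?s] d(8) by auto
    show ?thesis
    proof (cases "?s \<in> delta r")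
      case True then show ?thesis using m delta_zero[OF True] delta_nonzero[OF True] by simp
    next
      case False
      \<comment> \<open>Outside \<open>delta r\<close> the square of a source is followed only by
        squares outside the diagram, so it either keeps its label or leaves the diagram.\<close>
      then have u: "upper (label S) ?s = \<infinity>" using S.source_cases[OF d(3)] by blast
      then have uT: "upper (label T) ?s = \<infinity>" using upper_inf_iff by simp
      have sv: "\<not> fixed r ?s" by (rule S.domino_props(2)[OF i(3)])
      have l: "label T ?s = enat l1" "label S ?s = enat a" using T.label_vr[OF i(1)] S.label_vr[OF i(3)] d(8) by auto
      have lT: "lower (label T) ?s = label T ?s" "lower (label S) ?s = label S ?s"
        using T.label_lower_or_upper[OF sv] S.label_lower_or_upper[OF sv] u uT l by auto
      have "label T' ?s = label T ?s \<or> label T' ?s = \<infinity>"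
        using TT.L'.label_lower_or_upper[OF sv] TT.lower_agree[OF sv] TT.upper_agree[OF sv] uT lT by simp
      moreover have "label S' ?s = label S ?s \<or> label S' ?s = \<infinity>"
        using SS.L'.label_lower_or_upper[OF sv] SS.lower_agree[OF sv] SS.upper_agree[OF sv] u lT by simp
      ultimately show ?thesis using m l label_inf_iff'[of ?s] by auto
    qed
  qed
  have 2: "l2 \<in> TT.moved \<longleftrightarrow> t \<in> SS.moved"
  proof -
    let ?s = "S.vr' t"
    have m: "l2 \<in> TT.moved \<longleftrightarrow> label T' ?s \<noteq> label T ?s" "t \<in> SS.moved \<longleftrightarrow> label S' ?s \<noteq> label S ?s"
      using TT.moved_iff[OF i(2), of ?s] SS.moved_iff[OF i(4), of ?s] d(9) by auto
    have "label S ?s = \<infinity>" using S.sink_outside(1)[OF d(5)] S.label_infinity by blast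
    then show ?thesis using m label_inf_iff[of ?s] label_inf_iff'[of ?s] by simp
  qed
  have 3: "a \<in> SS.moved \<longleftrightarrow> t \<in> SS.moved" using S.cycle_dichotomy[OF d(1) SS.moved_closed] d by blast
  have "c1 \<subseteq> TT.moved \<longleftrightarrow> l1 \<in> TT.moved" "c2 \<subseteq> TT.moved \<longleftrightarrow> l2 \<in> TT.moved"
    using T.cycle_dichotomy[OF c(1) TT.moved_closed] T.cycle_dichotomy[OF c(2) TT.moved_closed] d(6,7) by blast+
  then show "c1 \<subseteq> TT.moved \<longleftrightarrow> c2 \<subseteq> TT.moved" using 1 2 3 by blast
qed

lemma delta_moved: "T.delta_labels \<subseteq> TT.moved"
proof
  fix k assume "k \<in> T.delta_labels"
  then have k: "k \<in> {1..n}" "supp T k \<inter> delta r \<noteq> {}" unfolding T.delta_labels_def by auto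
  have d: "T.vr k \<in> delta r" by (rule T.delta_source(2)[OF k])
  then show "k \<in> TT.moved" using TT.moved_iff[OF k(1), of "T.vr k"] delta_zero[OF d] delta_nonzero[OF d] by simp
qed

definition X :: "nat set" where
  "X = \<Union>(\<gamma> r T S)"

lemma good_X: "good X"
  unfolding X_def by (rule good_Union_gamma)

text \<open>The union of the cycles of \<open>S\<close> that correspond to \<open>X\<close>.\<close>

definition Y :: "nat set" where
  "Y = {l \<in> {1..n}. \<exists>a\<in>cycle r S l. S.source a \<and> (\<exists>k\<in>X. T.vr k = S.vr a)}"

lemma X_props: "T.closed X" "T.delta_labels \<subseteq> X" "X \<subseteq> {1..n}"
  using good_X delta_labels_gamma unfolding good_def T.closed_def X_def by auto

lemma cycle_S: "l \<in> {1..n} \<Longrightarrow> cycle r S l \<in> cycles r S" and cycle_T: "l \<in> {1..n} \<Longrightarrow> cycle r T l \<in> cycles r T"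
  using S.cycles_eq T.cycles_eq by blast+

lemma Y_closed: "S.closed Y"
  unfolding S.closed_def
proof (intro conjI ballI impI)
  show "Y \<subseteq> {1..n}" unfolding Y_def by blast
  fix l m assume h: "l \<in> {1..n}" "m \<in> {1..n}" "S.vr l = S.vr' m"
  have "l \<in> cycle r S m" using S.cycle_closed[OF h(2)] cycle.start[of m r S] h unfolding S.closed_def by blast
  then have "cycle r S m = cycle r S l" by (rule S.cycles_eqI[OF cycle_S[OF h(2)]])
  then show "l \<in> Y \<longleftrightarrow> m \<in> Y" unfolding Y_def using h by simp
qed

lemma delta_Y: "S.delta_labels \<subseteq> Y"
proof
  fix l assume "l \<in> S.delta_labels"
  then have l: "l \<in> {1..n}" "supp S l \<inter> delta r \<noteq> {}" unfolding S.delta_labels_def by auto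
  have d: "S.source l" "S.vr l \<in> delta r" by (rule S.delta_source[OF l])+
  have "label T (S.vr l) \<noteq> \<infinity>" using label_inf_iff[of "S.vr l"] S.label_vr[OF l(1)] by simp
  then obtain k where k: "k \<in> {1..n}" "label T (S.vr l) = enat k"
    using T.value_ex[of "S.vr l"] delta_nonzero[OF d(2)] by blast
  then have e: "S.vr l = T.vr k" using T.label_var S.domino_props(2)[OF l(1)] by blast
  have "k \<in> T.delta_labels" unfolding T.delta_labels_def using k(1) T.supp_eq[OF k(1)] d(2) e by auto
  then have "k \<in> X" using X_props by blast
  then show "l \<in> Y" unfolding Y_def using l(1) d(1) e[symmetric] cycle.start[of l r S] by blast
qed

lemma Y_iff:
  assumes l: "l \<in> {1..n}" and a: "a \<in> cycle r S l" "S.source a" and k: "k \<in> {1..n}" "T.vr k = S.vr a"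
  shows "l \<in> Y \<longleftrightarrow> k \<in> X"
proof
  assume "k \<in> X" then show "l \<in> Y" unfolding Y_def using l a k(2) by blast
next
  assume "l \<in> Y"
  then obtain b m where b: "b \<in> cycle r S l" "S.source b" "m \<in> X" "T.vr m = S.vr b" unfolding Y_def by blast
  have "b = a" by (rule S.source_unique[OF cycle_S[OF l] b(1,2) a])
  then have "m = k" using inj_onD[OF T.vr_inj, of m k] b k X_props(3) by auto
  then show "k \<in> X" using b by simp
qed

text \<open>Only squares with finite \<open>lower\<close> and infinite \<open>upper\<close> can
  enter or leave the final shape. Off \<open>delta r\<close>, such a square inside the shape is a
  source, where \<open>Y\<close> copies \<open>X\<close> by definition; one outside is a sink, where
  goodness of \<open>X\<close> gives the agreement.\<close>

lemma flipped_agree: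
  assumes s: "\<not> fixed r s" and u: "upper (label T) s = \<infinity>" and lo: "lower (label T) s \<noteq> \<infinity>"
  shows "T.flipped X s \<longleftrightarrow> S.flipped Y s"
proof (cases "s \<in> delta r")
  case True then show ?thesis unfolding T.flipped_def S.flipped_def by simp
next
  case False
  have uS: "upper (label S) s = \<infinity>" and loS: "lower (label S) s \<noteq> \<infinity>" using u lo upper_inf_iff lower_inf_iff by auto
  have "lower (label T) s \<noteq> 0" "lower (label S) s \<noteq> 0"
    using T.lower_0_delta[OF s] S.lower_0_delta[OF s] False u uS by auto
  moreover have "\<exists>s'. lower (label A) s = label A s'" for A :: tableau by (cases s) (auto simp: lower_def max_def)
  ultimately have "\<exists>k\<in>{1..n}. lower (label T) s = enat k" "\<exists>k\<in>{1..n}. lower (label S) s = enat k"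
    using T.value_ex S.value_ex lo loS by metis+
  then obtain k l where k: "k \<in> {1..n}" "lower (label T) s = enat k" and l: "l \<in> {1..n}" "lower (label S) s = enat l"
    by blast
  have fT: "T.flipped X s \<longleftrightarrow> k \<in> X" by (rule T.flipped_iff[OF X_props(1,2) k(1) s]) (simp add: k)
  have fS: "S.flipped Y s \<longleftrightarrow> l \<in> Y" by (rule S.flipped_iff[OF Y_closed delta_Y l(1) s]) (simp add: l)
  have pT: "s = T.vr k \<or> s = T.vr' k" using T.pair_iff[OF k(1) s] k by simp
  have pS: "s = S.vr l \<or> s = S.vr' l" using S.pair_iff[OF l(1) s] l by simp
  have oS: "m = l" if "m \<in> {1..n}" "s = S.vr m \<or> s = S.vr' m" for m
    using S.pair_iff[OF that(1) s] that(2) uS l by simp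
  show ?thesis
  proof (cases "label T s = \<infinity>")
    case False
    then have nS: "label S s \<noteq> \<infinity>" using label_inf_iff by simp
    have "label T s = enat k" "label S s = enat l"
      using T.label_lower_or_upper[OF s] S.label_lower_or_upper[OF s] False nS u uS k l by auto
    then have e: "s = T.vr k" "s = S.vr l" using T.label_var[OF k(1) s] S.label_var[OF l(1) s] by auto
    have "S.source l" unfolding S.source_def
    proof (intro conjI notI)
      assume "S.vr l \<in> S.vr' ` {1..n}"
      then obtain m where m: "m \<in> {1..n}" "s = S.vr' m" using e by auto
      then have "m = l" using oS by blast
      then show False using m e S.vr'_neq[OF l(1)] by simp
    qed (rule l(1))
    then have "l \<in> Y \<longleftrightarrow> k \<in> X" using Y_iff[OF l(1) cycle.start _ k(1)] e by simp
    then show ?thesis using fT fS by simp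
  next
    case True
    then have iS: "label S s = \<infinity>" using label_inf_iff by simp
    have e: "s = T.vr' k" "s = S.vr' l" using pT pS True iS T.label_vr[OF k(1)] S.label_vr[OF l(1)] by auto
    have sk: "S.sink l" unfolding S.sink_def
    proof (intro conjI notI)
      assume "S.vr' l \<in> S.vr ` {1..n}"
      then obtain m where "m \<in> {1..n}" "s = S.vr m" using e by auto
      then show False using S.label_vr[of m] iS by simp
    qed (rule l(1))
    have c: "cycle r S l \<in> cycles r S" by (rule cycle_S[OF l(1)])
    have ls: "l \<in> cycle r S l" by (rule cycle.start)
    obtain a where a: "a \<in> cycle r S l" "S.source a" using S.source_sink_exist[OF c] ls sk by blast
    have a1: "a \<in> {1..n}" using a(2) unfolding S.source_def by simp
    have "label T (S.vr a) \<noteq> \<infinity>" using label_inf_iff[of "S.vr a"] S.label_vr[OF a1] by simp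
    moreover have "label T (S.vr a) \<noteq> 0"
      using T.label_0[of "S.vr a"] S.label_0[of "S.vr a"] S.label_vr[OF a1] a1 by (auto simp: zero_enat_def)
    ultimately obtain m where m: "m \<in> {1..n}" "label T (S.vr a) = enat m" using T.value_ex[of "S.vr a"] by blast
    then have em: "T.vr m = S.vr a" using T.label_var[OF m(1) S.domino_props(2)[OF a1]] by simp
    \<comment> \<open>The cycle of \<open>S\<close> joins its source square, covered in
      \<open>T\<close> by \<open>m\<close>, to its sink square, to which \<open>k\<close> moves in
      \<open>T\<close>.\<close>
    have "linked r T S (cycle r T m) (cycle r T k)"
      by (rule linkedI[OF cycle_T[OF m(1)] cycle_T[OF k(1)] c a ls sk cycle.start cycle.start em]) (use e in simp)
    then have "cycle r T m \<subseteq> X \<longleftrightarrow> cycle r T k \<subseteq> X"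
      using good_X cycle_T[OF m(1)] cycle_T[OF k(1)] unfolding good_def by blast
    moreover have "cycle r T x \<subseteq> X \<longleftrightarrow> x \<in> X" if "x \<in> {1..n}" for x
      using T.cycle_subset[OF X_props(1), of x] cycle.start[of x r T] by blast
    ultimately have "m \<in> X \<longleftrightarrow> k \<in> X" using m(1) k(1) by simp
    then show ?thesis using fT fS Y_iff[OF l(1) a m(1) em] by simp
  qed
qed

lemma flip_inf_iff: "T.flip X s = \<infinity> \<longleftrightarrow> S.flip Y s = \<infinity>"
proof (cases "fixed r s")
  case True then show ?thesis using T.flip_fixed[OF True] S.flip_fixed[OF True] label_inf_iff by simp
next
  case s: False
  note bT = T.flip_bounds[OF s, of X] and bS = S.flip_bounds[OF s, of Y]
  show ?thesis
  proof (cases "upper (label T) s = \<infinity>")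
    case False
    then have "upper (label S) s \<noteq> \<infinity>" using upper_inf_iff by simp
    then show ?thesis using False bT bS by (metis enat_ord_simps(5))
  next
    case u: True
    then have uS: "upper (label S) s = \<infinity>" using upper_inf_iff by simp
    show ?thesis
    proof (cases "lower (label T) s = \<infinity>")
      case True
      then have "lower (label S) s = \<infinity>" using lower_inf_iff by simp
      then show ?thesis using True bT bS by simp
    next
      case lo: False
      then have loS: "lower (label S) s \<noteq> \<infinity>" using lower_inf_iff by simp
      have f: "T.flipped X s \<longleftrightarrow> S.flipped Y s" by (rule flipped_agree[OF s u lo])
      have "T.flip X s = \<infinity> \<longleftrightarrow> (T.flipped X s \<longleftrightarrow> label T s \<noteq> \<infinity>)"
        unfolding T.flip_def using s u lo T.label_lower_or_upper[OF s] by auto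
      moreover have "S.flip Y s = \<infinity> \<longleftrightarrow> (S.flipped Y s \<longleftrightarrow> label S s \<noteq> \<infinity>)"
        unfolding S.flip_def using s uS loS S.label_lower_or_upper[OF s] by auto
      ultimately show ?thesis using f label_inf_iff[of s] by simp
    qed
  qed
qed

lemma flip_top: "{s. T.flip X s \<le> enat n} = {s. S.flip Y s \<le> enat n}"
proof -
  have "T.flip X s \<le> enat n \<longleftrightarrow> T.flip X s \<noteq> \<infinity>" for s using T.flip_range[of X s] by (metis enat_ord_simps(5) infinity_ne_i1 enat.distinct(1))
  moreover have "S.flip Y s \<le> enat n \<longleftrightarrow> S.flip Y s \<noteq> \<infinity>" for s using S.flip_range[of Y s] by (metis enat_ord_simps(5) infinity_ne_i1 enat.distinct(1))
  ultimately show ?thesis using flip_inf_iff by simp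
qed

text \<open>Moving through \<open>X\<close> and \<open>Y\<close> yields a competitor of the minimal
  path, so whatever the passage to rank \<open>r + 1\<close> flips is flipped by \<open>X\<close>
  too.\<close>

lemma moved_subset: "TT.moved \<subseteq> X"
proof -
  let ?P = "\<lambda>t. if t \<le> n then sub T t else sub S (2 * n - t)"
  let ?P' = "\<lambda>t. if t \<le> n then sub T' t else sub S' (2 * n - t)"
  define g where "g t = (if t \<le> n then {s. T.flip X s \<le> enat t} else {s. S.flip Y s \<le> enat (2 * n - t)})" for t
  have "twin_path r (2 * n) ?P g" unfolding twin_path_def
  proof (intro conjI allI impI)
    fix t assume "t \<le> 2 * n"
    have 1: "twin r (sub T t) {s. T.flip X s \<le> enat t}" for t
      unfolding twin_def sub_def using T.ideals T.flip_ideal T.flip_fixed by simp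
    have 2: "twin r (sub S t) {s. S.flip Y s \<le> enat t}" for t
      unfolding twin_def sub_def using S.ideals S.flip_ideal S.flip_fixed by simp
    show "twin r (?P t) (g t)" unfolding g_def using 1 2 by simp
  next
    fix t assume t: "t < 2 * n"
    show "adj r (g t) (g (Suc t))"
    proof (cases "t < n")
      case True
      then show ?thesis unfolding g_def using T.flip_step[OF X_props(1,2) True] by (simp add: adjI)
    next
      case False
      define q where "q = 2 * n - Suc t"
      have q: "q < n" "2 * n - t = Suc q" "2 * n - Suc t = q" using False t unfolding q_def by auto
      have st: "step r {s. S.flip Y s \<le> enat q} {s. S.flip Y s \<le> enat (Suc q)}" by (rule S.flip_step[OF Y_closed delta_Y q(1)])
      \<comment> \<open>At \<open>t = n\<close> the definition of \<open>g\<close> uses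
        \<open>T\<close>, while the next vertex uses \<open>S\<close>; \<open>flip_top\<close> makes
        the two descriptions agree.\<close>
      have "g t = {s. S.flip Y s \<le> enat (Suc q)}"
      proof (cases "t = n")
        case True
        then have "Suc q = n" using q by simp
        then show ?thesis unfolding g_def using True flip_top by simp
      next
        case F: False
        then show ?thesis unfolding g_def using False q by simp
      qed
      moreover have "g (Suc t) = {s. S.flip Y s \<le> enat q}" unfolding g_def using False q by simp
      ultimately show ?thesis using adjI(2)[OF st] by simp
    qed
  qed
  moreover have "g 0 = core (r + 1) \<union> border" unfolding g_def using T.flip_zero by simp
  moreover have "g (2 * n) = core (r + 1) \<union> border" unfolding g_def using T.flip_zero S.flip_zero by simp
  ultimately have le: "flips (?P t) (?P' t) \<subseteq> flips (?P t) (g t)" if "t \<le> 2 * n" for t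
    by (rule minimalD[OF minimal _ _ _ that])
  then have leT: "flips (sub T t) (sub T' t) \<subseteq> flips (sub T t) {s. T.flip X s \<le> enat t}" if "t \<le> n" for t
    using le[of t] that unfolding g_def by simp
  show ?thesis
  proof
    fix k assume km: "k \<in> TT.moved"
    then have k: "k \<in> {1..n}" unfolding TT.moved_def by simp
    let ?v = "T.vr k"
    have lv: "label T ?v = enat k" by (rule T.label_vr[OF k])
    have ne: "label T' ?v \<noteq> enat k" using TT.moved_iff[OF k, of ?v] km lv by simp
    have "T.flip X ?v \<noteq> enat k"
    \<comment> \<open>If the label at \<open>?v\<close> drops, the flip is visible at level
      \<open>k - 1\<close>; if it rises, at level \<open>k\<close>.\<close>
    proof (cases "label T' ?v \<le> enat k")
      case True
      then have lt: "label T' ?v < enat k" using ne by simp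
      then have le1: "label T' ?v \<le> enat (k - 1)" by (cases "label T' ?v") auto
      have "?v \<in> flips (sub T (k - 1)) (sub T' (k - 1))" unfolding flips_def sub_def using le1 lv k by auto
      then have "?v \<in> flips (sub T (k - 1)) {s. T.flip X s \<le> enat (k - 1)}" by (rule subsetD[OF leT, rotated]) (use k in auto)
      then have "T.flip X ?v \<le> enat (k - 1)" unfolding flips_def sub_def using lv k by auto
      then show ?thesis using k by auto
    next
      case False
      have "?v \<in> flips (sub T k) (sub T' k)" unfolding flips_def sub_def using False lv by auto
      then have "?v \<in> flips (sub T k) {s. T.flip X s \<le> enat k}" by (rule subsetD[OF leT, rotated]) (use k in auto)
      then have "\<not> T.flip X ?v \<le> enat k" unfolding flips_def sub_def using lv by auto
      then show ?thesis by auto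
    qed
    then show "k \<in> X" using T.flip_eq_iff[OF X_props(1,2) k T.domino_props(2)[OF k]] by (auto split: if_splits)
  qed
qed

lemma moved_eq: "X = TT.moved"
  using gamma_least[OF good_moved delta_moved] moved_subset unfolding X_def by blast

text \<open>Once \<open>X = TT.moved\<close>, each domino of \<open>T'\<close> is the moved or
  unmoved domino of \<open>T\<close>. Only the zeros need care: vacated squares of
  \<open>delta r\<close> come from \<open>MT\<close>, those never covered from
  \<open>complete_core\<close>.\<close>

theorem MT_eq: "complete_core r (MT r T X) = T'"
proof
  fix s
  have b': "dom T' \<inter> border = {}" using T'(1) unfolding wf_tab_def by simp
  have sp: "T' s = Some k \<longleftrightarrow> s = T.fx k \<or> s = TT.L'.vr k" if "k \<in> {1..n}" for k
    using label_eq_enat[OF b', of k s] TT.L'.label_iff[OF that, of s] TT.fx_agree[OF that] that by simp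
  have spT: "T s = Some k \<longleftrightarrow> s = T.fx k \<or> s = T.vr k" if "k \<in> {1..n}" for k
    using T.label_Some[OF that, of s] T.label_iff[OF that, of s] by simp
  have mv: "TT.L'.vr k = T.vr' k" if "k \<in> X" for k
    using that TT.vr_agree[of k] unfolding moved_eq TT.moved_def by auto
  have nmv: "TT.L'.vr k = T.vr k" if "k \<in> {1..n}" "k \<notin> X" for k
    using that unfolding moved_eq TT.moved_def by auto
  have in': "s \<in> supp' r T k \<longleftrightarrow> T' s = Some k" if "k \<in> X" for k
    using sp[of k] mv[OF that] T.supp'_eq[of k] that X_props(3) by auto
  have sq: "s \<in> squares T X \<longleftrightarrow> (\<exists>k\<in>X. T s = Some k)" unfolding squares_def supp_def by auto
  have z': "T' s = Some 0 \<longleftrightarrow> s \<in> core r \<union> delta r"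
  proof -
    have "s \<in> sub T' 0 \<longleftrightarrow> s \<in> core (r + 1) \<union> border" using T'(1) unfolding wf_tab_def by simp
    then have "s \<in> border \<or> T' s = Some 0 \<longleftrightarrow> s \<in> core r \<union> delta r \<or> s \<in> border" unfolding T.core_Suc by (auto simp: mem_sub)
    moreover have "s \<in> border \<Longrightarrow> T' s \<noteq> Some 0" using b' by auto
    moreover have "s \<in> border \<Longrightarrow> s \<notin> core r \<union> delta r" unfolding border_def core_def delta_def by auto
    ultimately show ?thesis by blast
  qed
  have z: "T s = Some 0 \<longleftrightarrow> s \<in> core r"
  proof -
    have "s \<in> sub T 0 \<longleftrightarrow> s \<in> core r \<union> border" using T.sub_0 by simp
    then have "s \<in> border \<or> T s = Some 0 \<longleftrightarrow> s \<in> core r \<or> s \<in> border" by (auto simp: mem_sub)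
    moreover have "s \<in> border \<Longrightarrow> T s \<noteq> Some 0" using T.dom_border by auto
    moreover have "s \<in> border \<Longrightarrow> s \<notin> core r" unfolding border_def core_def by auto
    ultimately show ?thesis by blast
  qed
  have vals: "T s = None \<or> T s = Some 0 \<or> (\<exists>k\<in>{1..n}. T s = Some k)"
  proof (cases "T s")
    case (Some k)
    then have "k = 0 \<or> k \<in> labels T" unfolding labels_def by (auto intro: ranI)
    then show ?thesis using Some T.labels by auto
  qed simp
  have vals': "T' s = None \<or> T' s = Some 0 \<or> (\<exists>k\<in>{1..n}. T' s = Some k)"
  proof (cases "T' s")
    case (Some k)
    then have "k = 0 \<or> k \<in> labels T'" unfolding labels_def by (auto intro: ranI)
    then show ?thesis using Some T'(2) by auto
  qed simp
  have stay: "T' s = Some k" if "T s = Some k" "k \<in> {1..n}" "k \<notin> X" for k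
    using spT[OF that(2)] sp[OF that(2)] nmv[OF that(2,3)] that(1) by simp
  have stay': "T s = Some k" if "T' s = Some k" "k \<in> {1..n}" "k \<notin> X" for k
    using spT[OF that(2)] sp[OF that(2)] nmv[OF that(2,3)] that(1) by simp
  show "complete_core r (MT r T X) s = T' s"
  proof (cases "\<exists>k\<in>X. T' s = Some k")
    case True
    then obtain k where k: "k \<in> X" "T' s = Some k" by blast
    have "(THE l. l \<in> X \<and> s \<in> supp' r T l) = k"
      by (rule the_equality) (use k in' in auto)
    then have "MT r T X s = Some k" unfolding MT_def using k in' by auto
    then show ?thesis unfolding complete_core_def using k by simp
  next
    case False
    then have M: "MT r T X s = (if s \<in> squares T X then (if s \<in> delta r then Some 0 else None) else T s)"
      unfolding MT_def using in' by auto
    show ?thesis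
    proof (cases "s \<in> squares T X")
      case True
      then obtain k where k: "k \<in> X" "T s = Some k" using sq by blast
      show ?thesis
      proof (cases "s \<in> delta r")
        case d: True
        then show ?thesis using M True z' unfolding complete_core_def by simp
      next
        case d: False
        have "s \<notin> core r" using z k X_props(3) by auto
        then have "T' s \<noteq> Some 0" using z' d by simp
        moreover have "T' s \<noteq> Some l" if "l \<in> {1..n}" for l
          using stay'[OF _ that] False k by (cases "l \<in> X") auto
        ultimately have "T' s = None" using vals' by blast
        then show ?thesis using M True d unfolding complete_core_def by simp
      qed
    next
      case ns: False
      then have M1: "MT r T X s = T s" using M by simp
      from vals consider "T s = None" | "T s = Some 0" | k where "k \<in> {1..n}" "T s = Some k" by (elim disjE bexE)
      then show ?thesis
      proof cases
        case 1
        show ?thesis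
        proof (cases "s \<in> delta r")
          case True then show ?thesis using M1 1 z' unfolding complete_core_def by simp
        next
          case d: False
          have "s \<notin> core r" using z 1 by simp
          then have "T' s \<noteq> Some 0" using z' d by simp
          moreover have "T' s \<noteq> Some l" if "l \<in> {1..n}" for l
            using stay'[OF _ that] False 1 by (cases "l \<in> X") auto
          ultimately have "T' s = None" using vals' by blast
          then show ?thesis using M1 1 d unfolding complete_core_def by simp
        qed
      next
        case 2
        then have "T' s = Some 0" using z z' by simp
        then show ?thesis using M1 2 unfolding complete_core_def by simp
      next
        case (3 k)
        then have "k \<notin> X" using ns sq by blast
        then have "T' s = Some k" using stay 3 by simp
        then show ?thesis using M1 3 unfolding complete_core_def by simp
      qed
    qed
  qed
qed

end

theorem theorem3p1:
  fixes n r :: nat and \<sigma> :: "(nat \<times> nat \<times> int) set"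
  assumes "n \<ge> 1" and "\<sigma> \<in> hyperoctahedral n"
  shows "G (r + 1) n \<sigma> = MMT r (G r n \<sigma>)"
proof -
  interpret signed_perm n \<sigma> using assms(2) by (rule signed_perm.intro)
  define T S T' S' where ts: "T = left_tableau r \<sigma> n" "S = right_tableau r \<sigma> n"
    "T' = left_tableau (r + 1) \<sigma> n" "S' = right_tableau (r + 1) \<sigma> n"
  note g = tableaux_G[where r = r, folded ts(1,2)] and g' = tableaux_G[where r = "r + 1", folded ts(3,4)]
  have e: "(\<lambda>t. if t \<le> n then L r t n else L r n (2 * n - t)) = (\<lambda>t. if t \<le> n then sub T t else sub S (2 * n - t))"
    "(\<lambda>t. if t \<le> n then L (r + 1) t n else L (r + 1) n (2 * n - t)) = (\<lambda>t. if t \<le> n then sub T' t else sub S' (2 * n - t))"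
    using g(6,7) g'(6,7) by (auto simp: fun_eq_iff)
  have m: "minimal r (2 * n) (core (r + 1) \<union> border) (\<lambda>t. if t \<le> n then sub T t else sub S (2 * n - t))
      (\<lambda>t. if t \<le> n then sub T' t else sub S' (2 * n - t))"
    using minimal_G[of r] unfolding e .
  \<comment> \<open>The same path run backwards; at its middle vertex the two descriptions agree
    because \<open>T\<close> and \<open>S\<close> have the same shape.\<close>
  have rev: "minimal r (2 * n) (core (r + 1) \<union> border) (\<lambda>t. if t \<le> n then sub S t else sub T (2 * n - t))
      (\<lambda>t. if t \<le> n then sub S' t else sub T' (2 * n - t))"
  proof -
    have n: "sub S n = sub T n" "sub S' n = sub T' n" using g(6,7) g'(6,7) by simp_all
    show ?thesis
      by (rule minimal_cong[OF minimal_rev[OF m]]) (use n in \<open>auto simp: not_le le_less\<close>)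
  qed
  interpret q1: rank_shift r n T S T' S'
    by unfold_locales (use g g' m in auto)
  interpret q2: rank_shift r n S T S' T'
    by unfold_locales (use g g' rev in auto)
  have "complete_core r (MT r T (\<Union>(\<gamma> r T S))) = T'" "complete_core r (MT r S (\<Union>(\<gamma> r S T))) = S'"
    using q1.MT_eq q2.MT_eq unfolding q1.X_def q2.X_def by auto
  then show ?thesis unfolding G_def MMT_def by (simp add: ts)
qed

end
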